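(* Let $\mathcal{F}$ be a germ of a singular holomorphic foliation at $(\mathbb{C}^2,p)$ and let $C$ be any $\mathcal{F}$-invariant reduced curve. Then $$GSV_p(\mathcal{F},C)=\mu_p(\mathcal{F},C)-\mu_p(C)$$ and $$\mu_p(\mathcal{F},C)-\tau_p(\mathcal{F},C)=\mu_p(C)-\tau_p(C).$$
   Context: A germ of singular holomorphic foliation $\mathcal{F}$ at $(\mathbb{C}^2,p)$ is given in coordinates $(x,y)$ centered at $p$ by a 1-form $\omega=P\,dx+Q\,dy$ with $P,Q\in\mathbb{C}\{x,y\}$ relatively prime and vanishing at $p$, or by the dual vector field $v=-Q\,\partial_x+P\,\partial_y$. A curve $C:f=0$, $f\in\mathbb{C}[[x,y]]$, is $\mathcal{F}$-invariant if $\omega\wedge df=f h\,dx\wedge dy$ for some $h\in\mathbb{C}[[x,y]]$. For a reduced curve $C:f=0$, $\mu_p(C)=\dim_{\mathbb{C}}\mathbb{C}[[x,y]]/(f_x,f_y)$ and $\tau_p(C)=\dim_{\mathbb{C}}\mathbb{C}[[x,y]]/(f,f_x,f_y)$ are its Milnor and Tjurina numbers. For an invariant reduced curve $C:f=0$, the Tjurina number of $\mathcal{F}$ with respect to $C$ is $\tau_p(\mathcal{F},C)=\dim_{\mathbb{C}}\mathbb{C}[[x,y]]/(P,Q,f)$. For an irreducible invariant curve $B$ with primitive parametrization $\gamma(t)$, the multiplicity of $\mathcal{F}$ along $B$ is $\mu_p(\mathcal{F},B)=\mathrm{ord}_t\,\theta(t)$, where $\theta(t)$ is determined by $v(\gamma(t))=\theta(t)\gamma'(t)$.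 For a reduced invariant curve $C=\bigcup_{j=1}^rC_j$ with irreducible components $C_j$, $\mu_p(\mathcal{F},C)=\sum_{j=1}^r\mu_p(\mathcal{F},C_j)-r+1$. GSV-index: for a reduced invariant curve $C:f=0$ there are $g,h$ (each relatively prime to $f$) and a 1-form $\eta$ with $g\omega=h\,df+f\eta$; then $GSV_p(\mathcal{F},C)=\frac{1}{2\pi i}\int_{\partial C}\frac{g}{h}\,d\!\left(\frac{h}{g}\right)$, where $\partial C$ is the link of $C$ at $p$. Equivalently (and this is used when $C$ is only formal) $GSV_p(\mathcal{F},C)=I_p(f,h)-I_p(f,g)$, where $I_p$ is the intersection multiplicity. *)

theory Defs
  imports "HOL-Analysis.Analysis" "HOL-Computational_Algebra.Computational_Algebra"
begin

text \<open>
  The ring $\mathbb{C}[[x,y]]$ is represented as $\mathbb{C}[[x]][[y]]$: the coefficient of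
  $x^i y^j$ in \<open>F\<close> is \<open>F $ j $ i\<close>.  The point $p$ is the origin.
\<close>

type_synonym pseries2 = "complex fps fps"

definition value0 :: "pseries2 \<Rightarrow> complex" where
  "value0 F = F $ 0 $ 0"

definition deriv_x :: "pseries2 \<Rightarrow> pseries2" where
  "deriv_x F = Abs_fps (\<lambda>j. fps_deriv (F $ j))"

definition deriv_y :: "pseries2 \<Rightarrow> pseries2" where
  "deriv_y F = fps_deriv F"

text \<open>The subring $\mathbb{C}\{x,y\}$: absolute convergence on some polydisc.\<close>

definition convergent_series :: "pseries2 set" where
  "convergent_series =
     {F. \<exists>r>0. (\<lambda>(i, j). norm (F $ j $ i) * r ^ i * r ^ j) summable_on UNIV}"

text \<open>
  Relative primality is taken inside a given subring, so that it can be used both in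
  $\mathbb{C}\{x,y\}$ and in $\mathbb{C}[[x,y]]$; the library's \<^const>\<open>coprime\<close> needs a type
  class of which \<^typ>\<open>complex fps fps\<close> is not an instance.
\<close>

definition relatively_prime_in :: "'a :: comm_ring_1 set \<Rightarrow> 'a \<Rightarrow> 'a \<Rightarrow> bool" where
  "relatively_prime_in R a b \<longleftrightarrow>
     (\<forall>d\<in>R. (\<exists>u\<in>R. a = d * u) \<and> (\<exists>v\<in>R. b = d * v) \<longrightarrow> (\<exists>w\<in>R. d * w = 1))"

text \<open>A pair \<open>(A, B)\<close> stands for the 1-form $A\,dx + B\,dy$.\<close>

type_synonym form1 = "pseries2 \<times> pseries2"

definition differential :: "pseries2 \<Rightarrow> form1" where
  "differential f = (deriv_x f, deriv_y f)"

text \<open>The coefficient of $dx\wedge dy$ in the wedge product of two 1-forms.\<close>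

fun wedge :: "form1 \<Rightarrow> form1 \<Rightarrow> pseries2" where
  "wedge (A, B) (C, D) = A * D - B * C"

fun scale_form :: "pseries2 \<Rightarrow> form1 \<Rightarrow> form1" where
  "scale_form g (A, B) = (g * A, g * B)"

text \<open>A pair \<open>(V, W)\<close> of components of a vector field stands for $V\,\partial_x + W\,\partial_y$.\<close>

fun dual_field :: "form1 \<Rightarrow> pseries2 \<times> pseries2" where
  "dual_field (P, Q) = (- Q, P)"

fun singular_foliation :: "form1 \<Rightarrow> bool" where
  "singular_foliation (P, Q) \<longleftrightarrow>
     P \<in> convergent_series \<and> Q \<in> convergent_series \<and>
     relatively_prime_in convergent_series P Q \<and> value0 P = 0 \<and> value0 Q = 0"

text \<open>A (possibly formal) curve $f = 0$ through $p$ whose equation has no multiple factor.\<close>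

definition reduced_curve :: "pseries2 \<Rightarrow> bool" where
  "reduced_curve f \<longleftrightarrow> value0 f = 0 \<and> squarefree f"

definition invariant_curve :: "form1 \<Rightarrow> pseries2 \<Rightarrow> bool" where
  "invariant_curve \<omega> f \<longleftrightarrow> (\<exists>h. wedge \<omega> (differential f) = f * h)"

definition ideal_gen :: "pseries2 set \<Rightarrow> pseries2 set" where
  "ideal_gen S = {\<Sum>s\<in>S. a s * s | a. True}"

definition scalar :: "complex \<Rightarrow> pseries2" where
  "scalar c = fps_const (fps_const c)"

text \<open>
  The classes of the elements of the finite set \<open>B\<close> are pairwise distinct and form a
  $\mathbb{C}$-basis of $\mathbb{C}[[x,y]]/I$.
\<close>

definition quotient_basis :: "pseries2 set \<Rightarrow> pseries2 set \<Rightarrow> bool" where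
  "quotient_basis I B \<longleftrightarrow> finite B \<and>
     (\<forall>F. \<exists>!c. (\<forall>b. b \<notin> B \<longrightarrow> c b = 0) \<and> F - (\<Sum>b\<in>B. scalar (c b) * b) \<in> I)"

text \<open>
  $\dim_{\mathbb{C}} \mathbb{C}[[x,y]]/I$; it is unspecified if that dimension is infinite.
\<close>

definition quotient_dim :: "pseries2 set \<Rightarrow> nat" where
  "quotient_dim I = (THE n. \<exists>B. quotient_basis I B \<and> card B = n)"

definition milnor_number :: "pseries2 \<Rightarrow> nat" where
  "milnor_number f = quotient_dim (ideal_gen {deriv_x f, deriv_y f})"

definition tjurina_number :: "pseries2 \<Rightarrow> nat" where
  "tjurina_number f = quotient_dim (ideal_gen {f, deriv_x f, deriv_y f})"

definition intersection_multiplicity :: "pseries2 \<Rightarrow> pseries2 \<Rightarrow> nat" where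
  "intersection_multiplicity f g = quotient_dim (ideal_gen {f, g})"

fun foliation_tjurina_number :: "form1 \<Rightarrow> pseries2 \<Rightarrow> nat" where
  "foliation_tjurina_number (P, Q) f = quotient_dim (ideal_gen {P, Q, f})"

text \<open>
  The irreducible components of $f = 0$, as the principal ideals generated by the irreducible
  factors of \<open>f\<close>; passing to ideals identifies associated factors.
\<close>

definition curve_components :: "pseries2 \<Rightarrow> pseries2 set set" where
  "curve_components f = {ideal_gen {g} | g. irreducible g \<and> g dvd f}"

text \<open>
  $F(a(t), b(t)) = \sum_j F_j(a(t))\,b(t)^j$ for $F = \sum_j F_j(x)\,y^j$ and $a(0) = b(0) = 0$.
  The terms with $j > n$ do not contribute to the coefficient of $t^n$.
\<close>

fun subst2 :: "pseries2 \<Rightarrow> complex fps \<times> complex fps \<Rightarrow> complex fps" where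
  "subst2 F (a, b) = Abs_fps (\<lambda>n. \<Sum>j\<le>n. (((F $ j) oo a) * b ^ j) $ n)"

text \<open>A nonconstant parametrized arc \<open>(a, b)\<close> centered at the origin on which \<open>I\<close> vanishes.\<close>

fun parametrization :: "complex fps \<times> complex fps \<Rightarrow> pseries2 set \<Rightarrow> bool" where
  "parametrization (a, b) I \<longleftrightarrow>
     a $ 0 = 0 \<and> b $ 0 = 0 \<and> (a, b) \<noteq> (0, 0) \<and> (\<forall>F\<in>I. subst2 F (a, b) = 0)"

text \<open>Primitive: not obtained from another arc by a substitution $t \mapsto s(t)$ of order $> 1$.\<close>

fun primitive_parametrization :: "complex fps \<times> complex fps \<Rightarrow> pseries2 set \<Rightarrow> bool" where
  "primitive_parametrization (a, b) I \<longleftrightarrow>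
     parametrization (a, b) I \<and>
     (\<forall>a' b' s. s $ 0 = 0 \<and> a = a' oo s \<and> b = b' oo s \<longrightarrow> subdegree s = 1)"

definition branch_multiplicity :: "form1 \<Rightarrow> pseries2 set \<Rightarrow> nat" where
  "branch_multiplicity \<omega> I = (THE m. \<exists>a b \<theta>.
     primitive_parametrization (a, b) I \<and>
     subst2 (fst (dual_field \<omega>)) (a, b) = \<theta> * fps_deriv a \<and>
     subst2 (snd (dual_field \<omega>)) (a, b) = \<theta> * fps_deriv b \<and>
     subdegree \<theta> = m)"

definition foliation_multiplicity :: "form1 \<Rightarrow> pseries2 \<Rightarrow> int" where
  "foliation_multiplicity \<omega> f =
     (\<Sum>I\<in>curve_components f. int (branch_multiplicity \<omega> I)) - int (card (curve_components f)) + 1"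

text \<open>The algebraic form of the GSV-index, which also makes sense for formal curves.\<close>

definition gsv_index :: "form1 \<Rightarrow> pseries2 \<Rightarrow> int" where
  "gsv_index \<omega> f = (THE k. \<exists>g h \<eta>.
     relatively_prime_in UNIV g f \<and> relatively_prime_in UNIV h f \<and>
     scale_form g \<omega> = scale_form h (differential f) + scale_form f \<eta> \<and>
     k = int (intersection_multiplicity f h) - int (intersection_multiplicity f g))"

end

theory Submission
  imports Defs
begin

text \<open>
  For an irreducible \<open>g\<close> with primitive parametrization $\gamma$, the image of $\mathbb{C}[[x,y]]$
  in $\mathbb{C}[[t]]$ has finite codimension, so that multiplication by $F(\gamma)$ shows
  $I(g,F) = \mathrm{ord}\, F(\gamma)$.  Choose \<open>c\<close> such that the line $\ell = x - cy$ does not lie on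
  $C : f = 0$, and put $D = f_y + c f_x$ and $H = Q + cP$.  Then $D\omega = H\,df + f\eta$, and on every
  branch $H(\gamma) = -\theta\,\ell(\gamma)'$, whence $\mu(\mathcal{F},C) = I(f,H) - I(f,\ell) + 1$.
  On the branches of the polar curve \<open>D = 0\<close> one has $f(\delta)' = f_x(\delta)\,\ell(\delta)'$, which gives
  Teissier's formula $\mu(C) = I(f,D) - I(f,\ell) + 1$.  Subtracting the two yields the first claim.
  Whenever $g\omega = h\,df + f\eta$, the ideals generated by $gP, gQ$ and by $hf_x, hf_y$ modulo \<open>f\<close> agree,
  so that $I(f,g) + \tau(\mathcal{F},C) = I(f,h) + \tau(C)$.  Hence the index does not depend on the
  choice of $g, h$, and the second claim follows from the first.
\<close>

text \<open>Every invariant rests on a \<open>THE\<close> description, so each number must come with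
  a proof that it exists. Codimension is therefore a relation, \<open>rel_dim\<close>, that asserts
  existence and value together, and splitting chains of subspaces plays the part of exact sequences.

  For a branch, finiteness is the work of primitivity: the orders attained along a primitive arc
  include two consecutive numbers, hence all large ones, and successive approximation puts every
  series of large order into the image of C[[x,y]].

  For the foliation, the obstacle is that \<open>P\<close> and \<open>Q\<close> are coprime among
  convergent series, whereas the branches of \<open>f\<close> may be formal. Weierstrass division
  works in both rings and shows that the ideal (P, Q) contains a power of x. So \<open>P\<close> and
  \<open>Q\<close> can vanish together only on the y-axis, where x would be a common convergent
  factor. Over C[[x,y]] the same argument shows that irreducible series are prime.

  Two primitive arcs of one branch are never compared by a change of parameter: an order along
  either one is the same codimension.\<close>

unbundle no vec_syntax

section \<open>Relative dimension of subspaces\<close>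

locale relative_dimension = vector_space scale
  for scale :: "'a::field \<Rightarrow> 'b::ab_group_add \<Rightarrow> 'b" (infixr "\<cdot>" 75)
begin

definition adjoin :: "'b set \<Rightarrow> 'b \<Rightarrow> 'b set" where
  "adjoin W v = {w + c \<cdot> v | w c. w \<in> W}"

text \<open>Stands for dim (W/T) = n without quotient spaces: a chain from T to W in which each step
  adds one vector that is not yet there. Infinite dimension is the absence of such a chain.\<close>

inductive rel_dim :: "'b set \<Rightarrow> 'b set \<Rightarrow> nat \<Rightarrow> bool" for T where
  rel_dim_refl: "rel_dim T T 0"
| rel_dim_adjoin: "rel_dim T W n \<Longrightarrow> v \<notin> W \<Longrightarrow> rel_dim T (adjoin W v) (Suc n)"

lemma adjoinI: "w \<in> W \<Longrightarrow> w + c \<cdot> v \<in> adjoin W v"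
  by (auto simp: adjoin_def)

lemma adjoin_base: "w \<in> W \<Longrightarrow> w \<in> adjoin W v"
  using adjoinI[of w W 0 v] by simp

lemma adjoin_self: "subspace W \<Longrightarrow> v \<in> adjoin W v"
  using adjoinI[of 0 W 1 v] by (simp add: subspace_0)

lemma subspace_adjoin: assumes "subspace W" shows "subspace (adjoin W v)"
proof (rule subspaceI)
  show "0 \<in> adjoin W v" using assms by (intro adjoin_base) (simp add: subspace_0)
next
  fix x y assume "x \<in> adjoin W v" "y \<in> adjoin W v"
  then obtain w c w' c' where "x = w + c \<cdot> v" "y = w' + c' \<cdot> v" "w \<in> W" "w' \<in> W"
    by (auto simp: adjoin_def)
  then have "x + y = (w + w') + (c + c') \<cdot> v" "w + w' \<in> W"
    using assms by (auto simp: scale_left_distrib subspace_add algebra_simps)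
  then show "x + y \<in> adjoin W v" by (metis adjoinI)
next
  fix k x assume "x \<in> adjoin W v"
  then obtain w c where "x = w + c \<cdot> v" "w \<in> W" by (auto simp: adjoin_def)
  then have "k \<cdot> x = k \<cdot> w + (k * c) \<cdot> v" "k \<cdot> w \<in> W"
    using assms by (auto simp: scale_right_distrib subspace_scale)
  then show "k \<cdot> x \<in> adjoin W v" by (metis adjoinI)
qed

text \<open>One-step Steinitz exchange: u has a nonzero coefficient at v, so v can be recovered from
  u.\<close>

lemma adjoin_exchange:
  assumes W: "subspace W" and u: "u \<in> adjoin W v" "u \<notin> W"
  shows "adjoin W u = adjoin W v"
proof -
  obtain w c where u_eq: "u = w + c \<cdot> v" "w \<in> W" using u by (auto simp: adjoin_def)
  with u have c: "c \<noteq> 0" by auto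
  have "x + d \<cdot> u \<in> adjoin W v" if "x \<in> W" for x d
    using that u W adjoin_base subspace_adjoin[of W v]
    by (metis subspace_add subspace_scale)
  moreover have "x + d \<cdot> v \<in> adjoin W u" if "x \<in> W" for x d
  proof -
    have "v = (1 / c) \<cdot> (u - w)" using c u_eq by simp
    also have "\<dots> \<in> adjoin W u"
      using W u_eq(2) adjoin_self[OF W, of u] adjoin_base subspace_adjoin[OF W, of u]
      by (metis subspace_diff subspace_scale)
    finally have "v \<in> adjoin W u" .
    then show ?thesis using that W adjoin_base subspace_adjoin[OF W, of u]
      by (metis subspace_add subspace_scale)
  qed
  ultimately show ?thesis by (auto simp: adjoin_def[of W u] adjoin_def[of W v])
qed

lemma rel_dim_subspace: "rel_dim T W n \<Longrightarrow> subspace T \<Longrightarrow> subspace W"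
  by (induction rule: rel_dim.induct) (auto intro: subspace_adjoin)

lemma rel_dim_subset: "rel_dim T W n \<Longrightarrow> T \<subseteq> W"
  by (induction rule: rel_dim.induct) (auto intro: adjoin_base)

lemma rel_dim_trans:
  assumes "rel_dim U W n" "rel_dim T U m" shows "rel_dim T W (m + n)"
  using assms by (induction rule: rel_dim.induct) (auto intro: rel_dim.intros)

text \<open>Intersecting a chain with U leaves each step either trivial or again one-dimensional; in
  the second case the exchange lemma lets the new vector be taken from U.\<close>

lemma rel_dim_inter:
  assumes "rel_dim T W n" "subspace T" "subspace U" "T \<subseteq> U"
  obtains p where "rel_dim T (U \<inter> W) p"
  using assms(1)
proof (induction arbitrary: thesis rule: rel_dim.induct)
  case rel_dim_refl
  show ?case using rel_dim_refl[of 0] assms(4) by (metis inf.absorb2 rel_dim.rel_dim_refl)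
next
  case (rel_dim_adjoin W n v)
  then obtain p where p: "rel_dim T (U \<inter> W) p" by metis
  have W: "subspace W" using rel_dim_adjoin.hyps assms rel_dim_subspace by auto
  show ?case
  proof (cases "U \<inter> adjoin W v \<subseteq> W")
    case True
    then have "U \<inter> adjoin W v = U \<inter> W" using adjoin_base by blast
    then show ?thesis using p rel_dim_adjoin.prems by metis
  next
    case False
    then obtain u where u: "u \<in> U" "u \<in> adjoin W v" "u \<notin> W" by auto
    have eq: "U \<inter> adjoin W v = adjoin (U \<inter> W) u"
    proof (rule set_eqI, rule iffI)
      fix x assume x: "x \<in> U \<inter> adjoin W v"
      then have "x \<in> adjoin W u" using adjoin_exchange[OF W u(2,3)] by simp
      then obtain w c where w: "x = w + c \<cdot> u" "w \<in> W" by (auto simp: adjoin_def)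
      then have "w = x - c \<cdot> u" by simp
      then have "w \<in> U" using x u assms(3) by (metis IntD1 subspace_diff subspace_scale)
      with w show "x \<in> adjoin (U \<inter> W) u" by (auto simp: adjoin_def)
    next
      fix x assume "x \<in> adjoin (U \<inter> W) u"
      then obtain w c where w: "x = w + c \<cdot> u" "w \<in> W" "w \<in> U" by (auto simp: adjoin_def)
      then have "x \<in> U" using u assms(3) by (metis subspace_add subspace_scale)
      moreover have "x \<in> adjoin W v" using w adjoinI adjoin_exchange[OF W u(2,3)] by metis
      ultimately show "x \<in> U \<inter> adjoin W v" by simp
    qed
    have "rel_dim T (adjoin (U \<inter> W) u) (Suc p)"
      using p u by (intro rel_dim.rel_dim_adjoin) auto
    then show ?thesis using rel_dim_adjoin.prems eq by metis
  qed
qed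

text \<open>Dual to the intersection: adding U to every member of the chain turns it into a chain
  that starts at U, once steps whose vector is already present are dropped.\<close>

lemma rel_dim_sum:
  assumes "rel_dim T W n" "subspace T" "subspace U" "T \<subseteq> U" "U \<subseteq> W"
  obtains p where "rel_dim U W p"
proof -
  define S where "S X = {u + x | u x. u \<in> U \<and> x \<in> X}" for X
  have "\<exists>p. rel_dim U (S W) p" using assms(1)
  proof (induction rule: rel_dim.induct)
    case rel_dim_refl
    have "u \<in> S T" if "u \<in> U" for u
      using that assms(2) subspace_0 unfolding S_def
      by (intro CollectI exI[of _ u] exI[of _ 0]) auto
    moreover have "u + t \<in> U" if "u \<in> U" "t \<in> T" for u t
      using that assms(3,4) subspace_add by blast
    ultimately have "S T = U" unfolding S_def by blast
    then show ?case using rel_dim.rel_dim_refl by metis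
  next
    case (rel_dim_adjoin W n v)
    then obtain p where p: "rel_dim U (S W) p" by auto
    have eq: "S (adjoin W v) = adjoin (S W) v"
      unfolding S_def adjoin_def by (force simp: add.assoc)
    have sub: "subspace (S W)" using p assms rel_dim_subspace by auto
    show ?case
    proof (cases "v \<in> S W")
      case True
      then have "adjoin (S W) v = S W"
        using sub adjoin_base by (auto simp: adjoin_def subspace_add subspace_scale) 
      then show ?thesis using p eq by auto
    next
      case False
      then show ?thesis unfolding eq using rel_dim.rel_dim_adjoin[OF p] by blast
    qed
  qed
  moreover have "S W = W"
  proof -
    have sub: "subspace W" using assms rel_dim_subspace by auto
    have "w \<in> S W" if "w \<in> W" for w
      using that assms(3) subspace_0 unfolding S_def
      by (intro CollectI exI[of _ 0] exI[of _ w]) auto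
    moreover have "u + w \<in> W" if "u \<in> U" "w \<in> W" for u w
      using that assms(5) sub subspace_add by blast
    ultimately show ?thesis unfolding S_def by blast
  qed
  ultimately show ?thesis using that by auto
qed

lemma rel_dim_between:
  assumes "rel_dim T W n" "subspace T" "subspace U" "T \<subseteq> U" "U \<subseteq> W"
  obtains p q where "rel_dim U W p" "rel_dim T U q"
proof -
  obtain p where "rel_dim U W p" using rel_dim_sum[OF assms] .
  moreover obtain q where "rel_dim T (U \<inter> W) q" using rel_dim_inter[OF assms(1-4)] .
  moreover have "U \<inter> W = U" using assms by auto
  ultimately show ?thesis using that by metis
qed

text \<open>Strong induction that compares the last steps of two chains. If their hyperplanes W0 and
  W1 of W differ, the intersection of W0 and W1 has codimension one in each, which links the two
  lengths.\<close>

lemma rel_dim_unique: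
  assumes "rel_dim T W n" "rel_dim T W m" "subspace T"
  shows "m = n"
  using assms(1,2)
proof (induction arbitrary: W m rule: nat_less_induct[of _ n])
  case (1 n)
  note T = \<open>subspace T\<close>
  from 1(2) show ?case
  proof (cases rule: rel_dim.cases)
    case rel_dim_refl
    from 1(3) show ?thesis
    proof (cases rule: rel_dim.cases)
      case (rel_dim_adjoin W' k v)
      have "v \<in> adjoin W' v" using rel_dim_adjoin rel_dim_subspace T adjoin_self by blast
      moreover have "T \<subseteq> W'" using rel_dim_adjoin rel_dim_subset by auto
      ultimately show ?thesis using rel_dim_adjoin rel_dim_refl by auto
    qed (use rel_dim_refl in auto)
  next
    case A: (rel_dim_adjoin W0 n0 v)
    have W0: "subspace W0" using A rel_dim_subspace T by blast
    from 1(3) show ?thesis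
    proof (cases rule: rel_dim.cases)
      case rel_dim_refl
      have "v \<in> adjoin W0 v" using W0 adjoin_self by blast
      moreover have "T \<subseteq> W0" using A rel_dim_subset by auto
      ultimately show ?thesis using A rel_dim_refl by auto
    next
      case B: (rel_dim_adjoin W1 m0 v')
      have W1: "subspace W1" using B rel_dim_subspace T by blast
      have ih: "m = n0" if "rel_dim T X n0" "rel_dim T X m" for X m
        using 1(1) that A(2) by (metis lessI)
      show ?thesis
      proof (cases "W0 = W1")
        case True
        then show ?thesis using ih A B by blast
      next
        case False
        have TW: "T \<subseteq> W1" using B rel_dim_subset by auto
        obtain p where p: "rel_dim T (W1 \<inter> W0) p" using rel_dim_inter[OF A(3) T W1 TW] .
        have nsub1: "\<not> W0 \<subseteq> W1"
        proof
          assume s: "W0 \<subseteq> W1"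
          with False obtain u where u: "u \<in> W1" "u \<notin> W0" by auto
          then have "u \<in> adjoin W0 v" using A(1) B(1) adjoin_base by auto
          then have "adjoin W0 u = W" using adjoin_exchange W0 u A by auto
          moreover have "adjoin W0 u \<subseteq> W1"
            using s u W1 by (auto simp: adjoin_def subspace_add subspace_scale subset_iff)
          moreover have "v' \<in> W" using B(1) W1 adjoin_self by auto
          ultimately show False using B by auto
        qed
        have nsub0: "\<not> W1 \<subseteq> W0"
        proof
          assume s: "W1 \<subseteq> W0"
          with False obtain u where u: "u \<in> W0" "u \<notin> W1" by auto
          then have "u \<in> adjoin W1 v'" using A(1) B(1) adjoin_base by auto
          then have "adjoin W1 u = W" using adjoin_exchange W1 u B by auto
          moreover have "adjoin W1 u \<subseteq> W0"
            using s u W0 by (auto simp: adjoin_def subspace_add subspace_scale subset_iff)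
          moreover have "v \<in> W" using A(1) W0 adjoin_self by auto
          ultimately show False using A by auto
        qed
        \<comment> \<open>To be used with (W0, W1) and with (W1, W0): an element of X outside Y
          spans W over Y, hence spans X over the intersection.\<close>
        have hyper: "rel_dim T X (Suc p)"
          if X: "subspace X" and Y: "subspace Y" and XY: "X \<inter> Y = W1 \<inter> W0" 
            and n: "\<not> X \<subseteq> Y" and ad: "W = adjoin Y y" "X \<subseteq> W" for X Y y
        proof -
          obtain u where u: "u \<in> X" "u \<notin> Y" using n by auto
          have W: "W = adjoin Y u" using adjoin_exchange[of Y u y] Y u ad by auto
          have "X = adjoin (X \<inter> Y) u"
          proof (rule set_eqI, rule iffI)
            fix x assume x: "x \<in> X"
            then obtain w c where w: "x = w + c \<cdot> u" "w \<in> Y" 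
              using ad(2) W by (auto simp: adjoin_def)
            then have "w = x - c \<cdot> u" by simp
            then have "w \<in> X" using x u X by (metis subspace_diff subspace_scale)
            with w show "x \<in> adjoin (X \<inter> Y) u" by (auto simp: adjoin_def)
          next
            fix x assume "x \<in> adjoin (X \<inter> Y) u"
            then show "x \<in> X" using u X by (auto simp: adjoin_def subspace_add subspace_scale)
          qed
          moreover have "rel_dim T (adjoin (X \<inter> Y) u) (Suc p)"
            using p u XY by (intro rel_dim.rel_dim_adjoin) auto
          ultimately show ?thesis by metis
        qed
        have "rel_dim T W0 (Suc p)"
          using hyper[OF W0 W1 _ nsub1 B(1)] A(1) adjoin_base by blast
        moreover have "rel_dim T W1 (Suc p)"
          using hyper[OF W1 W0 _ nsub0 A(1)] B(1) adjoin_base by blast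
        \<comment> \<open>The induction hypothesis is available for n0 alone: on W0 it yields Suc p
          = n0, after which W1 has a chain of length n0 and m0 = n0 follows.\<close>
        ultimately show ?thesis using ih A B by metis
      qed
    qed
  qed
qed

text \<open>Adding the members of B one at a time gives a chain; independence modulo T says that no
  step is trivial. With its converse below, this ties chains to the bases of
  \<open>quotient_basis\<close>.\<close>

lemma rel_dim_basis_imp:
  assumes "finite B" "subspace T"
    and indep: "\<And>c. (\<Sum>b\<in>B. c b \<cdot> b) \<in> T \<Longrightarrow> \<forall>b\<in>B. c b = 0"
  shows "rel_dim T {t + (\<Sum>b\<in>B. c b \<cdot> b) | t c. t \<in> T} (card B)"
  using assms(1,3)
proof (induction B rule: finite_induct)
  case empty
  have "{t + (\<Sum>b\<in>{}. c b \<cdot> b) | t c. t \<in> T} = T" by auto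
  then show ?case using rel_dim_refl by simp
next
  case (insert v B)
  let ?S = "\<lambda>B. {t + (\<Sum>b\<in>B. c b \<cdot> b) | t c. t \<in> T}"
  have upd: "(\<Sum>b\<in>B. (c(v := k)) b \<cdot> b) = (\<Sum>b\<in>B. c b \<cdot> b)" for c k
    using insert by (intro sum.cong) auto
  have ih: "rel_dim T (?S B) (card B)"
  proof (rule insert.IH)
    fix c assume "(\<Sum>b\<in>B. c b \<cdot> b) \<in> T"
    then have "(\<Sum>b\<in>insert v B. (c(v := 0)) b \<cdot> b) \<in> T"
      using insert upd[of c 0] by simp
    then have "\<forall>b\<in>insert v B. (c(v := 0)) b = 0" using insert.prems[of "c(v := 0)"] by blast
    then show "\<forall>b\<in>B. c b = 0" using insert by (metis fun_upd_other insertCI)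
  qed
  have v: "v \<notin> ?S B"
  proof
    assume "v \<in> ?S B"
    then obtain t c where t: "v = t + (\<Sum>b\<in>B. c b \<cdot> b)" "t \<in> T" by auto
    \<comment> \<open>The coefficient -1 at v turns the expression for v into a linear relation
      modulo T.\<close>
    have "(\<Sum>b\<in>insert v B. (c(v := -1)) b \<cdot> b) = - t"
      using insert upd[of c "-1"] t(1) by (simp add: algebra_simps)
    then have "\<forall>b\<in>insert v B. (c(v := -1)) b = 0" 
      using insert.prems t(2) assms(2) by (metis subspace_neg)
    then show False by (metis fun_upd_same insertI1 neg_equal_0_iff_equal zero_neq_one)
  qed
  have "?S (insert v B) = adjoin (?S B) v"
  proof (rule set_eqI, rule iffI)
    fix x assume "x \<in> ?S (insert v B)"
    then obtain t c where t: "x = t + (\<Sum>b\<in>insert v B. c b \<cdot> b)" "t \<in> T" by auto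
    then have "x = (t + (\<Sum>b\<in>B. c b \<cdot> b)) + c v \<cdot> v"
      using insert by (simp add: algebra_simps)
    then show "x \<in> adjoin (?S B) v" using t unfolding adjoin_def by blast
  next
    fix x assume "x \<in> adjoin (?S B) v"
    then obtain t c k where t: "x = (t + (\<Sum>b\<in>B. c b \<cdot> b)) + k \<cdot> v" "t \<in> T" 
      unfolding adjoin_def by blast
    then have "x = t + (\<Sum>b\<in>insert v B. (c(v := k)) b \<cdot> b)"
      using insert upd[of c k] by (simp add: algebra_simps)
    then show "x \<in> ?S (insert v B)" using t by blast
  qed
  then show ?case using rel_dim_adjoin[OF ih v] insert by simp
qed

lemma rel_dim_imp_basis:
  assumes "rel_dim T W n" "subspace T"
  obtains B where "finite B" "card B = n"
    "\<And>c. (\<Sum>b\<in>B. c b \<cdot> b) \<in> T \<Longrightarrow> \<forall>b\<in>B. c b = 0"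
    "\<And>w. w \<in> W \<Longrightarrow> \<exists>c. w - (\<Sum>b\<in>B. c b \<cdot> b) \<in> T" "B \<subseteq> W"
  using assms(1)
proof (induction arbitrary: thesis rule: rel_dim.induct)
  case rel_dim_refl
  show ?case by (rule rel_dim_refl[of "{}"]) auto
next
  case (rel_dim_adjoin W n v)
  obtain B where B: "finite B" "card B = n"
    "\<And>c. (\<Sum>b\<in>B. c b \<cdot> b) \<in> T \<Longrightarrow> \<forall>b\<in>B. c b = 0"
    "\<And>w. w \<in> W \<Longrightarrow> \<exists>c. w - (\<Sum>b\<in>B. c b \<cdot> b) \<in> T" "B \<subseteq> W"
    using rel_dim_adjoin.IH by blast
  have W: "subspace W" using rel_dim_adjoin.hyps assms rel_dim_subspace by auto
  have TW: "T \<subseteq> W" using rel_dim_adjoin.hyps rel_dim_subset by auto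
  have vB: "v \<notin> B" using B rel_dim_adjoin.hyps by auto
  show ?case
  proof (rule rel_dim_adjoin.prems[of "insert v B"])
    show "finite (insert v B)" "card (insert v B) = Suc n" using B vB by auto
    show "insert v B \<subseteq> adjoin W v" using B(5) adjoin_base[of _ W v] adjoin_self[OF W, of v] by auto
  next
    fix c assume c: "(\<Sum>b\<in>insert v B. c b \<cdot> b) \<in> T"
    have cv: "c v = 0"
    proof (rule ccontr)
      assume nz: "c v \<noteq> 0"
      have sB: "(\<Sum>b\<in>B. c b \<cdot> b) \<in> W" using B W
        by (intro subspace_sum) (auto intro: subspace_scale)
      have "c v \<cdot> v = (\<Sum>b\<in>insert v B. c b \<cdot> b) - (\<Sum>b\<in>B. c b \<cdot> b)" using B vB by simp
      also have "\<dots> \<in> W" using c TW sB W by (intro subspace_diff) auto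
      finally have "(1 / c v) \<cdot> (c v \<cdot> v) \<in> W" using W subspace_scale by blast
      then show False using nz rel_dim_adjoin.hyps by simp
    qed
    then show "\<forall>b\<in>insert v B. c b = 0" using c B vB by simp
  next
    fix w assume "w \<in> adjoin W v"
    then obtain w' k where w: "w = w' + k \<cdot> v" "w' \<in> W" by (auto simp: adjoin_def)
    obtain c where c: "w' - (\<Sum>b\<in>B. c b \<cdot> b) \<in> T" using B(4)[OF w(2)] by blast
    have "(\<Sum>b\<in>B. (c(v := k)) b \<cdot> b) = (\<Sum>b\<in>B. c b \<cdot> b)"
      using vB by (intro sum.cong) auto
    then have "w - (\<Sum>b\<in>insert v B. (c(v := k)) b \<cdot> b) = w' - (\<Sum>b\<in>B. c b \<cdot> b)"
      using w B vB by simp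
    with c have "w - (\<Sum>b\<in>insert v B. (c(v := k)) b \<cdot> b) \<in> T" by simp
    then show "\<exists>c. w - (\<Sum>b\<in>insert v B. c b \<cdot> b) \<in> T" by blast
  qed
qed

end

text \<open>The last hypothesis makes the induced map from W/U to the quotient by T injective, so
  the steps of the chain stay nontrivial under \<phi>.\<close>

lemma rel_dim_image:
  assumes lin: "Vector_Spaces.linear s1 s2 \<phi>"
    and "relative_dimension.rel_dim s1 U W n" "module.subspace s1 U" "module.subspace s2 T"
    and "\<And>w. w \<in> W \<Longrightarrow> \<phi> w \<in> T \<longleftrightarrow> w \<in> U"
  shows "relative_dimension.rel_dim s2 T {t + \<phi> w | t w. t \<in> T \<and> w \<in> W} n"
proof -
  interpret Vector_Spaces.linear s1 s2 \<phi> by fact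
  interpret d1: relative_dimension s1 ..
  interpret d2: relative_dimension s2 ..
  from assms(2,5) show ?thesis
  proof (induction rule: d1.rel_dim.induct)
    case rel_dim_refl
    have "{t + \<phi> w | t w. t \<in> T \<and> w \<in> U} = T"
    proof (rule set_eqI, rule iffI)
      fix x assume "x \<in> {t + \<phi> w | t w. t \<in> T \<and> w \<in> U}"
      then show "x \<in> T" using rel_dim_refl assms(4) vs2.subspace_add by auto
    next
      fix x assume "x \<in> T"
      then have "x = x + \<phi> 0 \<and> x \<in> T \<and> 0 \<in> U" using assms(3) vs1.subspace_0 by (simp add: zero)
      then show "x \<in> {t + \<phi> w | t w. t \<in> T \<and> w \<in> U}" by blast
    qed
    then show ?case using d2.rel_dim_refl by simp
  next
    case (rel_dim_adjoin W n v)
    let ?S = "\<lambda>W. {t + \<phi> w | t w. t \<in> T \<and> w \<in> W}"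
    have W: "vs1.subspace W" "U \<subseteq> W"
      using rel_dim_adjoin.hyps assms d1.rel_dim_subspace d1.rel_dim_subset by auto
    have ih: "d2.rel_dim T (?S W) n" 
      using rel_dim_adjoin.IH rel_dim_adjoin.prems d1.adjoin_base by blast
    have "\<phi> v \<notin> ?S W"
    proof
      assume "\<phi> v \<in> ?S W"
      then obtain t w where tw: "\<phi> v = t + \<phi> w" "t \<in> T" "w \<in> W" by auto
      have "v - w \<in> d1.adjoin W v"
        using tw(3) W d1.adjoin_base d1.adjoin_self d1.subspace_adjoin
        by (metis vs1.subspace_diff)
      moreover have "\<phi> (v - w) \<in> T" using tw by (simp add: diff)
      ultimately have "v - w \<in> W" using rel_dim_adjoin.prems W by blast
      then have "v \<in> W" using tw(3) W(1) vs1.subspace_add by fastforce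
      then show False using rel_dim_adjoin.hyps by simp
    qed
    then have "d2.rel_dim T (d2.adjoin (?S W) (\<phi> v)) (Suc n)"
      by (intro d2.rel_dim_adjoin ih)
    moreover have "d2.adjoin (?S W) (\<phi> v) = ?S (d1.adjoin W v)"
    proof (rule set_eqI, rule iffI)
      fix x assume "x \<in> d2.adjoin (?S W) (\<phi> v)"
      then obtain t w c where tw: "x = (t + \<phi> w) + s2 c (\<phi> v)" "t \<in> T" "w \<in> W"
        unfolding d2.adjoin_def by blast
      then have "x = t + \<phi> (w + s1 c v)" by (simp add: add scale algebra_simps)
      moreover have "w + s1 c v \<in> d1.adjoin W v" using tw by (intro d1.adjoinI)
      ultimately show "x \<in> ?S (d1.adjoin W v)" using tw(2) by blast
    next
      fix x assume "x \<in> ?S (d1.adjoin W v)"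
      then obtain t w c where tw: "x = t + \<phi> (w + s1 c v)" "t \<in> T" "w \<in> W"
        unfolding d1.adjoin_def by blast
      then have xe: "x = (t + \<phi> w) + s2 c (\<phi> v)" by (simp add: add scale algebra_simps)
      have "t + \<phi> w \<in> ?S W" using tw by blast
      then show "x \<in> d2.adjoin (?S W) (\<phi> v)" unfolding xe by (rule d2.adjoinI)
    qed
    ultimately show ?case by simp
  qed
qed

text \<open>Here the last hypothesis is surjectivity onto W' modulo T: each vector added in the
  target is replaced by the image of some u in W, and these u form the chain of preimages.\<close>

lemma rel_dim_vimage:
  assumes lin: "Vector_Spaces.linear s1 s2 \<phi>"
    and "relative_dimension.rel_dim s2 T W' n" "module.subspace s2 T" "module.subspace s1 W"
    and "W' \<subseteq> {t + \<phi> w | t w. t \<in> T \<and> w \<in> W}"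
  shows "relative_dimension.rel_dim s1 {w \<in> W. \<phi> w \<in> T} {w \<in> W. \<phi> w \<in> W'} n"
proof -
  interpret Vector_Spaces.linear s1 s2 \<phi> by fact
  interpret d1: relative_dimension s1 ..
  interpret d2: relative_dimension s2 ..
  from assms(2,5) show ?thesis
  proof (induction rule: d2.rel_dim.induct)
    case rel_dim_refl
    show ?case by (rule d1.rel_dim_refl)
  next
    case (rel_dim_adjoin W' n v)
    let ?S = "\<lambda>W'. {w \<in> W. \<phi> w \<in> W'}"
    have W': "vs2.subspace W'" "T \<subseteq> W'"
      using rel_dim_adjoin.hyps assms d2.rel_dim_subspace d2.rel_dim_subset by auto
    have ih: "d1.rel_dim (?S T) (?S W') n" 
      using rel_dim_adjoin.IH rel_dim_adjoin.prems d2.adjoin_base by blast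
    have "v \<in> d2.adjoin W' v" using W' d2.adjoin_self by auto
    then obtain t u where tu: "v = t + \<phi> u" "t \<in> T" "u \<in> W"
      using subsetD[OF rel_dim_adjoin.prems] by blast
    have u_ad: "\<phi> u \<in> d2.adjoin W' v"
    proof -
      have "\<phi> u = v - t" using tu by simp
      moreover have "v \<in> d2.adjoin W' v" "t \<in> d2.adjoin W' v"
        using tu(2) W' by (auto intro: d2.adjoin_base d2.adjoin_self)
      ultimately show ?thesis using W' by (metis d2.subspace_adjoin vs2.subspace_diff)
    qed
    have u: "\<phi> u \<notin> W'"
    proof
      assume "\<phi> u \<in> W'"
      then have "v \<in> W'" using tu W' vs2.subspace_add by blast
      then show False using rel_dim_adjoin.hyps by simp
    qed
    have eq: "d2.adjoin W' v = d2.adjoin W' (\<phi> u)"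
      using d2.adjoin_exchange[OF W'(1) u_ad u] by simp
    have "?S (d2.adjoin W' v) = d1.adjoin (?S W') u"
    proof (rule set_eqI, rule iffI)
      fix x assume x: "x \<in> ?S (d2.adjoin W' v)"
      then have "\<phi> x \<in> d2.adjoin W' (\<phi> u)" using eq by auto
      then obtain w c where w: "\<phi> x = w + s2 c (\<phi> u)" "w \<in> W'" unfolding d2.adjoin_def by blast
      have "x = (x - s1 c u) + s1 c u" by simp
      moreover have "x - s1 c u \<in> W" using x tu(3) assms(4)
        by (auto intro!: vs1.subspace_diff vs1.subspace_scale)
      moreover have "\<phi> (x - s1 c u) \<in> W'" using w by (simp add: diff scale)
      ultimately show "x \<in> d1.adjoin (?S W') u" unfolding d1.adjoin_def by blast
    next
      fix x assume "x \<in> d1.adjoin (?S W') u"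
      then obtain w c where w: "x = w + s1 c u" "w \<in> W" "\<phi> w \<in> W'" unfolding d1.adjoin_def by blast
      then have "x \<in> W" using tu(3) assms(4) by (auto intro!: vs1.subspace_add vs1.subspace_scale)
      moreover have "\<phi> x \<in> d2.adjoin W' (\<phi> u)" using w
        by (auto simp: add scale intro: d2.adjoinI)
      ultimately show "x \<in> ?S (d2.adjoin W' v)" unfolding eq by simp
    qed
    then show ?case using d1.rel_dim_adjoin[OF ih, of u] u by simp
  qed
qed

section \<open>Power series along an arc\<close>

lemma subst2_nth: "subst2 F (a, b) $ n = (\<Sum>j\<le>n. (F $ j oo a) * b ^ j) $ n"
  by (simp add: fps_sum_nth)

declare subst2.simps [simp del]

text \<open>Since b has no constant term, b^j starts in degree j or later. Any sufficiently long
  finite sum may then stand for the substitution, which lets two series be truncated at a common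
  bound.\<close>

lemma subst2_nth_truncate:
  assumes "b $ 0 = 0" "n \<le> N"
  shows "subst2 F (a, b) $ n = (\<Sum>j\<le>N. (F $ j oo a) * b ^ j) $ n"
proof -
  have "((F $ j oo a) * b ^ j) $ n = 0" if "j > n" for j
  proof -
    have "b ^ j $ i = 0" if "i \<le> n" for i
      using \<open>j > n\<close> that assms(1) startsby_zero_power_prefix[of b j] by auto
    then show ?thesis by (simp add: fps_mult_nth)
  qed
  then have "(\<Sum>j\<le>n. ((F $ j oo a) * b ^ j) $ n) = (\<Sum>j\<le>N. ((F $ j oo a) * b ^ j) $ n)"
    using assms(2) by (intro sum.mono_neutral_left) auto
  then show ?thesis by (simp add: subst2_nth fps_sum_nth)
qed

lemma subst2_mult_nth_truncate:
  assumes "b $ 0 = 0" "n \<le> N"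
  shows "(subst2 F (a, b) * H) $ n = ((\<Sum>j\<le>N. (F $ j oo a) * b ^ j) * H) $ n"
  using assms by (auto simp: fps_mult_nth subst2_nth_truncate[where N = N] intro!: sum.cong)

lemma subst2_nth_0: "subst2 F (a, b) $ 0 = value0 F"
  by (simp add: subst2_nth value0_def)

lemma subst2_add: "subst2 (F + G) (a, b) = subst2 F (a, b) + subst2 G (a, b)"
  by (rule fps_ext)
     (simp add: subst2_nth fps_compose_add_distrib distrib_right sum.distrib del: fps_sum_nth)

lemma subst2_uminus: "subst2 (- F) (a, b) = - subst2 F (a, b)"
  by (rule fps_ext) (simp add: subst2_nth fps_compose_uminus sum_negf del: fps_sum_nth)

lemma subst2_diff: "subst2 (F - G) (a, b) = subst2 F (a, b) - subst2 G (a, b)"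
  using subst2_add[of F "- G" a b] by (simp add: subst2_uminus)

lemma subst2_fps_const: "subst2 (fps_const H) (a, b) = H oo a"
proof (rule fps_ext)
  fix n
  have "(\<Sum>j\<le>n. (fps_const H $ j oo a) * b ^ j) = (\<Sum>j\<le>n. if j = 0 then H oo a else 0)"
    by (intro sum.cong) auto
  then show "subst2 (fps_const H) (a, b) $ n = (H oo a) $ n"
    by (simp add: subst2_nth del: fps_sum_nth)
qed

lemma subst2_scalar: "subst2 (scalar c) (a, b) = fps_const c"
  by (simp add: scalar_def subst2_fps_const)

lemma subst2_0: "subst2 0 (a, b) = 0"
  using subst2_fps_const[of 0] by simp

lemma subst2_1: "subst2 1 (a, b) = 1"
  using subst2_fps_const[of 1] by simp

lemma subst2_x: "a $ 0 = 0 \<Longrightarrow> subst2 (fps_const fps_X) (a, b) = a"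
  by (simp add: subst2_fps_const)

lemma subst2_in_y: "subst2 (Abs_fps (\<lambda>j. fps_const (h $ j))) (a, b) = h oo b"
  by (rule fps_ext) (simp add: subst2_nth fps_compose_nth fps_sum_nth atLeast0AtMost)

lemma subst2_y: "b $ 0 = 0 \<Longrightarrow> subst2 fps_X (a, b) = b"
proof -
  assume b: "b $ 0 = 0"
  have "fps_X = (Abs_fps (\<lambda>j. fps_const ((fps_X :: complex fps) $ j)) :: pseries2)"
    by (rule fps_ext) (simp add: fps_X_def)
  then show ?thesis using subst2_in_y[of fps_X a b] b by simp
qed

lemma subst2_mult:
  assumes "a $ 0 = 0" "b $ 0 = 0"
  shows "subst2 (F * G) (a, b) = subst2 F (a, b) * subst2 G (a, b)"
proof (rule fps_ext)
  fix n
  let ?h = "\<lambda>j k. ((F $ j oo a) * (G $ k oo a) * b ^ (j + k)) $ n"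
  have z: "?h j k = 0" if "n < j + k" for j k
  proof -
    have "b ^ (j + k) $ i = 0" if "i \<le> n" for i
      using \<open>n < j + k\<close> that assms(2) startsby_zero_power_prefix[of b "j + k"] by auto
    then show ?thesis by (simp add: fps_mult_nth)
  qed
  have "(subst2 F (a, b) * subst2 G (a, b)) $ n
      = ((\<Sum>j\<le>n. (F $ j oo a) * b ^ j) * subst2 G (a, b)) $ n"
    using assms by (intro subst2_mult_nth_truncate) auto
  also have "\<dots> = ((\<Sum>k\<le>n. (G $ k oo a) * b ^ k) * (\<Sum>j\<le>n. (F $ j oo a) * b ^ j)) $ n"
    by (subst mult.commute, rule subst2_mult_nth_truncate) (use assms in auto)
  also have "\<dots> = ((\<Sum>j\<le>n. (F $ j oo a) * b ^ j) * (\<Sum>k\<le>n. (G $ k oo a) * b ^ k)) $ n"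
    by (simp only: mult.commute)
  also have "\<dots> = (\<Sum>j\<le>n. \<Sum>k\<le>n. ?h j k)"
    by (simp only: sum_product fps_sum_nth) (simp add: power_add mult_ac)
  also have "\<dots> = (\<Sum>(j, k)\<in>{..n} \<times> {..n}. ?h j k)"
    by (simp add: sum.cartesian_product)
  \<comment> \<open>The square of indices may be cut down to the triangle, since b^(j+k) has no
    terms of degree n or less outside it.\<close>
  also have "\<dots> = (\<Sum>(j, k)\<in>{(j, k). j + k \<le> n}. ?h j k)"
    by (rule sum.mono_neutral_right) (use z in \<open>force simp: not_le\<close>)+
  also have "\<dots> = (\<Sum>l\<le>n. \<Sum>j\<le>l. ?h j (l - j))"
    by (rule sum.triangle_reindex_eq)
  also have "\<dots> = (\<Sum>l\<le>n. (((F * G) $ l oo a) * b ^ l) $ n)"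
  proof (rule sum.cong)
    fix l assume "l \<in> {..n}"
    have "((F * G) $ l oo a) = (\<Sum>j\<le>l. (F $ j oo a) * (G $ (l - j) oo a))"
      using assms(1)
      by (simp add: fps_mult_nth fps_compose_sum_distrib fps_compose_mult_distrib atLeast0AtMost)
    then show "(\<Sum>j\<le>l. ?h j (l - j)) = (((F * G) $ l oo a) * b ^ l) $ n"
      by (simp add: sum_distrib_right fps_sum_nth)
  qed simp
  also have "\<dots> = subst2 (F * G) (a, b) $ n" by (simp add: subst2_nth fps_sum_nth)
  finally show "subst2 (F * G) (a, b) $ n = (subst2 F (a, b) * subst2 G (a, b)) $ n" ..
qed

lemma subst2_power:
  assumes "a $ 0 = 0" "b $ 0 = 0"
  shows "subst2 (F ^ n) (a, b) = subst2 F (a, b) ^ n"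
  by (induction n) (simp_all add: subst2_1 subst2_mult assms)

lemma subst2_sum: "subst2 (\<Sum>i\<in>A. F i) (a, b) = (\<Sum>i\<in>A. subst2 (F i) (a, b))"
  by (induction A rule: infinite_finite_induct) (auto simp: subst2_0 subst2_add)

lemma subst2_dvd:
  assumes "a $ 0 = 0" "b $ 0 = 0" "F dvd G"
  shows "subst2 F (a, b) dvd subst2 G (a, b)"
  using assms by (auto simp: subst2_mult elim!: dvdE)

lemma fps_deriv_subst2:
  assumes "a $ 0 = 0" "b $ 0 = 0"
  shows "fps_deriv (subst2 F (a, b))
       = subst2 (deriv_x F) (a, b) * fps_deriv a + subst2 (deriv_y F) (a, b) * fps_deriv b"
proof (rule fps_ext)
  fix n
  \<comment> \<open>Truncation at Suc n, because differentiation lowers the degree by one.\<close>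
  let ?U = "\<Sum>j\<le>Suc n. (F $ j oo a) * b ^ j"
  have "fps_deriv (subst2 F (a, b)) $ n = fps_deriv ?U $ n"
    using subst2_nth_truncate[of b "Suc n" "Suc n" F a] assms(2) by (simp del: sum.atMost_Suc)
  also have "fps_deriv ?U = (\<Sum>j\<le>Suc n. (fps_deriv (F $ j) oo a) * fps_deriv a * b ^ j
      + (F $ j oo a) * (of_nat j * b ^ (j - 1) * fps_deriv b))"
    unfolding fps_deriv_sum
    by (rule sum.cong) (use assms(1) in \<open>simp_all add: fps_compose_deriv fps_deriv_power' mult_ac
      del: sum.atMost_Suc\<close>)
  also have "\<dots> = (\<Sum>j\<le>Suc n. (deriv_x F $ j oo a) * b ^ j) * fps_deriv a
      + (\<Sum>j\<le>n. (deriv_y F $ j oo a) * b ^ j) * fps_deriv b"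
  proof -
    have "(\<Sum>j\<le>Suc n. (F $ j oo a) * (of_nat j * b ^ (j - 1) * fps_deriv b))
        = (\<Sum>j\<le>n. (F $ Suc j oo a) * (of_nat (Suc j) * b ^ j * fps_deriv b))"
      by (subst sum.atMost_Suc_shift) simp
    also have "\<dots> = (\<Sum>j\<le>n. (deriv_y F $ j oo a) * b ^ j) * fps_deriv b"
      unfolding sum_distrib_right
    proof (rule sum.cong)
      fix j
      have "(of_nat (j + 1) :: complex fps) oo a = of_nat (j + 1)"
        by (metis fps_const_compose fps_of_nat)
      then have "deriv_y F $ j oo a = of_nat (Suc j) * (F $ Suc j oo a)"
        using assms(1) by (simp add: deriv_y_def fps_compose_mult_distrib del: of_nat_Suc)
      then show "(F $ Suc j oo a) * (of_nat (Suc j) * b ^ j * fps_deriv b)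
        = (deriv_y F $ j oo a) * b ^ j * fps_deriv b" by (simp only: mult_ac)
    qed simp
    finally show ?thesis
      by (simp add: sum.distrib deriv_x_def sum_distrib_left mult_ac del: sum.atMost_Suc)
  qed
  also have "\<dots> $ n = (subst2 (deriv_x F) (a, b) * fps_deriv a
      + subst2 (deriv_y F) (a, b) * fps_deriv b) $ n"
    using subst2_mult_nth_truncate[of b n "Suc n" "deriv_x F" a "fps_deriv a"]
      subst2_mult_nth_truncate[of b n n "deriv_y F" a "fps_deriv b"] assms(2)
    by (simp only: fps_add_nth)
  finally show "fps_deriv (subst2 F (a, b)) $ n = (subst2 (deriv_x F) (a, b) * fps_deriv a
      + subst2 (deriv_y F) (a, b) * fps_deriv b) $ n" .
qed

lemma subst2_compose:
  assumes "a $ 0 = 0" "b $ 0 = 0" "s $ 0 = 0"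
  shows "subst2 F (a oo s, b oo s) = subst2 F (a, b) oo s"
proof (rule fps_ext)
  fix n
  let ?U = "\<Sum>j\<le>n. (F $ j oo a) * b ^ j"
  have "(subst2 F (a, b) oo s) $ n = (?U oo s) $ n"
    using assms(2) subst2_nth_truncate[of b _ n F a]
    by (auto simp: fps_compose_nth intro!: sum.cong)
  also have "?U oo s = (\<Sum>j\<le>n. (F $ j oo (a oo s)) * (b oo s) ^ j)"
    using assms by (simp add: fps_compose_sum_distrib fps_compose_mult_distrib fps_compose_power
        fps_compose_assoc)
  also have "\<dots> $ n = subst2 F (a oo s, b oo s) $ n" by (simp add: subst2_nth)
  finally show "subst2 F (a oo s, b oo s) $ n = (subst2 F (a, b) oo s) $ n" ..
qed

text \<open>A root of the polynomial whose coefficients are read along a is thus an arc on which the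
  series vanishes; this is how Puiseux roots become parametrizations.\<close>

lemma subst2_fps_of_poly:
  assumes "a $ 0 = 0" "b $ 0 = 0"
  shows "subst2 (fps_of_poly p) (a, b) = poly (map_poly (\<lambda>c. c oo a) p) b"
proof (induction p)
  case 0
  then show ?case by (simp add: subst2_0)
next
  case (pCons c p)
  have "subst2 (fps_of_poly (pCons c p)) (a, b) = (c oo a) + b * subst2 (fps_of_poly p) (a, b)"
    using assms by (simp add: fps_of_poly_pCons subst2_add subst2_mult subst2_fps_const subst2_y)
  then show ?case using pCons by (simp add: map_poly_pCons)
qed

text \<open>The coefficient of t^(i+j) on the arc (c t, t) is the homogeneous part of F of that
  degree evaluated at (c, 1). As a polynomial in c it is nonzero, so some c is not a root.\<close>

lemma exists_transversal_line:
  assumes "F \<noteq> 0"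
  obtains c where "subst2 F (fps_const c * fps_X, fps_X) \<noteq> 0"
proof -
  obtain j i where ji: "F $ j $ i \<noteq> 0" using assms by (metis fps_ext fps_zero_nth)
  define p where "p = (\<Sum>k\<le>i + j. monom (F $ k $ (i + j - k)) (i + j - k))"
  have "coeff p i = (\<Sum>k\<le>i + j. if k = j then F $ k $ i else 0)"
    unfolding p_def coeff_sum by (intro sum.cong) auto
  then have "p \<noteq> 0" using ji by auto
  then have "finite {c. poly p c = 0}" by (rule poly_roots_finite)
  then obtain c where c: "poly p c \<noteq> 0"
    using ex_new_if_finite[OF infinite_UNIV_char_0] by blast
  have "subst2 F (fps_const c * fps_X, fps_X) $ (i + j) = poly p c"
    by (simp add: subst2_nth fps_sum_nth fps_X_power_mult_right_nth p_def poly_sum poly_monom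
        mult.commute[of "c ^ _"])
  then show ?thesis using c that by (metis fps_zero_nth)
qed

lemma deriv_x_mult: "deriv_x (F * G) = deriv_x F * G + F * deriv_x G"
  by (rule fps_ext) (simp add: deriv_x_def fps_mult_nth fps_deriv_sum sum.distrib add.commute)

lemma deriv_y_mult: "deriv_y (F * G) = deriv_y F * G + F * deriv_y G"
  by (simp add: deriv_y_def algebra_simps)

section \<open>Weierstrass division\<close>

lemma pseries2_eqI: "(\<And>i j. F $ j $ i = G $ j $ i) \<Longrightarrow> F = (G :: pseries2)"
  by (auto simp: fps_eq_iff)

lemma pseries2_mult_nth:
  "(F * G) $ j $ i = (\<Sum>l\<le>j. \<Sum>k\<le>i. F $ l $ k * G $ (j - l) $ (i - k))" for F G :: pseries2
  by (simp add: fps_mult_nth fps_sum_nth atLeast0AtMost)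

definition y_regular :: "nat \<Rightarrow> pseries2 \<Rightarrow> bool" where
  "y_regular n D \<longleftrightarrow> (\<forall>j<n. D $ j $ 0 = 0) \<and> D $ n $ 0 \<noteq> 0"

text \<open>Solves for the coefficients of a series q such that q * D agrees with F in all y-degrees
  \<ge> n. In the coefficient of x^i y^(j+n), the unknown with indices i, j comes with the factor
  \<open>D $ n $ 0\<close>, and regularity leaves only unknowns with smaller i, or with the same i
  and smaller j. An explicit recursion also allows the coefficients to be estimated.\<close>

function weierstrass_quotient :: "pseries2 \<Rightarrow> pseries2 \<Rightarrow> nat \<Rightarrow> nat \<Rightarrow> nat \<Rightarrow> complex" where
  "weierstrass_quotient F D n i j =
     (F $ (j + n) $ i
      - (\<Sum>k<i. \<Sum>l\<le>j + n. weierstrass_quotient F D n k l * D $ (j + n - l) $ (i - k))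
      - (\<Sum>l<j. weierstrass_quotient F D n i l * D $ (j + n - l) $ 0)) / D $ n $ 0"
  by pat_completeness auto
termination
  by (relation "measures [\<lambda>(F, D, n, i, j). i, \<lambda>(F, D, n, i, j). j]") auto

declare weierstrass_quotient.simps [simp del]

lemma weierstrass_quotient_eq:
  fixes F :: pseries2
  assumes "y_regular n D"
  defines "q \<equiv> weierstrass_quotient F D n"
  shows "q i j * D $ n $ 0 = F $ (j + n) $ i
      - (\<Sum>k<i. \<Sum>l\<le>j + n. q k l * D $ (j + n - l) $ (i - k))
      - (\<Sum>l<j. q i l * D $ (j + n - l) $ 0)"
  unfolding q_def using assms(1)
  by (subst weierstrass_quotient.simps) (simp add: y_regular_def)

lemma weierstrass_division:
  assumes "y_regular n D" "j \<ge> n"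
  shows "(F - Abs_fps (\<lambda>j. Abs_fps (\<lambda>i. weierstrass_quotient F D n i j)) * D) $ j = 0"
proof (rule fps_ext)
  fix i
  obtain j' where j: "j = j' + n" using assms(2) by (metis add.commute le_Suc_ex)
  let ?q = "weierstrass_quotient F D n"
  let ?Q = "Abs_fps (\<lambda>j. Abs_fps (\<lambda>i. ?q i j))"
  have "(?Q * D) $ j $ i = (\<Sum>k\<le>i. \<Sum>l\<le>j. ?q k l * D $ (j - l) $ (i - k))"
    unfolding pseries2_mult_nth by (subst sum.swap) simp
  also have "{..i} = insert i {..<i}" by auto
  also have "(\<Sum>k\<in>insert i {..<i}. \<Sum>l\<le>j. ?q k l * D $ (j - l) $ (i - k))
      = (\<Sum>l\<le>j. ?q i l * D $ (j - l) $ 0) + (\<Sum>k<i. \<Sum>l\<le>j. ?q k l * D $ (j - l) $ (i - k))"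
    by simp
  also have "(\<Sum>l\<le>j. ?q i l * D $ (j - l) $ 0) = (\<Sum>l\<in>insert j' {..<j'}. ?q i l * D $ (j - l) $ 0)"
    by (rule sum.mono_neutral_right) (use assms(1) j in \<open>auto simp: y_regular_def\<close>)
  also have "\<dots> = ?q i j' * D $ n $ 0 + (\<Sum>l<j'. ?q i l * D $ (j - l) $ 0)"
    using j by simp
  finally show "(F - ?Q * D) $ j $ i = (0 :: complex fps) $ i"
    using weierstrass_quotient_eq[OF assms(1), of F i j'] j by simp
qed

section \<open>Convergent series and geometric bounds\<close>

lemma convergent_series_iff:
  "F \<in> convergent_series \<longleftrightarrow> (\<exists>C R. C \<ge> 0 \<and> R \<ge> 1 \<and> (\<forall>i j. norm (F $ j $ i) \<le> C * R ^ (i + j)))"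
proof
  assume "F \<in> convergent_series"
  then obtain r where r: "r > 0" "(\<lambda>(i, j). norm (F $ j $ i) * r ^ i * r ^ j) summable_on UNIV"
    by (auto simp: convergent_series_def)
  define C where "C = infsum (\<lambda>(i, j). norm (F $ j $ i) * r ^ i * r ^ j) UNIV"
  have C: "norm (F $ j $ i) * r ^ i * r ^ j \<le> C" for i j
    using finite_sum_le_infsum[OF r(2), of "{(i, j)}"] r(1) by (auto simp: C_def)
  have C0: "C \<ge> 0" unfolding C_def by (rule infsum_nonneg) (use r(1) in auto)
  have "norm (F $ j $ i) \<le> C * (max 1 (1 / r)) ^ (i + j)" for i j
  proof -
    have "norm (F $ j $ i) \<le> C * (1 / r) ^ (i + j)"
      using C[of j i] r(1) by (simp add: field_simps power_add)
    also have "\<dots> \<le> C * (max 1 (1 / r)) ^ (i + j)"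
      using C0 r(1) by (intro mult_left_mono power_mono) auto
    finally show ?thesis .
  qed
  then show "\<exists>C R. C \<ge> 0 \<and> R \<ge> 1 \<and> (\<forall>i j. norm (F $ j $ i) \<le> C * R ^ (i + j))"
    using C0 by (intro exI[of _ C] exI[of _ "max 1 (1 / r)"]) auto
next
  assume "\<exists>C R. C \<ge> 0 \<and> R \<ge> 1 \<and> (\<forall>i j. norm (F $ j $ i) \<le> C * R ^ (i + j))"
  then obtain C R where CR: "C \<ge> 0" "R \<ge> 1" "\<And>i j. norm (F $ j $ i) \<le> C * R ^ (i + j)" by blast
  \<comment> \<open>Half the radius that R suggests, so that the terms are dominated by C / 2^(i+j),
    whose finite sums are at most 4 C.\<close>
  define r where "r = 1 / (2 * R)"
  have r: "r > 0" using CR(2) by (simp add: r_def)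
  have le: "norm (F $ j $ i) * r ^ i * r ^ j \<le> C * ((1 / 2) ^ i * (1 / 2) ^ j)" for i j
  proof -
    have "norm (F $ j $ i) * r ^ i * r ^ j \<le> C * R ^ (i + j) * r ^ i * r ^ j"
      using CR(3) r by (intro mult_right_mono) auto
    also have "\<dots> = C * ((R * r) ^ i * (R * r) ^ j)" by (simp add: power_add power_mult_distrib)
    also have "R * r = 1 / 2" using CR(2) by (simp add: r_def)
    finally show ?thesis .
  qed
  have geo: "(\<Sum>i\<le>n. (1 / 2) ^ i) \<le> (2 :: real)" for n
    by (induction n) (auto simp: sum_gp0 )
  have "(\<lambda>(i, j). norm (F $ j $ i) * r ^ i * r ^ j) summable_on UNIV"
  proof (rule nonneg_bdd_above_summable_on)
    show "bdd_above (sum (\<lambda>(i, j). norm (F $ j $ i) * r ^ i * r ^ j) ` {A. A \<subseteq> UNIV \<and> finite A})"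
    proof (rule bdd_aboveI2)
      fix A :: "(nat \<times> nat) set" assume "A \<in> {A. A \<subseteq> UNIV \<and> finite A}"
      then have A: "finite A" by simp
      define n where "n = Max (insert 0 (fst ` A \<union> snd ` A))"
      have sub: "A \<subseteq> {..n} \<times> {..n}"
      proof
        fix p assume p: "p \<in> A"
        then have "fst p \<le> n" "snd p \<le> n" using A unfolding n_def by (auto intro!: Max_ge)
        then show "p \<in> {..n} \<times> {..n}" by (cases p) auto
      qed
      have "(\<Sum>(i, j)\<in>A. norm (F $ j $ i) * r ^ i * r ^ j)
          \<le> (\<Sum>(i, j)\<in>A. C * ((1 / 2) ^ i * (1 / 2) ^ j))"
        using le by (intro sum_mono) auto
      also have "\<dots> \<le> (\<Sum>(i, j)\<in>{..n} \<times> {..n}. C * ((1 / 2) ^ i * (1 / 2) ^ j))"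
        using sub CR(1) by (intro sum_mono2) auto
      also have "\<dots> = C * ((\<Sum>i\<le>n. (1 / 2) ^ i) * (\<Sum>j\<le>n. (1 / 2) ^ j))"
        by (subst sum_product, subst sum.cartesian_product, subst sum_distrib_left)
          (simp add: split_def)
      also have "\<dots> \<le> C * (2 * 2)"
        using geo CR(1) by (intro mult_left_mono mult_mono sum_nonneg) auto
      finally show "(\<Sum>(i, j)\<in>A. norm (F $ j $ i) * r ^ i * r ^ j) \<le> C * (2 * 2)" .
    qed
  qed (use r in auto)
  then show "F \<in> convergent_series" using r by (auto simp: convergent_series_def)
qed

text \<open>The bound persists for every larger base, so that several series can be given a common
  one.\<close>

lemma convergent_seriesE:
  assumes "F \<in> convergent_series"
  obtains C R where "C \<ge> 0" "R \<ge> 1"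
    "\<And>R' i j. R' \<ge> R \<Longrightarrow> norm (F $ j $ i) \<le> C * R' ^ (i + j)"
proof -
  obtain C R where CR: "C \<ge> 0" "R \<ge> 1" "\<And>i j. norm (F $ j $ i) \<le> C * R ^ (i + j)"
    using assms by (auto simp: convergent_series_iff)
  have "norm (F $ j $ i) \<le> C * R' ^ (i + j)" if "R' \<ge> R" for R' i j
    using CR that by (intro order_trans[OF CR(3)] mult_left_mono power_mono) auto
  with CR that show ?thesis by blast
qed

lemma convergent_series_add:
  assumes "F \<in> convergent_series" "G \<in> convergent_series"
  shows "F + G \<in> convergent_series"
proof -
  obtain C R where F: "C \<ge> 0" "R \<ge> 1" "\<And>R' i j. R' \<ge> R \<Longrightarrow> norm (F $ j $ i) \<le> C * R' ^ (i + j)"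
    using convergent_seriesE[OF assms(1)] by blast
  obtain C' T where G: "C' \<ge> 0" "T \<ge> 1" "\<And>R' i j. R' \<ge> T \<Longrightarrow> norm (G $ j $ i) \<le> C' * R' ^ (i + j)"
    using convergent_seriesE[OF assms(2)] by blast
  have "norm ((F + G) $ j $ i) \<le> (C + C') * (max R T) ^ (i + j)" for i j
    using norm_triangle_ineq[of "F $ j $ i" "G $ j $ i"] F(3)[of "max R T" j i] G(3)[of "max R T" j i]
    by (simp add: distrib_right)
  then show ?thesis unfolding convergent_series_iff using F(1,2) G(1,2)
    by (intro exI[of _ "C + C'"] exI[of _ "max R T"]) auto
qed

lemma convergent_series_uminus: "F \<in> convergent_series \<Longrightarrow> - F \<in> convergent_series"
  by (simp add: convergent_series_iff)

lemma convergent_series_mult: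
  assumes "F \<in> convergent_series" "G \<in> convergent_series"
  shows "F * G \<in> convergent_series"
proof -
  obtain C R where F: "C \<ge> 0" "R \<ge> 1" "\<And>R' i j. R' \<ge> R \<Longrightarrow> norm (F $ j $ i) \<le> C * R' ^ (i + j)"
    using convergent_seriesE[OF assms(1)] by blast
  obtain C' T where G: "C' \<ge> 0" "T \<ge> 1" "\<And>R' i j. R' \<ge> T \<Longrightarrow> norm (G $ j $ i) \<le> C' * R' ^ (i + j)"
    using convergent_seriesE[OF assms(2)] by blast
  define B where "B = max R T"
  have B: "B \<ge> R" "B \<ge> T" "B \<ge> 1" using F G by (auto simp: B_def)
  have "norm ((F * G) $ j $ i) \<le> (C * C') * (2 * B) ^ (i + j)" for i j
  proof -
    have "norm ((F * G) $ j $ i)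
        \<le> (\<Sum>l\<le>j. \<Sum>k\<le>i. norm (F $ l $ k * G $ (j - l) $ (i - k)))"
      unfolding pseries2_mult_nth by (intro sum_norm_le) (auto intro: sum_norm_le)
    also have "\<dots> \<le> (\<Sum>l\<le>j. \<Sum>k\<le>i. (C * C') * B ^ (i + j))"
    proof (intro sum_mono)
      fix l k assume lk: "l \<in> {..j}" "k \<in> {..i}"
      have "norm (F $ l $ k * G $ (j - l) $ (i - k))
          \<le> (C * B ^ (k + l)) * (C' * B ^ ((i - k) + (j - l)))"
        unfolding norm_mult using F(1,3) G(3) B by (intro mult_mono) auto
      also have "\<dots> = (C * C') * B ^ ((k + l) + ((i - k) + (j - l)))" by (simp add: power_add)
      also have "(k + l) + ((i - k) + (j - l)) = i + j" using lk by auto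
      finally show "norm (F $ l $ k * G $ (j - l) $ (i - k)) \<le> (C * C') * B ^ (i + j)" .
    qed
    also have "\<dots> = (real (j + 1) * real (i + 1)) * ((C * C') * B ^ (i + j))" by simp
    \<comment> \<open>The number of summands is at most 2^(i+j) and is absorbed by doubling the
      base.\<close>
    also have "\<dots> \<le> (2 ^ j * 2 ^ i) * ((C * C') * B ^ (i + j))"
    proof (intro mult_right_mono mult_mono)
      have "real (n + 1) \<le> 2 ^ n" for n :: nat
        using less_exp[of n] by (metis Suc_eq_plus1 Suc_leI of_nat_le_iff of_nat_numeral of_nat_power)
      then show "real (j + 1) \<le> 2 ^ j" "real (i + 1) \<le> 2 ^ i" by blast+
    qed (use F G B in auto)
    also have "\<dots> = (C * C') * (2 * B) ^ (i + j)" by (simp add: power_add power_mult_distrib)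
    finally show ?thesis .
  qed
  then show ?thesis unfolding convergent_series_iff using F(1) G(1) B(3)
    by (intro exI[of _ "C * C'"] exI[of _ "2 * B"]) auto
qed

lemma convergent_series_const: "fps_const (fps_const c) \<in> convergent_series"
  unfolding convergent_series_iff
  by (rule exI[of _ "norm c"], rule exI[of _ 1]) auto

text \<open>The ratio K of the two bases yields the factor 2 / K, which makes a recursion of
  convolution type contracting once K is large.\<close>

lemma sum_two_geometric_le:
  fixes B K :: real
  assumes "B > 0" "K \<ge> 2"
  shows "(\<Sum>l<j. (K * B) ^ l * B ^ (j - l)) \<le> (2 / K) * (K * B) ^ j"
proof (induction j)
  case (Suc j)
  have "(\<Sum>l<Suc j. (K * B) ^ l * B ^ (Suc j - l))
      = B * (\<Sum>l<j. (K * B) ^ l * B ^ (j - l)) + (K * B) ^ j * B"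
    by (auto simp: sum_distrib_left Suc_diff_le intro!: sum.cong)
  also have "\<dots> \<le> B * ((2 / K) * (K * B) ^ j) + (K * B) ^ j * B"
    using Suc assms by (intro add_right_mono mult_left_mono) auto
  also have "\<dots> = (2 / K + 1) * (B * (K * B) ^ j)" by (simp add: algebra_simps)
  also have "\<dots> \<le> 2 * (B * (K * B) ^ j)"
    using assms by (intro mult_right_mono) auto
  also have "\<dots> = (2 / K) * (K * B) ^ Suc j" using assms by simp
  finally show ?case .
qed (use assms in auto)

lemma sum_two_geometric_le':
  fixes B K :: real
  assumes "B > 0" "K \<ge> 2"
  shows "(\<Sum>l\<le>j. (K * B) ^ l * B ^ (j - l)) \<le> 2 * (K * B) ^ j"
proof -
  have "(\<Sum>l\<le>j. (K * B) ^ l * B ^ (j - l)) = (\<Sum>l<j. (K * B) ^ l * B ^ (j - l)) + (K * B) ^ j"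
    by (simp add: lessThan_Suc_atMost[symmetric])
  also have "\<dots> \<le> (2 / K) * (K * B) ^ j + (K * B) ^ j"
    using sum_two_geometric_le[OF assms] by simp
  also have "\<dots> = (2 / K + 1) * (K * B) ^ j" by (simp add: algebra_simps)
  also have "\<dots> \<le> 2 * (K * B) ^ j" using assms by (intro mult_right_mono) auto
  finally show ?thesis .
qed

text \<open>The recursion preserves a bound C * A^i * R^j. The base R is fixed first, from the sum
  over the same i; A comes afterwards, because the sum over smaller i runs up to the y-index j + n
  and costs a factor R^n. The term from F takes half of the available bound and each recursive sum a
  quarter.\<close>

lemma weierstrass_quotient_convergent:
  assumes reg: "y_regular n D" and conv: "F \<in> convergent_series" "D \<in> convergent_series"
  shows "Abs_fps (\<lambda>j. Abs_fps (\<lambda>i. weierstrass_quotient F D n i j)) \<in> convergent_series"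
proof -
  obtain CF RF where F: "CF \<ge> 0" "RF \<ge> 1"
      "\<And>R' i j. R' \<ge> RF \<Longrightarrow> norm (F $ j $ i) \<le> CF * R' ^ (i + j)"
    using convergent_seriesE[OF conv(1)] by blast
  obtain CD RD where D: "CD \<ge> 0" "RD \<ge> 1"
      "\<And>R' i j. R' \<ge> RD \<Longrightarrow> norm (D $ j $ i) \<le> CD * R' ^ (i + j)"
    using convergent_seriesE[OF conv(2)] by blast
  define B where "B = max RF RD"
  have B: "B \<ge> 1" "B \<ge> RF" "B \<ge> RD" using F(2) by (auto simp: B_def)
  define u where "u = norm (D $ n $ 0)"
  have u: "u > 0" using reg by (simp add: u_def y_regular_def)
  \<comment> \<open>Makes CD * B^n * (2 / K) at most u / 4, the share of the sum over l < j.\<close>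
  define K where "K = 2 + 8 * CD * B ^ n / u"
  have K: "K \<ge> 2" "CD * B ^ n * (2 / K) \<le> u / 4"
  proof -
    have nn: "0 \<le> 8 * CD * B ^ n / u" using D(1) B(1) u by auto
    then show "K \<ge> 2" by (simp add: K_def)
    have "8 * CD * B ^ n / u \<le> K" by (simp add: K_def)
    then show "CD * B ^ n * (2 / K) \<le> u / 4" using u \<open>K \<ge> 2\<close> by (simp add: field_simps)
  qed
  define R where "R = K * B"
  have R: "R \<ge> B" "R \<ge> 1" using K(1) B(1) mult_mono[of 1 K 1 B] mult_right_mono[of 1 K B]
    by (auto simp: R_def)
  \<comment> \<open>The corresponding choice for the sum over k < i; the extra 2 * R^n comes from
    its inner sum over l \<le> j + n.\<close>
  define L where "L = 2 + 16 * CD * R ^ n / u"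
  have L: "L \<ge> 2" "CD * (2 / L) * (2 * R ^ n) \<le> u / 4"
  proof -
    have nn: "0 \<le> 16 * CD * R ^ n / u" using D(1) R(2) u by auto
    then show "L \<ge> 2" by (simp add: L_def)
    have "16 * CD * R ^ n / u \<le> L" by (simp add: L_def)
    then show "CD * (2 / L) * (2 * R ^ n) \<le> u / 4" using u \<open>L \<ge> 2\<close> by (simp add: field_simps)
  qed
  define A where "A = L * B"
  have A: "A \<ge> B" "A \<ge> 1" using L(1) B(1) mult_mono[of 1 L 1 B] mult_right_mono[of 1 L B]
    by (auto simp: A_def)
  define C where "C = 2 * CF * B ^ n / u"
  have C: "C \<ge> 0" "CF * B ^ n = C * u / 2" using F(1) B(1) u by (auto simp: C_def)
  let ?q = "weierstrass_quotient F D n"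
  have bound: "norm (?q i j) \<le> C * A ^ i * R ^ j" for i j
  proof (induction i arbitrary: j rule: less_induct)
    case (less i)
    note IHi = less
    show ?case
    proof (induction j rule: less_induct)
      case (less j)
      have T1: "norm (\<Sum>k<i. \<Sum>l\<le>j + n. ?q k l * D $ (j + n - l) $ (i - k))
        \<le> C * A ^ i * R ^ j * (u / 4)"
      proof -
        have "norm (\<Sum>k<i. \<Sum>l\<le>j + n. ?q k l * D $ (j + n - l) $ (i - k))
          \<le> (\<Sum>k<i. \<Sum>l\<le>j + n. (C * A ^ k * R ^ l) * (CD * B ^ ((i - k) + (j + n - l))))"
        proof (intro sum_norm_le)
          fix k l assume "k \<in> {..<i}" "l \<in> {..j + n}"
          then show "norm (?q k l * D $ (j + n - l) $ (i - k))
            \<le> (C * A ^ k * R ^ l) * (CD * B ^ ((i - k) + (j + n - l)))"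
            unfolding norm_mult using IHi[of k l] D(3)[OF B(3), of "j + n - l" "i - k"] B C A R D(1)
            by (intro mult_mono) auto
        qed
        also have "\<dots> = C * CD * ((\<Sum>k<i. A ^ k * B ^ (i - k)) * (\<Sum>l\<le>j + n. R ^ l * B ^ (j + n - l)))"
          unfolding sum_product unfolding sum_distrib_left
          by (intro sum.cong refl) (simp only: power_add mult_ac)
        also have "\<dots> \<le> C * CD * (((2 / L) * A ^ i) * (2 * R ^ (j + n)))"
          using sum_two_geometric_le[of B L i] sum_two_geometric_le'[of B K "j + n"] B(1) L(1) K(1) C D(1) A R
          by (intro mult_left_mono mult_mono) (auto simp: A_def R_def intro!: sum_nonneg)
        also have "\<dots> = C * A ^ i * R ^ j * (CD * (2 / L) * (2 * R ^ n))" by (simp add: power_add)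
        also have "\<dots> \<le> C * A ^ i * R ^ j * (u / 4)"
          using L(2) C A R by (intro mult_left_mono) auto
        finally show ?thesis .
      qed
      have T2: "norm (\<Sum>l<j. ?q i l * D $ (j + n - l) $ 0) \<le> C * A ^ i * R ^ j * (u / 4)"
      proof -
        have "norm (\<Sum>l<j. ?q i l * D $ (j + n - l) $ 0)
          \<le> (\<Sum>l<j. (C * A ^ i * R ^ l) * (CD * B ^ (0 + (j + n - l))))"
        proof (intro sum_norm_le)
          fix l assume "l \<in> {..<j}"
          then show "norm (?q i l * D $ (j + n - l) $ 0)
            \<le> (C * A ^ i * R ^ l) * (CD * B ^ (0 + (j + n - l)))"
            unfolding norm_mult using less[of l] D(3)[OF B(3), of "j + n - l" 0] B C A R D(1)
            by (intro mult_mono) auto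
        qed
        also have "\<dots> = (\<Sum>l<j. C * A ^ i * CD * B ^ n * (R ^ l * B ^ (j - l)))"
        proof (rule sum.cong)
          fix l assume "l \<in> {..<j}"
          then have "j + n - l = n + (j - l)" by auto
          then show "(C * A ^ i * R ^ l) * (CD * B ^ (0 + (j + n - l)))
            = C * A ^ i * CD * B ^ n * (R ^ l * B ^ (j - l))" by (simp add: power_add)
        qed simp
        also have "\<dots> = C * A ^ i * CD * B ^ n * (\<Sum>l<j. R ^ l * B ^ (j - l))"
          by (simp add: sum_distrib_left)
        also have "\<dots> \<le> C * A ^ i * CD * B ^ n * ((2 / K) * R ^ j)"
          using sum_two_geometric_le[of B K j] B(1) K(1) C D(1) A
          by (intro mult_left_mono) (auto simp: R_def)
        also have "\<dots> = C * A ^ i * R ^ j * (CD * B ^ n * (2 / K))" by simp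
        also have "\<dots> \<le> C * A ^ i * R ^ j * (u / 4)"
          using K(2) C A R by (intro mult_left_mono) auto
        finally show ?thesis .
      qed
      have T0: "norm (F $ (j + n) $ i) \<le> C * A ^ i * R ^ j * (u / 2)"
      proof -
        have "norm (F $ (j + n) $ i) \<le> (CF * B ^ n) * (B ^ i * B ^ j)"
          using F(3)[OF B(2), of "j + n" i] by (simp add: power_add mult_ac)
        also have "\<dots> \<le> (CF * B ^ n) * (A ^ i * R ^ j)"
          using F(1) B A R by (intro mult_left_mono mult_mono power_mono) auto
        finally show ?thesis using C(2) by (simp add: mult_ac)
      qed
      have "norm (?q i j) * u = norm (?q i j * D $ n $ 0)" by (simp add: u_def norm_mult)
      also have "\<dots> \<le> C * A ^ i * R ^ j * (u / 2) + C * A ^ i * R ^ j * (u / 4)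
          + C * A ^ i * R ^ j * (u / 4)"
        unfolding weierstrass_quotient_eq[OF reg]
        by (intro order_trans[OF norm_triangle_ineq4] add_mono T0 T1 T2)
      also have "\<dots> = C * A ^ i * R ^ j * u" by simp
      finally show ?case using u by simp
    qed
  qed
  have "norm (?q i j) \<le> C * (max A R) ^ (i + j)" for i j
  proof -
    have "C * A ^ i * R ^ j \<le> C * (max A R) ^ i * (max A R) ^ j"
      using C A R by (intro mult_mono power_mono) auto
    with bound[of i j] show ?thesis by (simp add: power_add)
  qed
  then show ?thesis unfolding convergent_series_iff using C(1) A(2)
    by (intro exI[of _ C] exI[of _ "max A R"]) auto
qed

section \<open>Common factors and factorization\<close>

text \<open>Both rings are needed: \<open>P\<close> and \<open>Q\<close> are assumed relatively prime among the convergent series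
  only, whereas \<open>f\<close> may be formal.\<close>

definition series_ring :: "pseries2 set \<Rightarrow> bool" where
  "series_ring S \<longleftrightarrow> S = UNIV \<or> S = convergent_series"

lemma series_ring_UNIV [simp]: "series_ring UNIV"
  and series_ring_convergent [simp]: "series_ring convergent_series"
  by (auto simp: series_ring_def)

lemma series_ring_closed:
  assumes "series_ring S" "F \<in> S" "G \<in> S"
  shows "F + G \<in> S" "- F \<in> S" "F - G \<in> S" "F * G \<in> S"
proof -
  show "F + G \<in> S" "- F \<in> S" "F * G \<in> S"
    using assms convergent_series_add convergent_series_uminus convergent_series_mult
    by (auto simp: series_ring_def)
  show "F - G \<in> S" using convergent_series_add[of F "- G"] convergent_series_uminus[of G] assms
    by (auto simp: series_ring_def)
qed

definition xvar :: pseries2 where "xvar = fps_const fps_X"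

lemma subst2_xvar: "a $ 0 = 0 \<Longrightarrow> subst2 xvar (a, b) = a"
  by (simp add: xvar_def subst2_x)

lemma xvar_power_mult_nth:
  "(xvar ^ m * F) $ j $ i = (if i < m then 0 else F $ j $ (i - m))"
  by (simp add: xvar_def fps_const_power fps_X_power_mult_nth)

lemma xvar_convergent: "xvar \<in> convergent_series"
  unfolding convergent_series_iff
proof (intro exI[of _ 1] conjI allI)
  fix i j
  have "norm (xvar $ j $ i) \<le> 1" by (auto simp: xvar_def fps_const_def fps_X_def)
  then show "norm (xvar $ j $ i) \<le> 1 * 1 ^ (i + j)" by simp
qed auto

lemma series_ring_elems:
  assumes "series_ring S"
  shows "0 \<in> S" "1 \<in> S" "xvar \<in> S"
  using assms convergent_series_const[of 0] convergent_series_const[of 1] xvar_convergent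
  by (auto simp: series_ring_def)

lemma series_ring_xvar_power: "series_ring S \<Longrightarrow> xvar ^ m \<in> S"
  by (induction m) (auto intro: series_ring_elems series_ring_closed)

lemma xvar_power_cancel:
  assumes "series_ring S" "xvar ^ m * F \<in> S"
  shows "F \<in> S"
proof (cases "S = UNIV")
  case False
  with assms have S: "S = convergent_series" by (simp add: series_ring_def)
  define H where "H = xvar ^ m * F"
  have "H \<in> convergent_series" using assms S by (simp add: H_def)
  then obtain C R where CR: "C \<ge> 0" "R \<ge> 1" "\<And>i j. norm (H $ j $ i) \<le> C * R ^ (i + j)"
    by (auto simp: convergent_series_iff)
  have "norm (F $ j $ i) \<le> (C * R ^ m) * R ^ (i + j)" for i j
  proof -
    have "H $ j $ (i + m) = F $ j $ i" by (simp add: H_def xvar_power_mult_nth)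
    then show ?thesis using CR(3)[of j "i + m"] by (simp add: power_add mult_ac)
  qed
  then show ?thesis unfolding S convergent_series_iff using CR(1,2)
    by (intro exI[of _ "C * R ^ m"] exI[of _ R]) auto
qed auto

text \<open>Regularity in y is obtained by splitting off a power of x instead of by a linear change
  of coordinates, so the variables stay fixed.\<close>

lemma xvar_decompose:
  assumes "F \<noteq> 0"
  obtains m n F' where "F = xvar ^ m * F'" "y_regular n F'"
proof -
  define m where "m = (LEAST i. \<exists>j. F $ j $ i \<noteq> 0)"
  have "\<exists>i j. F $ j $ i \<noteq> 0" using assms by (auto simp: fps_eq_iff)
  then have m: "\<exists>j. F $ j $ m \<noteq> 0" unfolding m_def by (rule LeastI_ex)
  have m0: "F $ j $ i = 0" if "i < m" for i j
    using that not_less_Least unfolding m_def by blast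
  define n where "n = (LEAST j. F $ j $ m \<noteq> 0)"
  have n: "F $ n $ m \<noteq> 0" unfolding n_def using m by (rule LeastI_ex)
  have n0: "F $ j $ m = 0" if "j < n" for j
    using that not_less_Least unfolding n_def by blast
  define F' where "F' = Abs_fps (\<lambda>j. fps_shift m (F $ j))"
  have "F = xvar ^ m * F'"
    by (rule pseries2_eqI) (auto simp: xvar_power_mult_nth F'_def m0)
  moreover have "y_regular n F'" using n n0 by (auto simp: y_regular_def F'_def)
  ultimately show ?thesis using that by blast
qed

lemma weierstrass_division_in:
  assumes "series_ring S" "F \<in> S" "D \<in> S" "y_regular n D"
  shows "\<exists>q\<in>S. \<forall>j\<ge>n. (F - q * D) $ j = 0"
proof
  let ?q = "Abs_fps (\<lambda>j. Abs_fps (\<lambda>i. weierstrass_quotient F D n i j))"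
  show "\<forall>j\<ge>n. (F - ?q * D) $ j = 0" using weierstrass_division[OF assms(4)] by blast
  show "?q \<in> S"
    using weierstrass_quotient_convergent[OF assms(4)] assms(1-3) by (auto simp: series_ring_def)
qed

text \<open>Division of 1 by a series regular of order 0 leaves no remainder, which gives inverses
  in both rings at once.\<close>

lemma series_ring_unit:
  assumes "series_ring S" "F \<in> S" "value0 F \<noteq> 0"
  obtains w where "w \<in> S" "F * w = 1"
proof -
  have reg: "y_regular 0 F" using assms(3) by (simp add: y_regular_def value0_def)
  obtain q where q: "q \<in> S" "\<forall>j\<ge>0. (1 - q * F) $ j = 0"
    using weierstrass_division_in[OF assms(1) series_ring_elems(2)[OF assms(1)] assms(2) reg] by auto
  have "1 - q * F = 0" by (rule fps_ext) (use q(2) in simp)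
  then show ?thesis using that[OF q(1)] by (simp add: mult.commute)
qed

lemma value0_mult: "value0 (F * G) = value0 F * value0 G"
  by (simp add: value0_def)

lemma value0_1 [simp]: "value0 1 = 1"
  by (simp add: value0_def)

lemma pseries2_unit_iff: "F dvd 1 \<longleftrightarrow> value0 F \<noteq> 0" for F :: pseries2
proof
  assume "F dvd 1"
  then obtain w where "1 = F * w" by (auto elim: dvdE)
  then show "value0 F \<noteq> 0" by (metis mult_zero_left value0_1 value0_mult zero_neq_one)
next
  assume "value0 F \<noteq> 0"
  then show "F dvd 1" using series_ring_unit[OF series_ring_UNIV, of F] by (metis UNIV_I dvdI)
qed

text \<open>Divide both series by the element of the ideal that is, up to a power of \<open>x\<close>, regular
  of the least order in \<open>y\<close>.\<close>

lemma relatively_prime_imp_xvar_power: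
  assumes S: "series_ring S" and PQ: "P \<in> S" "Q \<in> S" and rp: "relatively_prime_in S P Q"
  obtains m A B where "xvar ^ m = A * P + B * Q"
proof -
  define I where "I = {A * P + B * Q | A B. A \<in> S \<and> B \<in> S}"
  have I_add: "u - c * v \<in> I" if uI: "u \<in> I" and vI: "v \<in> I" and c: "c \<in> S" for u v c
  proof -
    obtain A B where u: "u = A * P + B * Q" "A \<in> S" "B \<in> S"
      using uI by (auto simp: I_def)
    obtain A' B' where v: "v = A' * P + B' * Q" "A' \<in> S" "B' \<in> S"
      using vI by (auto simp: I_def)
    from u v have "u - c * v = (A - c * A') * P + (B - c * B') * Q" "A - c * A' \<in> S" "B - c * B' \<in> S"
      using S c by (auto simp: algebra_simps intro!: series_ring_closed)
    then show ?thesis unfolding I_def by blast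
  qed
  have I_mult: "c * u \<in> I" if uI: "u \<in> I" and c: "c \<in> S" for u c
  proof -
    obtain A B where "u = A * P + B * Q" "A \<in> S" "B \<in> S" using uI by (auto simp: I_def)
    then have "c * u = (c * A) * P + (c * B) * Q" "c * A \<in> S" "c * B \<in> S"
      using S c by (auto simp: algebra_simps intro!: series_ring_closed)
    then show ?thesis unfolding I_def by blast
  qed
  have "P = 1 * P + 0 * Q" "Q = 0 * P + 1 * Q" by simp_all
  then have PI: "P \<in> I" and QI: "Q \<in> I"
    unfolding I_def using series_ring_elems[OF S] by blast+
  have IS: "u \<in> S" if "u \<in> I" for u
    using that S PQ unfolding I_def by (auto intro!: series_ring_closed)
  \<comment> \<open>Only x^m * D has to lie in I, since stripping the power of x from an element may
    lead out of I.\<close>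
  define good where "good n \<longleftrightarrow> (\<exists>m D. xvar ^ m * D \<in> I \<and> y_regular n D)" for n
  have "P \<noteq> 0 \<or> Q \<noteq> 0"
  proof (rule ccontr)
    assume "\<not> (P \<noteq> 0 \<or> Q \<noteq> 0)"
    then have "\<exists>w\<in>S. 0 * w = (1 :: pseries2)"
      using rp series_ring_elems(1)[OF S] unfolding relatively_prime_in_def
      by (metis mult_zero_left)
    then show False by simp
  qed
  then obtain u where "u \<in> I" "u \<noteq> 0" using PI QI by blast
  then have "\<exists>n. good n" using xvar_decompose[of u] unfolding good_def by metis
  define n where "n = (LEAST n. good n)"
  have "good n" unfolding n_def using \<open>\<exists>n. good n\<close> by (rule LeastI_ex)
  then obtain m D where D: "xvar ^ m * D \<in> I" "y_regular n D" unfolding good_def by blast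
  have DS: "D \<in> S" using xvar_power_cancel[OF S] IS D(1) by blast
  have div: "\<exists>q\<in>S. F = D * q" if F: "F \<in> I" for F
  proof -
    obtain q where q: "q \<in> S" "\<forall>j\<ge>n. (F - q * D) $ j = 0"
      using weierstrass_division_in[OF S IS[OF F] DS D(2)] by blast
    \<comment> \<open>A nonzero remainder has y-degree below n; stripped of its power of x it would
      be regular of an order below n, against the minimality of n.\<close>
    have "F - q * D = 0"
    proof (rule ccontr)
      assume "F - q * D \<noteq> 0"
      then obtain l n' r where r: "F - q * D = xvar ^ l * r" "y_regular n' r"
        using xvar_decompose by blast
      have "(F - q * D) $ n' $ l \<noteq> 0"
        unfolding r(1) using r(2) by (simp add: xvar_power_mult_nth y_regular_def)
      then have "n' < n" using q(2) by (metis fps_zero_nth not_le)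
      have "xvar ^ (m + l) * r = xvar ^ m * (F - q * D)" unfolding r(1) by (simp only: power_add mult_ac)
      also have "\<dots> = xvar ^ m * F - q * (xvar ^ m * D)" by (simp add: algebra_simps)
      also have "\<dots> \<in> I" using I_add I_mult F D(1) q(1) series_ring_xvar_power[OF S] by blast
      finally have "good n'" unfolding good_def using r(2) by blast
      then show False using \<open>n' < n\<close> not_less_Least unfolding n_def by blast
    qed
    then show ?thesis using q(1) by (auto simp: mult.commute)
  qed
  \<comment> \<open>\<open>D\<close> divides \<open>P\<close> and \<open>Q\<close> within S, so it
    is a unit of S, and x^m itself lies in I.\<close>
  obtain w where w: "w \<in> S" "D * w = 1"
    using rp DS div[OF PI] div[OF QI] unfolding relatively_prime_in_def by blast
  have "xvar ^ m = w * (xvar ^ m * D)" using w(2) by (simp add: mult_ac)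
  also have "\<dots> \<in> I" using I_mult D(1) w(1) by blast
  finally show ?thesis using that unfolding I_def by blast
qed

section \<open>Divisibility tested along arcs\<close>

lemma xvar_dvd_iff: "xvar dvd F \<longleftrightarrow> subst2 F (0, fps_X) = 0"
proof
  assume "xvar dvd F"
  then show "subst2 F (0, fps_X) = 0"
    by (auto simp: subst2_mult subst2_xvar elim!: dvdE)
next
  assume z: "subst2 F (0, fps_X) = 0"
  have "F $ j $ 0 = 0" for j
  proof -
    have "subst2 F (0, fps_X) $ j = (\<Sum>k\<le>j. if k = j then F $ j $ 0 else 0)"
      unfolding subst2_nth fps_sum_nth
      by (intro sum.cong) (auto simp: fps_X_power_mult_right_nth)
    then show ?thesis using z by simp
  qed
  then have "F = xvar * Abs_fps (\<lambda>j. fps_shift 1 (F $ j))"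
    using xvar_power_mult_nth[of 1] by (intro pseries2_eqI) auto
  then show "xvar dvd F" by (metis dvdI)
qed

lemma xvar_nonzero: "xvar \<noteq> 0"
  by (simp add: xvar_def fps_const_nonzero_eq_nonzero)

lemma xvar_not_unit: "\<not> xvar dvd 1"
  by (simp add: pseries2_unit_iff value0_def xvar_def)

text \<open>x generates the kernel of restriction to the arc (0, t), which maps into an integral
  domain.\<close>

lemma prime_elem_xvar: "prime_elem xvar"
  unfolding prime_elem_def
  using xvar_not_unit xvar_nonzero by (auto simp: xvar_dvd_iff subst2_mult)

text \<open>The passage from coprimality among convergent series to formal arcs. A power of x in the
  ideal (P, Q) forces a common zero arc into the y-axis; then x divides both series, with quotients
  in the same ring S.\<close>

lemma not_both_vanish_on_arc:
  assumes "series_ring S" "P \<in> S" "Q \<in> S" "relatively_prime_in S P Q"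
    and ab: "a $ 0 = 0" "b $ 0 = 0" "(a, b) \<noteq> (0, 0)"
  shows "subst2 P (a, b) \<noteq> 0 \<or> subst2 Q (a, b) \<noteq> 0"
proof (rule ccontr)
  assume "\<not> ?thesis"
  then have z: "subst2 P (a, b) = 0" "subst2 Q (a, b) = 0" by auto
  obtain m A B where "xvar ^ m = A * P + B * Q"
    using relatively_prime_imp_xvar_power[OF assms(1-4)] .
  then have "subst2 (xvar ^ m) (a, b) = 0"
    by (simp add: subst2_add subst2_mult ab z)
  then have a: "a = 0" using ab by (simp add: subst2_power subst2_xvar)
  then have b: "b \<noteq> 0" using ab by auto
  have div: "\<exists>u\<in>S. F = xvar * u" if "F \<in> S" "subst2 F (a, b) = 0" for F
  proof -
    \<comment> \<open>Every arc with a = 0 is the axis (0, t) with b substituted for t, so vanishing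
      passes from the arc to the axis.\<close>
    have "subst2 F (0, fps_X) oo b = subst2 F (0 oo b, fps_X oo b)"
      using ab by (intro subst2_compose[symmetric]) auto
    also have "\<dots> = 0" using that ab a by simp
    finally have "subst2 F (0, fps_X) = 0" using ab b by (auto simp: fps_compose_eq_0_iff)
    then obtain u where u: "F = xvar * u" using xvar_dvd_iff by (auto elim: dvdE)
    then have "u \<in> S" using xvar_power_cancel[OF assms(1), of 1 u] that by simp
    with u show ?thesis by blast
  qed
  have "\<exists>w\<in>S. xvar * w = 1"
    using assms(4) series_ring_elems(3)[OF assms(1)] div[OF assms(2) z(1)] div[OF assms(3) z(2)]
    unfolding relatively_prime_in_def by blast
  then show False using xvar_not_unit by (metis dvdI)
qed

lemma irreducible_relatively_prime:
  assumes "irreducible g" "\<not> g dvd F"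
  shows "relatively_prime_in UNIV g F"
  unfolding relatively_prime_in_def
proof (intro ballI impI)
  fix d assume "(\<exists>u\<in>UNIV. g = d * u) \<and> (\<exists>v\<in>UNIV. F = d * v)"
  then obtain u v where uv: "g = d * u" "F = d * v" by blast
  have "\<not> u dvd 1"
  proof
    assume "u dvd 1"
    then obtain w where "1 = u * w" by (auto elim: dvdE)
    then have "F = g * (w * v)" using uv by (metis mult.assoc mult.right_neutral)
    then show False using assms(2) by simp
  qed
  then have "d dvd 1" using assms(1) uv(1) irreducibleD by blast
  then show "\<exists>w\<in>UNIV. d * w = 1" by (metis UNIV_I dvdE)
qed

text \<open>If g is not associated to x, coprimality to F gives x^m = A * g + B * F. Hence g divides
  x^m * H, and the powers of x can be removed one by one because x is prime and does not divide
  g.\<close>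

lemma irreducible_imp_prime:
  fixes g F H :: pseries2
  assumes g: "irreducible g" and dv: "g dvd F * H"
  shows "g dvd F \<or> g dvd H"
proof (cases "xvar dvd g")
  case True
  then obtain e where e: "g = xvar * e" by (auto elim: dvdE)
  then have "e dvd 1" using g xvar_not_unit irreducibleD by blast
  then have dx: "g dvd xvar" by (auto simp: e)
  have "xvar dvd F * H" using True dv dvd_trans by blast
  then have "xvar dvd F \<or> xvar dvd H" using prime_elem_xvar prime_elem_dvd_mult_iff by blast
  then show ?thesis using dx dvd_trans by blast
next
  case False
  have "g dvd H" if ndvd: "\<not> g dvd F"
  proof -
    obtain m A B where m: "xvar ^ m = A * g + B * F"
      using relatively_prime_imp_xvar_power[OF series_ring_UNIV UNIV_I UNIV_I
          irreducible_relatively_prime[OF g ndvd]] by blast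
    have "xvar ^ m * H = g * (A * H) + B * (F * H)" by (simp add: m algebra_simps)
    then have "g dvd xvar ^ m * H" using dv by simp
    then show ?thesis
    proof (induction m)
      case (Suc m)
      then obtain k where k: "xvar ^ Suc m * H = g * k" by (auto elim: dvdE)
      then have "xvar dvd g * k" by (metis dvd_triv_left mult.assoc power_Suc)
      then have "xvar dvd k" using False prime_elem_xvar prime_elem_dvd_mult_iff by blast
      then obtain k' where "k = xvar * k'" by (auto elim: dvdE)
      then have "xvar * (xvar ^ m * H) = xvar * (g * k')" using k by (simp add: mult_ac)
      then have "xvar ^ m * H = g * k'" using xvar_nonzero by (metis mult_left_cancel)
      then show ?case using Suc.IH by simp
    qed simp
  qed
  then show ?thesis by blast
qed

lemma irreducible_vanish_imp_dvd:
  assumes "irreducible g" "a $ 0 = 0" "b $ 0 = 0" "(a, b) \<noteq> (0, 0)"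
    and "subst2 g (a, b) = 0" "subst2 F (a, b) = 0"
  shows "g dvd F"
  using not_both_vanish_on_arc[OF series_ring_UNIV UNIV_I UNIV_I irreducible_relatively_prime] assms
  by blast

lemma subdegree_subst2_pos:
  assumes "\<not> F dvd 1" "subst2 F (a, b) \<noteq> 0"
  shows "subdegree (subst2 F (a, b)) > 0"
  using assms by (auto simp: pseries2_unit_iff subst2_nth_0 subdegree_eq_0_iff intro!: gr0I)

text \<open>The order along a fixed transversal line is additive and positive on nonunits; it is the
  measure both for finding an irreducible factor and for the induction.\<close>

lemma factorization_induct [consumes 1, case_names unit mult]:
  fixes F :: pseries2
  assumes "F \<noteq> 0"
    and unit: "\<And>u. u dvd 1 \<Longrightarrow> P u"
    and mult: "\<And>p G. irreducible p \<Longrightarrow> G \<noteq> 0 \<Longrightarrow> P G \<Longrightarrow> P (p * G)"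
  shows "P F"
proof -
  obtain c where "subst2 F (fps_const c * fps_X, fps_X) \<noteq> 0"
    using exists_transversal_line[OF assms(1)] .
  moreover define ev where "ev F = subst2 F (fps_const c * fps_X, fps_X)" for F
  ultimately have nz: "ev F \<noteq> 0" by simp
  have ev_mult: "ev (A * B) = ev A * ev B" for A B by (simp add: ev_def subst2_mult)
  have ev_pos: "subdegree (ev A) > 0" if "ev A \<noteq> 0" "\<not> A dvd 1" for A
    using that subdegree_subst2_pos unfolding ev_def by blast
  have ex: "\<exists>p. irreducible p \<and> p dvd A" if "ev A \<noteq> 0" "\<not> A dvd 1" for A
    using that
  proof (induction "subdegree (ev A)" arbitrary: A rule: less_induct)
    case less
    show ?case
    proof (cases "irreducible A")
      case False
      have "A \<noteq> 0" using less.prems by (auto simp: ev_def subst2_0)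
      then obtain B C where BC: "A = B * C" "\<not> B dvd 1" "\<not> C dvd 1"
        using False less.prems by (auto simp: irreducible_def)
      then have nz: "ev B \<noteq> 0" "ev C \<noteq> 0" using less.prems by (auto simp: ev_mult)
      then have "subdegree (ev B) < subdegree (ev A)"
        using ev_pos[OF nz(2) BC(3)] by (simp add: BC(1) ev_mult)
      then obtain p where "irreducible p" "p dvd B" using less.hyps nz BC by blast
      then show ?thesis using BC by auto
    qed auto
  qed
  from nz show ?thesis
  proof (induction "subdegree (ev F)" arbitrary: F rule: less_induct)
    case less
    show ?case
    proof (cases "F dvd 1")
      case False
      obtain p where "irreducible p" "p dvd F" using ex[OF less.prems False] by blast
      then obtain G where p: "irreducible p" "F = p * G" by (auto elim: dvdE)
      then have nz: "ev p \<noteq> 0" "ev G \<noteq> 0" using less.prems by (auto simp: ev_mult)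
      have "\<not> p dvd 1" using p(1) by (simp add: irreducible_def)
      then have "subdegree (ev G) < subdegree (ev F)"
        using ev_pos[OF nz(1)] nz by (simp add: p(2) ev_mult)
      then have "P G" using less.hyps nz by blast
      moreover have "G \<noteq> 0" using nz by (auto simp: ev_def subst2_0)
      ultimately show ?thesis using mult p by simp
    qed (use unit in auto)
  qed
qed

text \<open>Squarefreeness makes the factors pairwise nonassociated, so they can be collected in a
  set G without losing multiplicities.\<close>

lemma squarefree_factorization:
  fixes f :: pseries2
  assumes "squarefree f"
  obtains u G where "finite G" "u dvd 1" "f = u * \<Prod>G" "\<And>g. g \<in> G \<Longrightarrow> irreducible g"
    "\<And>g h. g \<in> G \<Longrightarrow> h \<in> G \<Longrightarrow> g dvd h \<Longrightarrow> g = h"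
proof -
  have "f \<noteq> 0" using assms by auto
  then have "squarefree f \<longrightarrow> (\<exists>u G. finite G \<and> u dvd 1 \<and> f = u * \<Prod>G \<and> (\<forall>g\<in>G. irreducible g)
    \<and> (\<forall>g\<in>G. \<forall>h\<in>G. g dvd h \<longrightarrow> g = h))"
  proof (induction rule: factorization_induct)
    case (unit u)
    then show ?case by (intro impI exI[of _ u] exI[of _ "{}"]) auto
  next
    case (mult p F)
    show ?case
    proof
      assume sq: "squarefree (p * F)"
      then have "squarefree F" using squarefree_multD(2) by blast
      then obtain u G where G: "finite G" "u dvd 1" "F = u * \<Prod>G" "\<forall>g\<in>G. irreducible g"
        "\<forall>g\<in>G. \<forall>h\<in>G. g dvd h \<longrightarrow> g = h" using mult by blast
      have pF: "\<not> p dvd F"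
      proof
        assume "p dvd F"
        then have "p ^ 2 dvd p * F" by (simp add: power2_eq_square)
        then have "p dvd 1" using sq unfolding squarefree_def by blast
        then show False using mult.hyps(1) by (simp add: irreducible_def)
      qed
      have pG: "\<not> p dvd g" if "g \<in> G" for g
      proof
        assume "p dvd g"
        also have "g dvd F" using dvd_prodI[OF G(1) that, of "\<lambda>x. x"] G(3) by simp
        finally show False using pF by simp
      qed
      have Gp: "\<not> g dvd p" if "g \<in> G" for g
      proof
        assume "g dvd p"
        then obtain e where e: "p = g * e" by (auto elim: dvdE)
        have "\<not> g dvd 1" using G(4) that by (auto simp: irreducible_def)
        then have "e dvd 1" using mult.hyps(1) e irreducibleD by blast
        then have "p dvd g" using e by auto
        then show False using pG that by blast
      qed
      have "p \<notin> G" using pG[of p] by auto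
      then have "p * F = u * \<Prod>(insert p G)" using G by (simp add: mult_ac)
      then show "\<exists>u G. finite G \<and> u dvd 1 \<and> p * F = u * \<Prod>G \<and> (\<forall>g\<in>G. irreducible g)
        \<and> (\<forall>g\<in>G. \<forall>h\<in>G. g dvd h \<longrightarrow> g = h)"
      proof (intro exI conjI)
        show "finite (insert p G)" "u dvd 1" using G(1,2) by auto
        show "\<forall>g\<in>insert p G. irreducible g" using G(4) mult.hyps(1) by simp
        show "\<forall>g\<in>insert p G. \<forall>h\<in>insert p G. g dvd h \<longrightarrow> g = h"
        proof (intro ballI impI)
          fix g h assume "g \<in> insert p G" "h \<in> insert p G" "g dvd h"
          then show "g = h" using G(5) pG Gp by (metis insertE)
        qed
      qed
    qed
  qed
  then obtain u G where "finite G" "u dvd 1" "f = u * \<Prod>G" "\<forall>g\<in>G. irreducible g"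
    "\<forall>g\<in>G. \<forall>h\<in>G. g dvd h \<longrightarrow> g = h" using assms by auto
  then show ?thesis by (intro that[of G u]) auto
qed

section \<open>Newton-Puiseux parametrizations\<close>

declare parametrization.simps [simp del] primitive_parametrization.simps [simp del]

lemma map_poly_add_hom:
  assumes "f 0 = 0" "\<And>a b. f (a + b) = f a + f b"
  shows "map_poly f (p + q) = map_poly f p + map_poly f q"
  by (rule poly_eqI) (simp add: coeff_map_poly assms)

lemma map_poly_mult_hom:
  fixes f :: "'a::comm_semiring_0 \<Rightarrow> 'b::comm_semiring_0"
  assumes "f 0 = 0" "\<And>a b. f (a + b) = f a + f b" "\<And>a b. f (a * b) = f a * f b"
  shows "map_poly f (p * q) = map_poly f p * map_poly f q"
proof (rule poly_eqI)
  fix n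
  have sum: "f (sum g A) = (\<Sum>x\<in>A. f (g x))" for g :: "nat \<Rightarrow> 'a" and A
    by (induction A rule: infinite_finite_induct) (simp_all add: assms)
  show "coeff (map_poly f (p * q)) n = coeff (map_poly f p * map_poly f q) n"
    by (simp add: coeff_map_poly coeff_mult sum assms)
qed

lemma map_poly_pcompose_hom:
  fixes f :: "'a::comm_semiring_0 \<Rightarrow> 'b::comm_semiring_0"
  assumes "f 0 = 0" "\<And>a b. f (a + b) = f a + f b" "\<And>a b. f (a * b) = f a * f b"
  shows "map_poly f (pcompose p q) = pcompose (map_poly f p) (map_poly f q)"
  by (induction p)
     (simp_all add: pcompose_pCons map_poly_pCons map_poly_add_hom[of f, OF assms(1,2)]
       map_poly_mult_hom[of f, OF assms] assms(1))

text \<open>Prepares the Tschirnhaus shift, for which only the two top coefficients of p(y + h) have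
  to be known.\<close>

lemma coeff_pcompose_shift:
  fixes p :: "'a::comm_ring_1 poly"
  assumes "degree p \<le> Suc n"
  shows "coeff (pcompose p [:h, 1:]) n = coeff p n + of_nat (Suc n) * h * coeff p (Suc n)
       \<and> coeff (pcompose p [:h, 1:]) (Suc n) = coeff p (Suc n)"
  using assms
proof (induction n arbitrary: p)
  case 0
  obtain c r where p: "p = pCons c r" by (rule pCons_cases)
  then have "degree r = 0" using 0 by (cases "r = 0") auto
  then obtain d where "r = [:d:]" by (rule degree_eq_zeroE)
  then show ?case by (simp add: p pcompose_pCons coeff_pCons mult_ac)
next
  case (Suc n)
  obtain c r where p: "p = pCons c r" by (rule pCons_cases)
  then have r: "degree r \<le> Suc n" using Suc.prems by (cases "r = 0") auto
  then have z: "coeff (pcompose r [:h, 1:]) (Suc (Suc n)) = 0"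
    using degree_pcompose_le[of r "[:h, 1:]"] by (intro coeff_eq_0) auto
  show ?case using Suc.IH[OF r] z by (simp add: p pcompose_pCons coeff_pCons algebra_simps)
qed

lemma poly_eq_sum:
  fixes p :: "'a::comm_semiring_1 poly"
  assumes "degree p \<le> n"
  shows "poly p x = (\<Sum>i\<le>n. coeff p i * x ^ i)"
  unfolding poly_altdef using assms
  by (intro sum.mono_neutral_left) (auto simp: coeff_eq_0)

abbreviation ramify :: "nat \<Rightarrow> complex fps poly \<Rightarrow> complex fps poly" where
  "ramify m \<equiv> map_poly (\<lambda>c. c oo fps_X ^ m)"

lemma poly_ramify_shift:
  assumes "m > 0"
  shows "poly (ramify m (pcompose p [:h, 1:])) b = poly (ramify m p) (b + (h oo fps_X ^ m))"
proof -
  have z: "(fps_X ^ m :: complex fps) $ 0 = 0" using assms by simp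
  have "ramify m (pcompose p [:h, 1:]) = pcompose (ramify m p) (ramify m [:h, 1:])"
    by (rule map_poly_pcompose_hom)
       (simp_all add: fps_compose_add_distrib fps_compose_mult_distrib[OF z])
  then show ?thesis by (simp add: map_poly_pCons poly_pcompose add.commute)
qed

text \<open>Dividing y^n by F leaves a remainder of y-degree below n, so the multiple e * F is a
  monic polynomial of degree n. At x = 0 its coefficient of y^n is the constant term of e times that
  of \<open>F $ n\<close>; as it equals 1, e is a unit.\<close>

lemma weierstrass_preparation:
  assumes reg: "y_regular n F"
  obtains W e where "fps_of_poly W = e * F" "e dvd 1" "degree W = n" "lead_coeff W = 1"
    "\<And>i. i < n \<Longrightarrow> coeff W i $ 0 = 0"
proof -
  obtain e where e: "\<forall>j\<ge>n. (fps_X ^ n - e * F) $ j = 0"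
    using weierstrass_division_in[OF series_ring_UNIV UNIV_I UNIV_I reg] by blast
  have low: "(e * F) $ j $ 0 = 0" if "j < n" for j
    unfolding pseries2_mult_nth using reg that by (intro sum.neutral) (auto simp: y_regular_def)
  have "(e * F) $ n $ 0 = (\<Sum>l\<le>n. if l = 0 then e $ 0 $ 0 * F $ n $ 0 else 0)"
    unfolding pseries2_mult_nth using reg by (intro sum.cong) (auto simp: y_regular_def)
  then have "(e * F) $ n $ 0 = value0 e * F $ n $ 0" by (simp add: value0_def)
  moreover have eFn: "(e * F) $ n = 1" using e[rule_format, of n] by (simp add: fps_X_power_nth)
  ultimately have unit: "e dvd 1" by (auto simp: pseries2_unit_iff)
  have high: "(e * F) $ j = 0" if "j > n" for j
    using e[rule_format, of j] that by (simp add: fps_X_power_nth)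
  define W where "W = (\<Sum>i\<le>n. monom ((e * F) $ i) i)"
  have "coeff W j = (\<Sum>i\<le>n. if i = j then (e * F) $ i else 0)" for j
    unfolding W_def coeff_sum by (intro sum.cong) auto
  then have W: "coeff W j = (e * F) $ j" for j using high[of j] by auto
  have "fps_of_poly W = e * F" by (rule fps_ext) (simp add: W)
  moreover have deg: "degree W = n"
    using W high eFn by (intro antisym degree_le le_degree) auto
  moreover have "lead_coeff W = 1" by (simp add: deg W eFn)
  moreover have "coeff W i $ 0 = 0" if "i < n" for i using low[OF that] by (simp only: W)
  ultimately show ?thesis using that unit by blast
qed

text \<open>At t = 0 a Weierstrass polynomial reduces to a power of y, so b has no constant term and
  may be substituted; the unit e does not vanish on the arc and can be cancelled.\<close>

lemma weierstrass_polynomial_root: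
  assumes m: "m > 0" and b: "poly (ramify m W) b = 0"
    and W: "fps_of_poly W = e * F" "e dvd 1" "lead_coeff W = 1"
      "\<And>i. i < degree W \<Longrightarrow> coeff W i $ 0 = 0"
  shows "b $ 0 = 0" "subst2 F (fps_X ^ m, b) = 0"
proof -
  have zm: "(fps_X ^ m :: complex fps) $ 0 = 0" using m by simp
  have "poly (ramify m W) b = (\<Sum>i\<le>degree W. (coeff W i oo fps_X ^ m) * b ^ i)"
    using map_poly_degree_leq[of _ W] by (subst poly_eq_sum) (auto simp: coeff_map_poly)
  then have "poly (ramify m W) b $ 0 = (\<Sum>i\<le>degree W. coeff W i $ 0 * (b $ 0) ^ i)"
    by (simp add: fps_sum_nth fps_power_zeroth)
  also have "\<dots> = (\<Sum>i\<le>degree W. if i = degree W then (b $ 0) ^ degree W else 0)"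
    using W(3,4) by (intro sum.cong) auto
  finally show b0: "b $ 0 = 0" using b by simp
  have "subst2 (fps_of_poly W) (fps_X ^ m, b) = 0"
    using subst2_fps_of_poly[OF zm b0] b by simp
  moreover have "subst2 e (fps_X ^ m, b) \<noteq> 0"
    using W(2) subst2_nth_0[of e "fps_X ^ m" b] by (auto simp: pseries2_unit_iff)
  ultimately show "subst2 F (fps_X ^ m, b) = 0" using subst2_mult[OF zm b0] W(1) by auto
qed

text \<open>Shifting \<open>q\<close> to the root \<open>c\<close> of its reduction, Weierstrass preparation splits off the
  factor of degree \<open>order c\<close> and thus takes the place of Hensel's lemma.\<close>

lemma split_off_root:
  fixes q :: "complex fps poly"
  defines "q0 \<equiv> map_poly (\<lambda>c. c $ 0) q"
  assumes q0: "q0 \<noteq> 0"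
  obtains W e where "fps_of_poly W = e * fps_of_poly (pcompose q [:fps_const c, 1:])" "e dvd 1"
    "degree W = order c q0" "lead_coeff W = 1" "\<And>i. i < order c q0 \<Longrightarrow> coeff W i $ 0 = 0"
proof -
  define k where "k = order c q0"
  obtain s where s: "q0 = [:-c, 1:] ^ k * s" "\<not> [:-c, 1:] dvd s"
    using order_decomp[OF q0] k_def by blast
  \<comment> \<open>At x = 0 the shifted polynomial is y^k * s(y + c) with s(c) nonzero, hence
    regular of order k.\<close>
  have "map_poly (\<lambda>c. c $ 0) (pcompose q [:fps_const c, 1:]) = pcompose q0 [:c, 1:]"
    unfolding q0_def by (subst map_poly_pcompose_hom) (simp_all add: map_poly_pCons)
  also have "\<dots> = pcompose ([:-c, 1:] ^ k) [:c, 1:] * pcompose s [:c, 1:]"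
    by (simp add: s(1) pcompose_mult)
  also have "pcompose ([:-c, 1:] ^ k) [:c, 1:] = monom 1 k"
  proof -
    have "pcompose [:-c, 1:] [:c, 1:] = [:0, 1:]" by (simp add: pcompose_pCons)
    then have "pcompose ([:-c, 1:] ^ k) [:c, 1:] = [:0, 1:] ^ k"
      by (induction k) (simp_all only: power_0 power_Suc pcompose_1 pcompose_mult)
    then show ?thesis by (simp add: monom_altdef)
  qed
  finally have map0: "map_poly (\<lambda>c. c $ 0) (pcompose q [:fps_const c, 1:])
      = monom 1 k * pcompose s [:c, 1:]" .
  have co: "coeff (pcompose q [:fps_const c, 1:]) j $ 0
      = (if j < k then 0 else coeff (pcompose s [:c, 1:]) (j - k))" for j
    using arg_cong[OF map0, of "\<lambda>p. coeff p j"] by (simp add: coeff_map_poly coeff_monom_mult)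
  have "coeff (pcompose s [:c, 1:]) 0 = poly s c"
    by (simp add: poly_pcompose flip: poly_0_coeff_0)
  also have "\<dots> \<noteq> 0" using s(2) by (simp add: poly_eq_0_iff_dvd)
  finally have "y_regular k (fps_of_poly (pcompose q [:fps_const c, 1:]))"
    by (simp add: y_regular_def co)
  then show ?thesis using weierstrass_preparation that unfolding k_def by metis
qed


text \<open>The change of variables \<open>x = t^v, y = t^u z\<close> of slope \<open>u / v\<close>.\<close>

lemma newton_slope:
  fixes p :: "complex fps poly"
  assumes p: "degree p = n" "lead_coeff p = 1" and i: "i < n" "coeff p i \<noteq> 0"
  obtains u v q i0 where "v > 0" "degree q = n" "lead_coeff q = 1" "i0 < n" "coeff q i0 $ 0 \<noteq> 0"
    "\<And>i. coeff p i = 0 \<Longrightarrow> coeff q i = 0"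
    "\<And>m b. m > 0 \<Longrightarrow> poly (ramify (v * m) p) (fps_X ^ (m * u) * b) = fps_X ^ (m * u * n) * poly (ramify m q) b"
proof -
  define I where "I = {i. i < n \<and> coeff p i \<noteq> 0}"
  \<comment> \<open>The slopes of the Newton polygon seen from the vertex y^n. A minimal slope makes
    all divisions by powers of t in \<open>Q\<close> exact and leaves a nonzero constant term at
    i0.\<close>
  define r where "r i = real (subdegree (coeff p i)) / real (n - i)" for i
  have "finite I" "I \<noteq> {}" using i by (auto simp: I_def)
  then obtain i0 where "is_arg_min r (\<lambda>x. x \<in> I) i0" using ex_is_arg_min_if_finite by blast
  then have i0: "i0 \<in> I" "\<And>i. i \<in> I \<Longrightarrow> r i0 \<le> r i" by (auto simp: is_arg_min_linorder)
  define u where "u = subdegree (coeff p i0)"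
  define v where "v = n - i0"
  have v: "v > 0" using i0(1) by (simp add: v_def I_def)
  have le: "u * (n - i) \<le> subdegree (coeff p i) * v" if "i \<in> I" for i
  proof -
    have "real u / real v \<le> real (subdegree (coeff p i)) / real (n - i)"
      using i0(2)[OF that] by (simp add: r_def u_def v_def)
    then have "real u * real (n - i) \<le> real (subdegree (coeff p i)) * real v"
      using v that by (simp add: divide_le_eq le_divide_eq I_def field_simps)
    then show ?thesis by (simp only: of_nat_mult[symmetric] of_nat_le_iff)
  qed
  have zv: "(fps_X ^ v :: complex fps) $ 0 = 0" using v by simp
  define Q where "Q i = (if i = n then 1 else fps_shift (u * (n - i)) (coeff p i oo fps_X ^ v))" for i
  define q where "q = (\<Sum>i\<le>n. monom (Q i) i)"
  have "coeff q j = (\<Sum>i\<le>n. if i = j then Q i else 0)" for j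
    unfolding q_def coeff_sum by (intro sum.cong) auto
  then have q: "coeff q j = (if j \<le> n then Q j else 0)" for j by simp
  have Q: "coeff p i oo fps_X ^ v = Q i * fps_X ^ (u * (n - i))" if "i \<le> n" for i
  proof (cases "i = n")
    case True
    then show ?thesis using p by (simp add: Q_def)
  next
    case False
    show ?thesis
    proof (cases "coeff p i = 0")
      case True
      then show ?thesis using False by (simp add: Q_def)
    next
      case nz: False
      then have "u * (n - i) \<le> subdegree (coeff p i oo fps_X ^ v)"
        using le[of i] that False zv by (simp add: I_def)
      then show ?thesis using False subdegree_decompose' by (simp add: Q_def)
    qed
  qed
  have degq: "degree q = n" by (intro antisym degree_le le_degree) (auto simp: q Q_def)
  moreover have "lead_coeff q = 1" by (simp add: degq q Q_def)
  moreover have "i0 < n" using i0(1) by (simp add: I_def)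
  moreover have "coeff q i0 $ 0 \<noteq> 0"
  proof -
    have "subdegree (coeff p i0 oo fps_X ^ v) = u * v" using zv by (simp add: u_def)
    moreover have "coeff p i0 oo fps_X ^ v \<noteq> 0"
      using i0(1) v zv by (auto simp: I_def fps_compose_eq_0_iff)
    ultimately have "(coeff p i0 oo fps_X ^ v) $ (u * v) \<noteq> 0"
      using nth_subdegree_nonzero by metis
    then show ?thesis using \<open>i0 < n\<close> by (simp add: q Q_def v_def)
  qed
  moreover have "coeff q i = 0" if "coeff p i = 0" for i
    using that p by (auto simp: q Q_def)
  moreover have "poly (ramify (v * m) p) (fps_X ^ (m * u) * b)
      = fps_X ^ (m * u * n) * poly (ramify m q) b" if m: "m > 0" for m b
  proof -
    have zm: "(fps_X ^ m :: complex fps) $ 0 = 0" using m by simp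
    have "poly (ramify (v * m) p) (fps_X ^ (m * u) * b)
        = (\<Sum>i\<le>n. (coeff p i oo fps_X ^ (v * m)) * (fps_X ^ (m * u) * b) ^ i)"
      using map_poly_degree_leq[of _ p] p(1)
      by (subst poly_eq_sum[of _ n]) (auto simp: coeff_map_poly)
    also have "\<dots> = (\<Sum>i\<le>n. fps_X ^ (m * u * n) * ((coeff q i oo fps_X ^ m) * b ^ i))"
    proof (rule sum.cong)
      fix i assume "i \<in> {..n}"
      then have i: "i \<le> n" by simp
      have "coeff p i oo fps_X ^ (v * m) = coeff p i oo (fps_X ^ v oo fps_X ^ m)"
        using zm by (simp add: fps_X_power_compose power_mult mult.commute[of v m])
      also have "\<dots> = (coeff p i oo fps_X ^ v) oo fps_X ^ m"
        by (rule fps_compose_assoc[OF zm zv])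
      also have "\<dots> = (Q i oo fps_X ^ m) * fps_X ^ (m * (u * (n - i)))"
        using zm by (simp add: Q[OF i] fps_compose_mult_distrib fps_X_power_compose flip: power_mult)
      finally have "(coeff p i oo fps_X ^ (v * m)) * (fps_X ^ (m * u) * b) ^ i
          = (Q i oo fps_X ^ m) * b ^ i * fps_X ^ (m * (u * (n - i)) + m * u * i)"
        by (simp add: power_mult_distrib power_add mult_ac flip: power_mult)
      also have "m * (u * (n - i)) + m * u * i = m * u * n"
        using i by (simp add: algebra_simps flip: distrib_left)
      finally show "(coeff p i oo fps_X ^ (v * m)) * (fps_X ^ (m * u) * b) ^ i
          = fps_X ^ (m * u * n) * ((coeff q i oo fps_X ^ m) * b ^ i)"
        using i by (simp add: q mult_ac)
    qed simp
    also have "\<dots> = fps_X ^ (m * u * n) * poly (ramify m q) b"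
      using map_poly_degree_leq[of _ q] degq
      by (subst poly_eq_sum[of "ramify m q" n]) (auto simp: coeff_map_poly sum_distrib_left)
    finally show ?thesis .
  qed
  ultimately show ?thesis using v that[of v q i0 u] by blast
qed

text \<open>Induction on the degree. Once the coefficient of degree n - 1 has been removed, either
  only y^n is left, or the Newton slope gives a polynomial whose reduction at t = 0 has a root of
  multiplicity strictly between 0 and n; the factor belonging to that root has smaller
  degree.\<close>

theorem newton_puiseux:
  assumes "lead_coeff p = 1" "degree p > 0"
  shows "\<exists>m>0. \<exists>b. poly (ramify m p) b = 0"
  using assms
proof (induction "degree p" arbitrary: p rule: less_induct)
  case less
  define n where "n = degree p"
  have n: "n > 0" using less.prems by (simp add: n_def)
  then obtain n' where n': "n = Suc n'" by (cases n) auto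
  \<comment> \<open>Tschirnhaus shift: in characteristic 0 one may divide by n, and the
    next-to-highest coefficient disappears.\<close>
  define h where "h = - (fps_const (1 / of_nat n) * coeff p n')"
  define p1 where "p1 = pcompose p [:h, 1:]"
  have p1: "degree p1 = n" by (simp add: p1_def degree_pcompose n_def)
  have lead1: "lead_coeff p1 = 1" using less.prems by (simp add: p1_def lead_coeff_comp)
  have "coeff p1 n' = coeff p n' + of_nat n * h * coeff p n"
    using coeff_pcompose_shift[of p n' h] n' n_def p1_def by simp
  also have "of_nat n * h * coeff p n = - coeff p n'"
  proof -
    have "(of_nat n :: complex fps) * fps_const (1 / of_nat n) = 1"
      using n by (simp add: fps_of_nat[symmetric] del: fps_of_nat)
    then show ?thesis using less.prems by (simp add: h_def n_def flip: mult.assoc)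
  qed
  finally have c1: "coeff p1 n' = 0" by simp
  have "\<exists>m>0. \<exists>b. poly (ramify m p1) b = 0"
  proof (cases "\<forall>i<n. coeff p1 i = 0")
    case True
    then have "poly (ramify 1 p1) 0 = 0"
      using n by (simp add: poly_0_coeff_0 coeff_map_poly)
    then show ?thesis by (meson zero_less_one)
  next
    case False
    then obtain i where i: "i < n" "coeff p1 i \<noteq> 0" by blast
    obtain u v q i0 where q: "v > 0" "degree q = n" "lead_coeff q = 1" "i0 < n"
      "coeff q i0 $ 0 \<noteq> 0" "\<And>i. coeff p1 i = 0 \<Longrightarrow> coeff q i = 0"
      "\<And>m b. m > 0 \<Longrightarrow> poly (ramify (v * m) p1) (fps_X ^ (m * u) * b)
         = fps_X ^ (m * u * n) * poly (ramify m q) b"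
      using newton_slope[OF p1 lead1 i] by metis
    define q0 where "q0 = map_poly (\<lambda>c. c $ 0) q"
    have co0: "coeff q0 j = coeff q j $ 0" for j by (simp add: q0_def coeff_map_poly)
    have lead0: "coeff q0 n = 1" using q(2,3) co0 by simp
    have deg0: "degree q0 = n"
      using lead0 q(2) by (intro antisym degree_le le_degree) (auto simp: co0 coeff_eq_0)
    have q0: "q0 \<noteq> 0" using lead0 by auto
    have "\<not> constant (poly q0)" using deg0 n by (simp add: constant_degree)
    then obtain c where c: "poly q0 c = 0" using fundamental_theorem_of_algebra by blast
    define k where "k = order c q0"
    have "k > 0" using c q0 order_root by (auto simp: k_def)
    \<comment> \<open>Were the reduction (y - c)^n, its vanishing coefficient of degree n - 1 would
      give c = 0, hence y^n, but the coefficient at i0 is nonzero.\<close>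
    have "k < n"
    proof (rule ccontr)
      assume "\<not> k < n"
      then have k: "k = n" using order_degree[OF q0, of c] deg0 by (simp add: k_def)
      obtain s where s: "q0 = [:-c, 1:] ^ n * s" using order_1[of c q0] k k_def by (auto elim: dvdE)
      then have "s \<noteq> 0" using q0 by auto
      then have "degree q0 = n + degree s" using s by (simp add: degree_mult_eq degree_power_eq)
      then have "degree s = 0" using deg0 by simp
      then obtain d where d: "s = [:d:]" by (rule degree_eq_zeroE)
      then have "coeff q0 n = d" by (simp add: s coeff_linear_power)
      then have "s = 1" using lead0 d by simp
      then have q0e: "q0 = [:-c, 1:] ^ n" using s by simp
      have "coeff q0 n' = of_nat n * (- c)"
        unfolding q0e by (subst coeff_linear_poly_power) (simp_all add: n')
      moreover have "coeff q0 n' = 0" using q(6)[OF c1] by (simp add: co0)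
      ultimately have "c = 0" using n by simp
      then have "q0 = monom 1 n" by (simp add: q0e monom_altdef)
      then show False using q(4,5) co0[of i0] by simp
    qed
    obtain W e where W: "fps_of_poly W = e * fps_of_poly (pcompose q [:fps_const c, 1:])"
      "e dvd 1" "degree W = k" "lead_coeff W = 1" "\<And>i. i < k \<Longrightarrow> coeff W i $ 0 = 0"
      using split_off_root[of q c] q0 unfolding q0_def k_def by metis
    obtain m b where m: "m > 0" and b: "poly (ramify m W) b = 0"
      using less.hyps[of W] W \<open>k > 0\<close> \<open>k < n\<close> n_def by auto
    have zm: "(fps_X ^ m :: complex fps) $ 0 = 0" using m by simp
    have "b $ 0 = 0" "subst2 (fps_of_poly (pcompose q [:fps_const c, 1:])) (fps_X ^ m, b) = 0"
      using weierstrass_polynomial_root[OF m b W(1,2,4)] W(3,5) by auto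
    then have "poly (ramify m (pcompose q [:fps_const c, 1:])) b = 0"
      using subst2_fps_of_poly[OF zm] by simp
    then have "poly (ramify m q) (b + fps_const c) = 0"
      using poly_ramify_shift[OF m] by simp
    then have "poly (ramify (v * m) p1) (fps_X ^ (m * u) * (b + fps_const c)) = 0"
      using q(7)[OF m] by simp
    then show ?thesis using m q(1) by (metis nat_0_less_mult_iff)
  qed
  then obtain m b where "m > 0" "poly (ramify m p1) b = 0" by blast
  then show ?case unfolding p1_def using poly_ramify_shift by metis
qed

lemma ideal_gen_single: "ideal_gen {g} = {k * g | k. True}"
  by (auto simp: ideal_gen_def)

lemma parametrization_iff:
  "parametrization (a, b) (ideal_gen {g}) \<longleftrightarrow>
     a $ 0 = 0 \<and> b $ 0 = 0 \<and> (a, b) \<noteq> (0, 0) \<and> subst2 g (a, b) = 0"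
  by (auto simp: parametrization.simps ideal_gen_single subst2_mult dest: spec[of _ 1])

lemma irreducible_has_parametrization:
  assumes g: "irreducible g"
  obtains a b where "parametrization (a, b) (ideal_gen {g})"
proof (cases "xvar dvd g")
  case True
  then show ?thesis using that[of 0 fps_X] by (simp add: parametrization_iff xvar_dvd_iff)
next
  case False
  have "g \<noteq> 0" using False by auto
  then obtain k n g' where g': "g = xvar ^ k * g'" "y_regular n g'" using xvar_decompose by blast
  have "k = 0" using False g'(1) by (cases k) auto
  then have reg: "y_regular n g" using g' by simp
  obtain W e where W: "fps_of_poly W = e * g" "e dvd 1" "degree W = n" "lead_coeff W = 1"
    "\<And>i. i < n \<Longrightarrow> coeff W i $ 0 = 0"
    using weierstrass_preparation[OF reg] by metis
  have "value0 g = 0" using g pseries2_unit_iff[of g] by (auto simp: irreducible_def)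
  then have "n > 0" using reg by (auto simp: y_regular_def value0_def intro!: gr0I)
  obtain m b where m: "m > 0" and b: "poly (ramify m W) b = 0"
    using newton_puiseux[of W] W(3,4) \<open>n > 0\<close> by auto
  have zm: "(fps_X ^ m :: complex fps) $ 0 = 0" using m by simp
  have b0: "b $ 0 = 0" and "subst2 g (fps_X ^ m, b) = 0"
    using weierstrass_polynomial_root[OF m b W(1,2,4)] W(3,5) by auto
  then show ?thesis using that[of "fps_X ^ m" b] zm b0 by (simp add: parametrization_iff)
qed

text \<open>A parametrization of least order is primitive.\<close>

lemma irreducible_has_primitive_parametrization:
  assumes g: "irreducible g"
  obtains a b where "primitive_parametrization (a, b) (ideal_gen {g})"
proof -
  \<comment> \<open>A coordinate that is 0 has \<open>subdegree\<close> 0 and adds nothing, so M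
    also measures arcs on the axes.\<close>
  define M where "M = (\<lambda>(a :: complex fps, b :: complex fps). subdegree a + subdegree b)"
  define A where "A = {(a, b). parametrization (a, b) (ideal_gen {g})}"
  obtain a0 b0 where "parametrization (a0, b0) (ideal_gen {g})"
    using irreducible_has_parametrization[OF g] .
  then have "(a0, b0) \<in> A" by (simp add: A_def)
  then obtain ab where ab: "ab \<in> A" "\<And>cd. cd \<in> A \<Longrightarrow> M ab \<le> M cd"
    using ex_has_least_nat[of "\<lambda>x. x \<in> A" _ M] by blast
  obtain a b where [simp]: "ab = (a, b)" by (cases ab)
  have par: "parametrization (a, b) (ideal_gen {g})" using ab(1) by (simp add: A_def)
  have "subdegree s = 1" if s: "s $ 0 = 0" "a = a' oo s" "b = b' oo s" for a' b' s
  proof -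
    have par': "a $ 0 = 0" "b $ 0 = 0" "(a, b) \<noteq> (0, 0)" "subst2 g (a, b) = 0"
      using par unfolding parametrization_iff by auto
    then have z: "a' $ 0 = 0" "b' $ 0 = 0" using s by auto
    have s0: "s \<noteq> 0" using par'(3) s z by auto
    have "subst2 g (a', b') oo s = 0" using subst2_compose[OF z s(1), of g] par'(4) s by simp
    then have "subst2 g (a', b') = 0" using s(1) s0 by (simp add: fps_compose_eq_0_iff)
    moreover have "(a', b') \<noteq> (0, 0)" using par'(3) s by auto
    ultimately have "parametrization (a', b') (ideal_gen {g})" using z by (simp add: parametrization_iff)
    then have "M (a, b) \<le> M (a', b')" using ab(2)[of "(a', b')"] by (simp add: A_def)
    \<comment> \<open>Substitution of s multiplies both orders by the order of s, so minimality of M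
      allows only order 1.\<close>
    moreover have "M (a, b) = M (a', b') * subdegree s" using s by (simp add: M_def algebra_simps)
    moreover have "M (a', b') > 0"
      using \<open>(a', b') \<noteq> (0, 0)\<close> z by (auto simp: M_def subdegree_eq_0_iff intro!: gr0I)
    ultimately have "subdegree s \<le> 1" by simp
    moreover have "subdegree s \<noteq> 0" using s0 s(1) by (simp add: subdegree_eq_0_iff)
    ultimately show ?thesis by simp
  qed
  then have "primitive_parametrization (a, b) (ideal_gen {g})"
    using par by (auto simp: primitive_parametrization.simps)
  then show ?thesis using that by blast
qed

section \<open>Values along a primitive arc\<close>

interpretation pser: relative_dimension "\<lambda>c F. scalar c * F"
  by unfold_locales (simp_all add: scalar_def algebra_simps flip: fps_const_add fps_const_mult)

interpretation fser: relative_dimension "\<lambda>c \<phi>. fps_const c * (\<phi> :: complex fps)"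
  by unfold_locales (simp_all add: algebra_simps flip: fps_const_add fps_const_mult)

text \<open>Successive approximation: each remainder lies in K, so its order is some \<nu> l;
  subtracting the right multiple of \<psi> k pushes it past \<nu> k and therefore to at least \<nu>
  (k + 1). Finite sums suffice in the conclusion, because n \<le> N < \<nu> (N + 1) already makes
  the remainder vanish in degree n.\<close>

lemma expansion_in_sequence:
  fixes \<psi> :: "nat \<Rightarrow> complex fps"
  assumes \<nu>: "strict_mono \<nu>" and \<psi>: "\<And>k. \<psi> k \<noteq> 0" "\<And>k. subdegree (\<psi> k) = \<nu> k"
    and K: "\<And>\<phi> k c. \<phi> \<in> K \<Longrightarrow> \<phi> - fps_const c * \<psi> k \<in> K"
      "\<And>\<phi>. \<phi> \<in> K \<Longrightarrow> \<phi> \<noteq> 0 \<Longrightarrow> subdegree \<phi> \<in> range \<nu>"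
    and \<phi>: "\<phi> \<in> K"
  shows "\<exists>c. \<forall>N. \<forall>n\<le>N. \<phi> $ n = (\<Sum>k\<le>N. fps_const (c k) * \<psi> k) $ n"
proof -
  \<comment> \<open>The ratio of leading coefficients; it is 0 when the remainder already has order
    above \<nu> k.\<close>
  define d where "d \<rho> k = \<rho> $ \<nu> k / \<psi> k $ \<nu> k" for \<rho> k
  define R where "R = rec_nat \<phi> (\<lambda>k \<rho>. \<rho> - fps_const (d \<rho> k) * \<psi> k)"
  define c where "c k = d (R k) k" for k
  have R0: "R 0 = \<phi>" and RS: "R (Suc k) = R k - fps_const (c k) * \<psi> k" for k
    by (simp_all add: R_def c_def)
  have RK: "R k \<in> K" for k by (induction k) (simp_all add: R0 RS \<phi> K)
  have low: "R k $ i = 0" if "i < \<nu> k" for k i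
    using that
  proof (induction k arbitrary: i)
    case 0
    show ?case
    proof (cases "R 0 = 0")
      case False
      then obtain l where "subdegree (R 0) = \<nu> l" using K(2)[OF RK] by blast
      moreover have "\<nu> 0 \<le> \<nu> l" using \<nu> by (simp add: strict_mono_less_eq)
      ultimately show ?thesis using 0 by (intro nth_less_subdegree_zero) simp
    qed auto
  next
    case (Suc k)
    show ?case
    proof (cases "R (Suc k) = 0")
      case False
      then obtain l where l: "subdegree (R (Suc k)) = \<nu> l" using K(2)[OF RK] by blast
      have z: "R (Suc k) $ j = 0" if "j \<le> \<nu> k" for j
      proof (cases "j = \<nu> k")
        case True
        have "\<psi> k $ \<nu> k \<noteq> 0" using \<psi>[of k] nth_subdegree_nonzero by metis
        then show ?thesis using True by (simp add: RS c_def d_def)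
      next
        case False
        then have "j < \<nu> k" using that by simp
        moreover then have "\<psi> k $ j = 0" using \<psi>(2)[of k] by (intro nth_less_subdegree_zero) simp
        ultimately show ?thesis using Suc.IH by (simp add: RS)
      qed
      have "\<nu> k < \<nu> l" using z[of "\<nu> l"] l False by (metis not_le nth_subdegree_nonzero)
      then have "\<nu> (Suc k) \<le> \<nu> l" using \<nu> by (simp add: strict_mono_less strict_mono_less_eq Suc_le_eq)
      then show ?thesis using Suc.prems l by (intro nth_less_subdegree_zero) simp
    qed auto
  qed
  have sum: "\<phi> = (\<Sum>k<N. fps_const (c k) * \<psi> k) + R N" for N
    by (induction N) (simp_all add: R0 RS)
  have "\<phi> $ n = (\<Sum>k\<le>N. fps_const (c k) * \<psi> k) $ n" if "n \<le> N" for n N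
  proof -
    have "n < \<nu> (Suc N)" using that strict_mono_imp_increasing[OF \<nu>, of "Suc N"] by simp
    then have "R (Suc N) $ n = 0" by (rule low)
    then show ?thesis using arg_cong[OF sum[of "Suc N"], of "\<lambda>f. f $ n"]
      by (simp only: fps_add_nth lessThan_Suc_atMost add_0_right)
  qed
  then show ?thesis by blast
qed

section \<open>The value semigroup of a branch\<close>

definition value_semigroup :: "complex fps \<times> complex fps \<Rightarrow> nat set" where
  "value_semigroup \<gamma> = {subdegree (subst2 F \<gamma>) | F. subst2 F \<gamma> \<noteq> 0}"

context
  fixes a b :: "complex fps" and g :: pseries2
  assumes g: "irreducible g" and prim: "primitive_parametrization (a, b) (ideal_gen {g})"
begin

lemma primitive_arc: "a $ 0 = 0" "b $ 0 = 0" "(a, b) \<noteq> (0, 0)" "subst2 g (a, b) = 0"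
  using prim by (auto simp: primitive_parametrization.simps parametrization_iff)

lemma primitive_subdegree: "s $ 0 = 0 \<Longrightarrow> a = a' oo s \<Longrightarrow> b = b' oo s \<Longrightarrow> subdegree s = 1"
  using prim by (simp add: primitive_parametrization.simps)

lemma primitive_vanish_iff: "subst2 F (a, b) = 0 \<longleftrightarrow> g dvd F"
proof
  show "subst2 F (a, b) = 0 \<Longrightarrow> g dvd F"
    by (rule irreducible_vanish_imp_dvd[OF g primitive_arc])
  show "g dvd F \<Longrightarrow> subst2 F (a, b) = 0"
    using subst2_dvd[OF primitive_arc(1,2)] primitive_arc(4) by fastforce
qed

lemma value_semigroup_add:
  assumes "p \<in> value_semigroup (a, b)" "q \<in> value_semigroup (a, b)"
  shows "p + q \<in> value_semigroup (a, b)"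
proof -
  obtain F G where "p = subdegree (subst2 F (a, b))" "subst2 F (a, b) \<noteq> 0"
    "q = subdegree (subst2 G (a, b))" "subst2 G (a, b) \<noteq> 0"
    using assms by (auto simp: value_semigroup_def)
  then show ?thesis
    unfolding value_semigroup_def by (intro CollectI exI[of _ "F * G"])
      (simp add: subst2_mult primitive_arc(1,2))
qed

lemma value_semigroup_0: "0 \<in> value_semigroup (a, b)"
  unfolding value_semigroup_def by (intro CollectI exI[of _ 1]) (simp add: subst2_1)

lemma value_semigroup_mult: "p \<in> value_semigroup (a, b) \<Longrightarrow> k * p \<in> value_semigroup (a, b)"
  by (induction k) (simp_all add: value_semigroup_0 value_semigroup_add)

text \<open>If the least positive difference of two values is \<open>d\<close>, then \<open>a\<close> and \<open>b\<close> are power series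
  in a quotient of order \<open>d\<close>, so that primitivity forces \<open>d = 1\<close>.\<close>

lemma value_semigroup_consecutive:
  obtains p where "p \<in> value_semigroup (a, b)" "Suc p \<in> value_semigroup (a, b)"
proof -
  let ?V = "value_semigroup (a, b)"
  let ?e = "\<lambda>F. subst2 F (a, b)"
  have z: "a $ 0 = 0" "b $ 0 = 0" by (fact primitive_arc)+
  define P where "P d \<longleftrightarrow> d > 0 \<and> (\<exists>p\<in>?V. p + d \<in> ?V)" for d
  have "\<exists>d. P d"
  proof -
    obtain F where F: "?e F \<noteq> 0" "?e F $ 0 = 0"
    proof (cases "a = 0")
      case True
      then show ?thesis using that[of fps_X] primitive_arc by (simp add: subst2_y)
    next
      case False
      then show ?thesis using that[of xvar] primitive_arc by (simp add: subst2_xvar)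
    qed
    then have "subdegree (?e F) > 0" by (auto simp: subdegree_eq_0_iff intro!: gr0I)
    moreover have "0 + subdegree (?e F) \<in> ?V" using F(1) by (auto simp: value_semigroup_def)
    ultimately have "P (subdegree (?e F))" unfolding P_def using value_semigroup_0 by blast
    then show ?thesis ..
  qed
  define d where "d = (LEAST d. P d)"
  have Pd: "P d" unfolding d_def using \<open>\<exists>d. P d\<close> by (rule LeastI_ex)
  then obtain p where d: "d > 0" "p \<in> ?V" "p + d \<in> ?V" by (auto simp: P_def)
  \<comment> \<open>Remainder argument: e mod d is again a difference of two values, so it vanishes
    by the choice of d.\<close>
  have dvd: "d dvd e" if e: "q \<in> ?V" "q + e \<in> ?V" for q e
  proof (rule ccontr)
    assume "\<not> d dvd e"
    then have r: "e mod d > 0" by (simp add: mod_greater_zero_iff_not_dvd)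
    have "q + (e div d) * (p + d) \<in> ?V" "q + e + (e div d) * p \<in> ?V"
      using value_semigroup_add[OF e(1) value_semigroup_mult[OF d(3), of "e div d"]]
        value_semigroup_add[OF e(2) value_semigroup_mult[OF d(2), of "e div d"]] by simp_all
    moreover have "q + e + (e div d) * p = (q + (e div d) * (p + d)) + e mod d"
      by (simp add: algebra_simps)
    ultimately have "P (e mod d)" unfolding P_def using r by metis
    then have "d \<le> e mod d" unfolding d_def by (rule Least_le)
    then show False using mod_less_divisor[OF d(1), of e] by linarith
  qed
  obtain F G where F: "?e F \<noteq> 0" "subdegree (?e F) = p + d" and G: "?e G \<noteq> 0" "subdegree (?e G) = p"
    using d(2,3) unfolding value_semigroup_def by auto
  obtain u where u: "?e F = ?e G * u"
    using subdegree_le_imp_dvd_left_divring[OF G(1), of "?e F"] F G by auto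
  then have u0: "u \<noteq> 0" using F by auto
  then have du: "subdegree u = d" using arg_cong[OF u, of subdegree] F G by simp
  have uz: "u $ 0 = 0" using du d(1) by (metis nth_less_subdegree_zero)
  \<comment> \<open>The power series that are quotients of two restrictions to the arc. Their orders
    are differences of values, hence multiples of d, so the powers of u suffice to expand
    them.\<close>
  define K where "K = {\<phi>. \<exists>A B. ?e B \<noteq> 0 \<and> \<phi> * ?e B = ?e A}"
  have K1: "\<phi> - fps_const c * u ^ k \<in> K" if \<phi>: "\<phi> \<in> K" for \<phi> c k
  proof -
    obtain A B where AB: "?e B \<noteq> 0" "\<phi> * ?e B = ?e A" using \<phi> by (auto simp: K_def)
    have Fk: "u ^ k * ?e G ^ k = ?e F ^ k" by (simp add: u power_mult_distrib mult.commute)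
    have "(\<phi> - fps_const c * u ^ k) * ?e (B * G ^ k)
        = \<phi> * ?e B * ?e G ^ k - fps_const c * (u ^ k * ?e G ^ k) * ?e B"
      using z by (simp add: subst2_mult subst2_power algebra_simps)
    also have "\<dots> = ?e (A * G ^ k - scalar c * F ^ k * B)"
      using z by (simp add: AB Fk subst2_mult subst2_power subst2_diff subst2_scalar)
    finally show ?thesis using AB(1) G(1) z unfolding K_def
      by (intro CollectI exI[of _ "A * G ^ k - scalar c * F ^ k * B"] exI[of _ "B * G ^ k"])
        (simp add: subst2_mult subst2_power)
  qed
  have K2: "subdegree \<phi> \<in> range ((*) d)" if \<phi>: "\<phi> \<in> K" "\<phi> \<noteq> 0" for \<phi>
  proof -
    obtain A B where AB: "?e B \<noteq> 0" "\<phi> * ?e B = ?e A" using \<phi> by (auto simp: K_def)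
    then have nz: "?e A \<noteq> 0" using \<phi> by auto
    have "subdegree (?e B) + subdegree \<phi> = subdegree (?e A)"
      using arg_cong[OF AB(2), of subdegree] \<phi> AB(1) by simp
    then have "d dvd subdegree \<phi>"
      using dvd[of "subdegree (?e B)" "subdegree \<phi>"] AB(1) nz unfolding value_semigroup_def by auto
    then show ?thesis by (auto elim: dvdE)
  qed
  have comp: "\<exists>w. \<phi> = w oo u" if "\<phi> \<in> K" for \<phi>
  proof -
    have "\<exists>c. \<forall>N. \<forall>n\<le>N. \<phi> $ n = (\<Sum>k\<le>N. fps_const (c k) * u ^ k) $ n"
      by (rule expansion_in_sequence[of "(*) d" _ K])
        (use K1 K2 that d(1) u0 du in \<open>simp_all add: strict_mono_def\<close>)
    then obtain c where c: "\<forall>N. \<forall>n\<le>N. \<phi> $ n = (\<Sum>k\<le>N. fps_const (c k) * u ^ k) $ n" ..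
    have "\<phi> = Abs_fps c oo u"
    proof (rule fps_ext)
      fix n
      show "\<phi> $ n = (Abs_fps c oo u) $ n"
        using c[rule_format, of n n] by (simp add: fps_compose_nth fps_sum_nth atLeast0AtMost)
    qed
    then show ?thesis ..
  qed
  have "?e F' \<in> K" for F' unfolding K_def
    by (intro CollectI exI[of _ F'] exI[of _ 1]) (simp add: subst2_1)
  then have "a \<in> K" "b \<in> K"
    using subst2_xvar[OF z(1), of b] subst2_y[OF z(2), of a] by metis+
  then obtain a' b' where "a = a' oo u" "b = b' oo u" using comp by metis
  then have "subdegree u = 1" using primitive_subdegree uz by blast
  then show ?thesis using that[of p] d du by simp
qed

text \<open>With p and p + 1 in the semigroup, n = (n div p - n mod p) * p + (n mod p) * (p + 1);
  for p > 0 the first coefficient is not negative as soon as n \<ge> p * p.\<close>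

lemma value_semigroup_cofinite:
  obtains c where "\<And>n. n \<ge> c \<Longrightarrow> n \<in> value_semigroup (a, b)"
proof -
  obtain p where p: "p \<in> value_semigroup (a, b)" "Suc p \<in> value_semigroup (a, b)"
    using value_semigroup_consecutive .
  have "n \<in> value_semigroup (a, b)" if n: "n \<ge> p * p" for n
  proof (cases "p = 0")
    case True
    then show ?thesis using value_semigroup_mult[OF p(2), of n] by simp
  next
    case False
    have le: "n mod p \<le> n div p"
      using n False by (metis div_le_mono less_imp_le mod_less_divisor nonzero_mult_div_cancel_right
          neq0_conv order_trans)
    have "(n div p - n mod p) * p + n mod p * Suc p \<in> value_semigroup (a, b)"
      using p by (intro value_semigroup_add value_semigroup_mult)
    also have "(n div p - n mod p) * p + n mod p * Suc p = (n div p - n mod p + n mod p) * p + n mod p"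
      by (simp add: algebra_simps)
    also have "\<dots> = n" using le by simp
    finally show ?thesis .
  qed
  then show ?thesis by (rule that)
qed

text \<open>An expansion with a separate series in x and y for every order would require infinite
  sums of such series. Instead only m series \<open>G e\<close> are used, one per residue class
  modulo the order m of a nonzero coordinate z, and powers of z fill the gaps. The expansion then
  regroups into finitely many products \<open>\<iota> (H e) * G e\<close>.\<close>

lemma parametrization_conductor:
  obtains c where "\<And>\<phi>. (\<forall>i<c. \<phi> $ i = 0) \<Longrightarrow> \<exists>F. subst2 F (a, b) = \<phi>"
proof -
  let ?e = "\<lambda>F. subst2 F (a, b)"
  obtain c0 where c0: "\<And>n. n \<ge> c0 \<Longrightarrow> n \<in> value_semigroup (a, b)"
    using value_semigroup_cofinite by blast
  have zab: "a $ 0 = 0" "b $ 0 = 0" by (fact primitive_arc)+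
  \<comment> \<open>z is a coordinate that does not vanish identically on the arc, and \<iota>
    regards a power series in one variable as a series in that coordinate.\<close>
  obtain z \<iota> where z: "z $ 0 = 0" "z \<noteq> 0" "\<And>H. ?e (\<iota> H) = H oo z"
  proof (cases "a = 0")
    case True
    then show ?thesis using that[of b "\<lambda>H. Abs_fps (\<lambda>j. fps_const (H $ j))"] primitive_arc
      by (auto simp: subst2_in_y)
  next
    case False
    then show ?thesis using that[of a fps_const] primitive_arc by (auto simp: subst2_fps_const)
  qed
  define m where "m = subdegree z"
  have m: "m > 0" using z(1,2) by (auto simp: m_def subdegree_eq_0_iff intro!: gr0I)
  have "\<exists>G. ?e G \<noteq> 0 \<and> subdegree (?e G) = c0 + e" for e
    using c0[of "c0 + e"] by (auto simp: value_semigroup_def)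
  then obtain G where G: "\<And>e. ?e (G e) \<noteq> 0" "\<And>e. subdegree (?e (G e)) = c0 + e" by metis
  define \<psi> where "\<psi> k = z ^ (k div m) * ?e (G (k mod m))" for k
  have \<psi>: "\<psi> k \<noteq> 0" "subdegree (\<psi> k) = c0 + k" for k
    using z(2) G by (auto simp: \<psi>_def m_def[symmetric])
  have "\<exists>F. ?e F = \<phi>" if \<phi>: "\<forall>i<c0. \<phi> $ i = 0" for \<phi>
  proof -
    define K where "K = {\<phi> :: complex fps. \<forall>i<c0. \<phi> $ i = 0}"
    have K1: "\<phi> - fps_const c * \<psi> k \<in> K" if "\<phi> \<in> K" for \<phi> c k
    proof -
      have "\<psi> k $ i = 0" if "i < c0" for i
        using that \<psi>(2)[of k] by (intro nth_less_subdegree_zero) simp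
      then show ?thesis using that by (auto simp: K_def)
    qed
    have K2: "subdegree \<phi> \<in> range ((+) c0)" if "\<phi> \<in> K" "\<phi> \<noteq> 0" for \<phi>
    proof -
      have "subdegree \<phi> \<ge> c0" using that by (intro subdegree_geI) (auto simp: K_def)
      then show ?thesis by (auto simp: le_iff_add)
    qed
    have "\<exists>c. \<forall>N. \<forall>n\<le>N. \<phi> $ n = (\<Sum>k\<le>N. fps_const (c k) * \<psi> k) $ n"
    proof (rule expansion_in_sequence[of "(+) c0" \<psi> K \<phi>])
      show "\<phi> \<in> K" using \<phi> by (simp add: K_def)
    qed (use K1 K2 \<psi> in \<open>auto simp: strict_mono_def\<close>)
    then obtain c where c: "\<forall>N. \<forall>n\<le>N. \<phi> $ n = (\<Sum>k\<le>N. fps_const (c k) * \<psi> k) $ n" ..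
    define H where "H e = Abs_fps (\<lambda>q. c (q * m + e))" for e
    define F where "F = (\<Sum>e<m. \<iota> (H e) * G e)"
    have "?e F $ n = \<phi> $ n" for n
    proof -
      have trunc: "(H e oo z) $ i = (\<Sum>q<Suc n. fps_const (c (q * m + e)) * z ^ q) $ i" if "i \<le> n" for e i
      proof -
        have "(\<Sum>q\<le>i. c (q * m + e) * z ^ q $ i) = (\<Sum>q<Suc n. c (q * m + e) * z ^ q $ i)"
          using that z(1) startsby_zero_power_prefix[of z]
          by (intro sum.mono_neutral_left) auto
        then show ?thesis by (simp add: fps_compose_nth H_def fps_sum_nth atLeast0AtMost)
      qed
      have "?e F $ n = (\<Sum>e<m. ((H e oo z) * ?e (G e)) $ n)"
        using zab by (simp add: F_def subst2_sum subst2_mult z(3) fps_sum_nth)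
      also have "\<dots> = (\<Sum>e<m. ((\<Sum>q<Suc n. fps_const (c (q * m + e)) * z ^ q) * ?e (G e)) $ n)"
        by (intro sum.cong refl) (simp add: fps_mult_nth trunc)
      also have "\<dots> = (\<Sum>e<m. \<Sum>q<Suc n. (fps_const (c (q * m + e)) * \<psi> (q * m + e)) $ n)"
        unfolding sum_distrib_right fps_sum_nth \<psi>_def
        by (intro sum.cong refl) (simp add: mult_ac)
      also have "\<dots> = (\<Sum>q<Suc n. \<Sum>e<m. (fps_const (c (q * m + e)) * \<psi> (q * m + e)) $ n)"
        by (rule sum.swap)
      \<comment> \<open>The double index (q, e) is division of k by m with remainder e.\<close>
      also have "\<dots> = (\<Sum>q<Suc n. \<Sum>k\<in>{q * m..<q * m + m}. (fps_const (c k) * \<psi> k) $ n)"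
      proof (rule sum.cong[OF refl])
        fix q
        show "(\<Sum>e<m. (fps_const (c (q * m + e)) * \<psi> (q * m + e)) $ n)
          = (\<Sum>k\<in>{q * m..<q * m + m}. (fps_const (c k) * \<psi> k) $ n)"
          using sum.shift_bounds_nat_ivl[of "\<lambda>k. (fps_const (c k) * \<psi> k) $ n" 0 "q * m" m]
          by (simp add: atLeast0LessThan add.commute del: fps_mult_left_const_nth)
      qed
      also have "\<dots> = (\<Sum>k<Suc n * m. (fps_const (c k) * \<psi> k) $ n)"
        by (rule sum.nat_group)
      also have "\<dots> = (\<Sum>k\<le>Suc n * m. (fps_const (c k) * \<psi> k) $ n)"
      proof -
        have "n < Suc n * m" using m by (metis Suc_le_lessD nat_mult_1_right mult_le_mono2 Suc_leI One_nat_def)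
        then have "\<psi> (Suc n * m) $ n = 0"
          using \<psi>(2)[of "Suc n * m"] by (intro nth_less_subdegree_zero) simp
        then show ?thesis by (simp flip: lessThan_Suc_atMost)
      qed
      also have "\<dots> = \<phi> $ n"
      proof -
        have "n \<le> Suc n * m" using m by (cases m) auto
        then show ?thesis using c by (simp add: fps_sum_nth)
      qed
      finally show ?thesis .
    qed
    then show ?thesis by (metis fps_ext)
  qed
  then show ?thesis by (rule that)
qed

end

section \<open>Intersection multiplicities as orders\<close>

lemma ideal_gen_add:
  assumes "x \<in> ideal_gen S" "y \<in> ideal_gen S" shows "x + y \<in> ideal_gen S"
proof -
  obtain f h where "x = (\<Sum>s\<in>S. f s * s)" "y = (\<Sum>s\<in>S. h s * s)"
    using assms by (auto simp: ideal_gen_def)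
  then have "x + y = (\<Sum>s\<in>S. (f s + h s) * s)" by (simp add: sum.distrib distrib_right)
  then show ?thesis unfolding ideal_gen_def by (intro CollectI exI[of _ "\<lambda>s. f s + h s"]) simp
qed

lemma ideal_gen_mult:
  assumes "x \<in> ideal_gen S" shows "k * x \<in> ideal_gen S"
proof -
  obtain f where "x = (\<Sum>s\<in>S. f s * s)" using assms by (auto simp: ideal_gen_def)
  then have "k * x = (\<Sum>s\<in>S. (k * f s) * s)" by (simp add: sum_distrib_left mult.assoc)
  then show ?thesis unfolding ideal_gen_def by (intro CollectI exI[of _ "\<lambda>s. k * f s"]) simp
qed

lemma ideal_gen_0: "0 \<in> ideal_gen S"
  unfolding ideal_gen_def by (auto intro!: exI[of _ "\<lambda>s. 0"])

lemma subspace_ideal_gen: "pser.subspace (ideal_gen S)"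
  by (rule pser.subspaceI) (auto intro: ideal_gen_add ideal_gen_mult ideal_gen_0)

lemma ideal_gen_base:
  assumes "finite S" "p \<in> S" shows "p \<in> ideal_gen S"
proof -
  have "(\<Sum>s\<in>S. (if s = p then 1 else 0) * s) = (\<Sum>s\<in>S. if s = p then p else 0)"
    by (intro sum.cong) auto
  then show ?thesis unfolding ideal_gen_def using assms
    by (intro CollectI exI[of _ "\<lambda>s. if s = p then 1 else 0"]) simp
qed

lemma ideal_gen_insert:
  assumes "finite S"
  shows "ideal_gen (insert p S) = {k * p + x | k x. x \<in> ideal_gen S}"
proof (cases "p \<in> S")
  case True
  then have mem: "k * p + x \<in> ideal_gen S" if "x \<in> ideal_gen S" for k x
    by (rule ideal_gen_add[OF ideal_gen_mult[OF ideal_gen_base[OF assms]] that])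
  show ?thesis
  proof (rule set_eqI, rule iffI)
    fix x assume "x \<in> ideal_gen (insert p S)"
    then have "x \<in> ideal_gen S" using insert_absorb[OF True] by metis
    moreover have "x = 0 * p + x" by simp
    ultimately show "x \<in> {k * p + x | k x. x \<in> ideal_gen S}" by blast
  next
    fix x assume "x \<in> {k * p + x | k x. x \<in> ideal_gen S}"
    then have "x \<in> ideal_gen S" using mem by auto
    then show "x \<in> ideal_gen (insert p S)" using insert_absorb[OF True] by metis
  qed
next
  case False
  have upd: "(\<Sum>s\<in>S. (f(p := k)) s * s) = (\<Sum>s\<in>S. f s * s)" for f k
    using False by (intro sum.cong) auto
  show ?thesis
  proof (rule set_eqI, rule iffI)
    fix x assume "x \<in> ideal_gen (insert p S)"
    then obtain f where "x = f p * p + (\<Sum>s\<in>S. f s * s)"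
      using assms False by (auto simp: ideal_gen_def)
    then show "x \<in> {k * p + x | k x. x \<in> ideal_gen S}" by (auto simp: ideal_gen_def)
  next
    fix x assume "x \<in> {k * p + x | k x. x \<in> ideal_gen S}"
    then obtain k f where "x = k * p + (\<Sum>s\<in>S. f s * s)" by (auto simp: ideal_gen_def)
    then have "x = (\<Sum>s\<in>insert p S. (f(p := k)) s * s)" using upd[of f k] assms False by simp
    then show "x \<in> ideal_gen (insert p S)"
      unfolding ideal_gen_def by (intro CollectI exI[of _ "f(p := k)"]) simp
  qed
qed

lemma ideal_gen_single': "x \<in> ideal_gen {g} \<longleftrightarrow> (\<exists>k. x = k * g)"
  by (auto simp: ideal_gen_single)

lemma ideal_gen_pair: "x \<in> ideal_gen {p, q} \<longleftrightarrow> (\<exists>k l. x = k * p + l * q)"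
  by (auto simp: ideal_gen_insert[of "{q}"] ideal_gen_single')

lemma ideal_gen_triple: "x \<in> ideal_gen {p, q, r} \<longleftrightarrow> (\<exists>k l m. x = k * p + (l * q + m * r))"
  by (auto simp: ideal_gen_insert[of "{q, r}"] ideal_gen_pair)

lemma ideal_gen_subset:
  assumes "finite S" "finite T" "S \<subseteq> ideal_gen T" shows "ideal_gen S \<subseteq> ideal_gen T"
  using assms(1,3)
proof (induction S rule: finite_induct)
  case empty
  then show ?case using ideal_gen_0 by (auto simp: ideal_gen_def)
next
  case (insert p S)
  show ?case
  proof
    fix x assume "x \<in> ideal_gen (insert p S)"
    then obtain k y where "x = k * p + y" "y \<in> ideal_gen S"
      using ideal_gen_insert[OF insert.hyps(1)] by auto
    moreover have "p \<in> ideal_gen T" "ideal_gen S \<subseteq> ideal_gen T" using insert by auto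
    ultimately show "x \<in> ideal_gen T" using ideal_gen_add[OF ideal_gen_mult] by blast
  qed
qed

lemma ideal_gen_eq:
  assumes "finite S" "finite T" "S \<subseteq> ideal_gen T" "T \<subseteq> ideal_gen S"
  shows "ideal_gen S = ideal_gen T"
  using assms ideal_gen_subset by blast

section \<open>Codimensions of ideals\<close>

abbreviation codim :: "pseries2 set \<Rightarrow> nat \<Rightarrow> bool" where
  "codim I n \<equiv> pser.rel_dim I UNIV n"

text \<open>Every dimension in the theorem passes through here: a chain provides the witness for
  \<open>THE\<close>, and the uniqueness of chain lengths shows that it is the only one.\<close>

lemma quotient_dim_eq:
  assumes I: "pser.subspace I" and n: "codim I n"
  shows "quotient_dim I = n"
  unfolding quotient_dim_def
proof (rule the_equality)
  obtain B where B: "finite B" "card B = n"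
    "\<And>c. (\<Sum>b\<in>B. scalar (c b) * b) \<in> I \<Longrightarrow> \<forall>b\<in>B. c b = 0"
    "\<And>w. w \<in> UNIV \<Longrightarrow> \<exists>c. w - (\<Sum>b\<in>B. scalar (c b) * b) \<in> I" "B \<subseteq> UNIV"
    by (rule pser.rel_dim_imp_basis[OF n I], rule that, assumption+)
  have "\<exists>!c. (\<forall>b. b \<notin> B \<longrightarrow> c b = 0) \<and> F - (\<Sum>b\<in>B. scalar (c b) * b) \<in> I" for F
  proof (rule ex_ex1I)
    obtain c where c: "F - (\<Sum>b\<in>B. scalar (c b) * b) \<in> I" using B(4)[of F] by auto
    have "(\<Sum>b\<in>B. scalar (if b \<in> B then c b else 0) * b) = (\<Sum>b\<in>B. scalar (c b) * b)"
      by (intro sum.cong) auto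
    then show "\<exists>c. (\<forall>b. b \<notin> B \<longrightarrow> c b = 0) \<and> F - (\<Sum>b\<in>B. scalar (c b) * b) \<in> I"
      using c by (intro exI[of _ "\<lambda>b. if b \<in> B then c b else 0"]) simp
  next
    fix c c'
    assume c: "(\<forall>b. b \<notin> B \<longrightarrow> c b = 0) \<and> F - (\<Sum>b\<in>B. scalar (c b) * b) \<in> I"
      and c': "(\<forall>b. b \<notin> B \<longrightarrow> c' b = 0) \<and> F - (\<Sum>b\<in>B. scalar (c' b) * b) \<in> I"
    have "(\<Sum>b\<in>B. scalar (c b - c' b) * b)
        = (F - (\<Sum>b\<in>B. scalar (c' b) * b)) - (F - (\<Sum>b\<in>B. scalar (c b) * b))"
      by (simp add: pser.scale_left_diff_distrib sum_subtractf)
    also have "\<dots> \<in> I" by (rule pser.subspace_diff[OF I conjunct2[OF c'] conjunct2[OF c]])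
    finally have "\<forall>b\<in>B. c b - c' b = 0" by (rule B(3))
    then show "c = c'" using c c' by (intro ext) (metis eq_iff_diff_eq_0)
  qed
  then show "\<exists>B. quotient_basis I B \<and> card B = n" using B(1,2) by (auto simp: quotient_basis_def)
next
  fix m assume "\<exists>B. quotient_basis I B \<and> card B = m"
  then obtain B where B: "finite B" "card B = m"
    and ex1: "\<And>F. \<exists>!c. (\<forall>b. b \<notin> B \<longrightarrow> c b = 0) \<and> F - (\<Sum>b\<in>B. scalar (c b) * b) \<in> I"
    by (auto simp: quotient_basis_def)
  \<comment> \<open>Independence comes from the uniqueness of the coefficients for the zero series,
    with coefficients set to 0 outside B.\<close>
  have indep: "\<forall>b\<in>B. c b = 0" if c: "(\<Sum>b\<in>B. scalar (c b) * b) \<in> I" for c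
  proof -
    let ?c = "\<lambda>b. if b \<in> B then c b else 0"
    have "(\<Sum>b\<in>B. scalar (?c b) * b) = (\<Sum>b\<in>B. scalar (c b) * b)"
      by (intro sum.cong) auto
    then have "0 - (\<Sum>b\<in>B. scalar (?c b) * b) \<in> I"
      using c I pser.subspace_neg by (simp del: if_cong)
    moreover have "0 - (\<Sum>b\<in>B. scalar 0 * b) \<in> I"
      using I pser.subspace_0 by (simp add: scalar_def)
    moreover define Q where "Q c \<longleftrightarrow> (\<forall>b. b \<notin> B \<longrightarrow> c b = 0) \<and> 0 - (\<Sum>b\<in>B. scalar (c b) * b) \<in> I" for c
    ultimately have "Q ?c" "Q (\<lambda>b. 0)" by simp_all
    moreover have "\<exists>!c. Q c" unfolding Q_def by (rule ex1)
    ultimately have "?c = (\<lambda>b. 0)" by (metis (no_types))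
    then have "?c b = 0" for b by (rule fun_cong)
    then show ?thesis by (metis (full_types))
  qed
  have "pser.rel_dim I {t + (\<Sum>b\<in>B. scalar (c b) * b) | t c. t \<in> I} (card B)"
    by (rule pser.rel_dim_basis_imp[OF B(1) I indep])
  moreover have "{t + (\<Sum>b\<in>B. scalar (c b) * b) | t c. t \<in> I} = UNIV"
  proof (rule UNIV_eq_I[symmetric])
    fix F
    obtain c where "F - (\<Sum>b\<in>B. scalar (c b) * b) \<in> I" using ex1[of F] by blast
    moreover have "F = (F - (\<Sum>b\<in>B. scalar (c b) * b)) + (\<Sum>b\<in>B. scalar (c b) * b)" by simp
    ultimately show "F \<in> {t + (\<Sum>b\<in>B. scalar (c b) * b) | t c. t \<in> I}" by blast
  qed
  ultimately show "m = n" using pser.rel_dim_unique[OF n _ I] B(2) by simp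
qed

lemma quotient_dim_ideal_gen: "codim (ideal_gen S) n \<Longrightarrow> quotient_dim (ideal_gen S) = n"
  by (rule quotient_dim_eq[OF subspace_ideal_gen])

lemma codim_unit: "u dvd 1 \<Longrightarrow> codim (ideal_gen {u, q}) 0"
proof -
  assume "u dvd 1"
  then obtain w where w: "1 = u * w" by (auto elim: dvdE)
  have "x \<in> ideal_gen {u, q}" for x
    unfolding ideal_gen_pair by (rule exI[of _ "x * w"], rule exI[of _ 0]) (use w in \<open>simp add: mult_ac\<close>)
  then have "ideal_gen {u, q} = UNIV" by blast
  then show ?thesis using pser.rel_dim_refl[of UNIV] by simp
qed

lemma linear_mult: "Vector_Spaces.linear (\<lambda>c F. scalar c * F) (\<lambda>c F. scalar c * F) ((*) k)"
  by unfold_locales (simp_all add: algebra_simps)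

lemma linear_fps_mult:
  "Vector_Spaces.linear (\<lambda>c \<phi>. fps_const c * \<phi>) (\<lambda>c \<phi>. fps_const c * (\<phi> :: complex fps)) ((*) k)"
  by unfold_locales (simp_all add: algebra_simps)

lemma linear_subst2:
  assumes "a $ 0 = 0" "b $ 0 = 0"
  shows "Vector_Spaces.linear (\<lambda>c F. scalar c * F) (\<lambda>c \<phi>. fps_const c * \<phi>) (\<lambda>F. subst2 F (a, b))"
  by unfold_locales (simp_all add: subst2_add subst2_mult subst2_scalar assms)

text \<open>Multiplication by p carries C[[x,y]]/(r, q) isomorphically onto (p, q)/(p * r, q);
  injectivity is the cancellation of p modulo q.\<close>

lemma codim_mult:
  assumes cancel: "\<And>w. q dvd p * w \<Longrightarrow> q dvd w"
    and n: "codim (ideal_gen {p, q}) n" and m: "codim (ideal_gen {r, q}) m"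
  shows "codim (ideal_gen {p * r, q}) (n + m)"
proof -
  have iff: "p * w \<in> ideal_gen {p * r, q} \<longleftrightarrow> w \<in> ideal_gen {r, q}" for w
  proof
    assume "p * w \<in> ideal_gen {p * r, q}"
    then obtain k l where "p * w = k * (p * r) + l * q" by (auto simp: ideal_gen_pair)
    then have "p * (w - k * r) = q * l" by (simp add: algebra_simps)
    then have "q dvd w - k * r" using cancel by (metis dvdI)
    then obtain s where "w - k * r = q * s" by (auto elim: dvdE)
    then have "w = k * r + s * q" by (simp add: algebra_simps)
    then show "w \<in> ideal_gen {r, q}" by (auto simp: ideal_gen_pair)
  next
    assume "w \<in> ideal_gen {r, q}"
    then obtain k l where "w = k * r + l * q" by (auto simp: ideal_gen_pair)
    then have "p * w = k * (p * r) + (p * l) * q" by (simp add: algebra_simps)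
    then show "p * w \<in> ideal_gen {p * r, q}" unfolding ideal_gen_pair by blast
  qed
  have "pser.rel_dim (ideal_gen {p * r, q}) {t + p * w | t w. t \<in> ideal_gen {p * r, q} \<and> w \<in> UNIV} m"
    by (rule rel_dim_image[OF linear_mult m]) (simp_all add: subspace_ideal_gen iff)
  moreover have "{t + p * w | t w. t \<in> ideal_gen {p * r, q} \<and> w \<in> UNIV} = ideal_gen {p, q}"
  proof (rule set_eqI, rule iffI)
    fix x assume "x \<in> {t + p * w | t w. t \<in> ideal_gen {p * r, q} \<and> w \<in> UNIV}"
    then obtain k l w where "x = k * (p * r) + l * q + p * w" by (auto simp: ideal_gen_pair)
    then have "x = (k * r + w) * p + l * q" by (simp add: algebra_simps)
    then show "x \<in> ideal_gen {p, q}" unfolding ideal_gen_pair by blast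
  next
    fix x assume "x \<in> ideal_gen {p, q}"
    then obtain k l where "x = k * p + l * q" by (auto simp: ideal_gen_pair)
    then have "x = (0 * (p * r) + l * q) + p * k" by (simp add: algebra_simps)
    moreover have "0 * (p * r) + l * q \<in> ideal_gen {p * r, q}" unfolding ideal_gen_pair by blast
    ultimately show "x \<in> {t + p * w | t w. t \<in> ideal_gen {p * r, q} \<and> w \<in> UNIV}" by blast
  qed
  ultimately show ?thesis using pser.rel_dim_trans[OF n] by (simp add: add.commute)
qed

lemma irreducible_cancel:
  fixes p q w :: pseries2
  assumes "irreducible p" "\<not> p dvd q" "q dvd p * w"
  shows "q dvd w"
proof -
  obtain e where e: "p * w = q * e" using assms(3) by (auto elim: dvdE)
  then have "p dvd q * e" by (metis dvd_triv_left)
  then have "p dvd e" using irreducible_imp_prime assms(1,2) by blast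
  then obtain e' where "e = p * e'" by (auto elim: dvdE)
  then have "p * w = p * (q * e')" using e by (simp add: mult_ac)
  moreover have "p \<noteq> 0" using assms(1) by auto
  ultimately have "w = q * e'" by (metis mult_left_cancel)
  then show ?thesis by simp
qed

lemma rel_dim_order_filtration: "fser.rel_dim {\<phi>. \<forall>i<n. \<phi> $ i = 0} UNIV n"
proof (induction n)
  case 0
  show ?case using fser.rel_dim_refl[of UNIV] by simp
next
  case (Suc n)
  let ?T = "\<lambda>n. {\<phi> :: complex fps. \<forall>i<n. \<phi> $ i = 0}"
  have "fps_X ^ n \<notin> ?T (Suc n)" by (auto simp: fps_X_power_nth)
  then have "fser.rel_dim (?T (Suc n)) (fser.adjoin (?T (Suc n)) (fps_X ^ n)) (Suc 0)"
    by (intro fser.rel_dim.intros)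
  moreover have "fser.adjoin (?T (Suc n)) (fps_X ^ n) = ?T n"
  proof (rule set_eqI, rule iffI)
    fix x assume "x \<in> fser.adjoin (?T (Suc n)) (fps_X ^ n)"
    then show "x \<in> ?T n" by (auto simp: fser.adjoin_def fps_X_power_nth)
  next
    fix x assume x: "x \<in> ?T n"
    have "x = (x - fps_const (x $ n) * fps_X ^ n) + fps_const (x $ n) * fps_X ^ n" by simp
    moreover have "x - fps_const (x $ n) * fps_X ^ n \<in> ?T (Suc n)"
      using x by (auto simp: fps_X_power_nth less_Suc_eq)
    ultimately show "x \<in> fser.adjoin (?T (Suc n)) (fps_X ^ n)" unfolding fser.adjoin_def by blast
  qed
  ultimately show ?case using fser.rel_dim_trans[OF Suc] by fastforce
qed

text \<open>Let A be the image of C[[x,y]] in C[[t]] and s the restriction of F to the arc.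
  Multiplication by s maps C[[t]]/A isomorphically onto s C[[t]]/(s A), so both have dimension
  \<delta>; counting the codimension of s A through A and through s C[[t]] leaves dim A/(s A) = ord
  s. This is pulled back along the surjection onto A, whose kernel is generated by g.\<close>

lemma codim_irreducible:
  assumes g: "irreducible g" and prim: "primitive_parametrization (a, b) (ideal_gen {g})"
    and nz: "subst2 F (a, b) \<noteq> 0"
  shows "codim (ideal_gen {g, F}) (subdegree (subst2 F (a, b)))"
proof -
  let ?e = "\<lambda>F. subst2 F (a, b)"
  let ?s = "subdegree (?e F)"
  have z: "a $ 0 = 0" "b $ 0 = 0" using primitive_arc[OF g prim] by auto
  define A where "A = range ?e"
  define M where "M X = {?e F * \<phi> | \<phi>. \<phi> \<in> X}" for X
  have subA: "fser.subspace A"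
  proof (rule fser.subspaceI)
    show "0 \<in> A" using rangeI[of ?e 0] by (simp add: A_def subst2_0)
  next
    fix x y assume "x \<in> A" "y \<in> A"
    then obtain X Y where "x + y = ?e (X + Y)" by (auto simp: A_def subst2_add)
    then show "x + y \<in> A" by (simp add: A_def)
  next
    fix c x assume "x \<in> A"
    then obtain X where "fps_const c * x = ?e (scalar c * X)"
      by (auto simp: A_def subst2_mult subst2_scalar z)
    then show "fps_const c * x \<in> A" by (simp add: A_def)
  qed
  have subM: "fser.subspace (M X)" if "fser.subspace X" for X
  proof (rule fser.subspaceI)
    show "0 \<in> M X" using fser.subspace_0[OF that] by (auto simp: M_def)
  next
    fix x y assume "x \<in> M X" "y \<in> M X"
    then obtain \<phi> \<psi> where "\<phi> \<in> X" "\<psi> \<in> X" "x + y = ?e F * (\<phi> + \<psi>)"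
      by (auto simp: M_def distrib_left)
    then show "x + y \<in> M X" using fser.subspace_add[OF that] by (auto simp: M_def)
  next
    fix c x assume "x \<in> M X"
    then obtain \<phi> where "\<phi> \<in> X" "fps_const c * x = ?e F * (fps_const c * \<phi>)"
      by (auto simp: M_def mult.left_commute)
    then show "fps_const c * x \<in> M X" using fser.subspace_scale[OF that] unfolding M_def by blast
  qed
  obtain c where c: "\<And>\<phi>. (\<forall>i<c. \<phi> $ i = 0) \<Longrightarrow> \<exists>F. ?e F = \<phi>"
    using parametrization_conductor[OF g prim] by blast
  have subT: "fser.subspace {\<phi> :: complex fps. \<forall>i<c. \<phi> $ i = 0}"
    by (rule fser.subspaceI) auto
  have TA: "{\<phi> :: complex fps. \<forall>i<c. \<phi> $ i = 0} \<subseteq> A"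
  proof
    fix \<phi> :: "complex fps" assume "\<phi> \<in> {\<phi>. \<forall>i<c. \<phi> $ i = 0}"
    then obtain X where "?e X = \<phi>" using c[of \<phi>] by auto
    then show "\<phi> \<in> A" by (auto simp: A_def)
  qed
  \<comment> \<open>Finiteness of \<delta> comes from the conductor: A contains all series of order
    at least c, which have finite codimension.\<close>
  obtain \<delta> \<epsilon> where \<delta>: "fser.rel_dim A UNIV \<delta>"
    and "fser.rel_dim {\<phi>. \<forall>i<c. \<phi> $ i = 0} A \<epsilon>"
    using fser.rel_dim_between[OF rel_dim_order_filtration subT subA TA subset_UNIV] .
  have image: "fser.rel_dim (M A) {t + ?e F * w | t w. t \<in> M A \<and> w \<in> UNIV} \<delta>"
    by (rule rel_dim_image[OF linear_fps_mult \<delta> subA subM[OF subA]]) (use nz in \<open>auto simp: M_def\<close>)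
  have "{t + ?e F * w | t w. t \<in> M A \<and> w \<in> UNIV} = M UNIV"
  proof (rule set_eqI, rule iffI)
    fix x assume "x \<in> {t + ?e F * w | t w. t \<in> M A \<and> w \<in> UNIV}"
    then obtain \<phi> w where "x = ?e F * \<phi> + ?e F * w" by (auto simp: M_def)
    then have "x = ?e F * (\<phi> + w)" by (simp add: algebra_simps)
    then show "x \<in> M UNIV" by (auto simp: M_def)
  next
    fix x assume "x \<in> M UNIV"
    then obtain w where "x = 0 + ?e F * w" by (auto simp: M_def)
    moreover have "0 \<in> M A" using subM[OF subA] by (rule fser.subspace_0)
    ultimately show "x \<in> {t + ?e F * w | t w. t \<in> M A \<and> w \<in> UNIV}" by blast
  qed
  with image have image': "fser.rel_dim (M A) (M UNIV) \<delta>" by simp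
  have "M UNIV = {\<phi>. \<forall>i<?s. \<phi> $ i = 0}"
  proof (rule set_eqI, rule iffI)
    fix x assume "x \<in> M UNIV"
    then obtain w where "x = ?e F * w" by (auto simp: M_def)
    then show "x \<in> {\<phi>. \<forall>i<?s. \<phi> $ i = 0}"
      by (auto simp: fps_mult_nth intro!: sum.neutral nth_less_subdegree_zero)
  next
    fix x :: "complex fps" assume x: "x \<in> {\<phi>. \<forall>i<?s. \<phi> $ i = 0}"
    show "x \<in> M UNIV"
    proof (cases "x = 0")
      case True
      then show ?thesis by (auto simp: M_def intro!: exI[of _ 0])
    next
      case False
      then have "?s \<le> subdegree x" using x by (intro subdegree_geI) auto
      then show ?thesis using subdegree_le_imp_dvd_left_divring[OF nz] by (auto simp: M_def)
    qed
  qed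
  then have "fser.rel_dim (M UNIV) UNIV ?s" using rel_dim_order_filtration[of ?s] by simp
  then have tot: "fser.rel_dim (M A) UNIV (\<delta> + ?s)" using fser.rel_dim_trans image' by blast
  have MA: "M A \<subseteq> A" unfolding M_def A_def by (auto simp flip: subst2_mult[OF z])
  obtain p q where p: "fser.rel_dim A UNIV p" and q: "fser.rel_dim (M A) A q"
    using fser.rel_dim_between[OF tot subM[OF subA] subA MA subset_UNIV] .
  have "p = \<delta>" using fser.rel_dim_unique[OF \<delta> p subA] .
  moreover have "q + p = \<delta> + ?s"
    using fser.rel_dim_unique[OF tot fser.rel_dim_trans[OF p q] subM[OF subA]] .
  ultimately have qs: "q = ?s" by simp
  have "pser.rel_dim {w \<in> UNIV. ?e w \<in> M A} {w \<in> UNIV. ?e w \<in> A} q"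
  proof (rule rel_dim_vimage[OF linear_subst2[OF z] q subM[OF subA]])
    show "pser.subspace UNIV" by simp
    show "A \<subseteq> {t + ?e w | t w. t \<in> M A \<and> w \<in> UNIV}"
    proof
      fix x assume "x \<in> A"
      then obtain w where "x = 0 + ?e w" by (auto simp: A_def)
      moreover have "0 \<in> M A" using subM[OF subA] by (rule fser.subspace_0)
      ultimately show "x \<in> {t + ?e w | t w. t \<in> M A \<and> w \<in> UNIV}" by blast
    qed
  qed
  moreover have "{w \<in> UNIV. ?e w \<in> A} = UNIV" by (auto simp: A_def)
  moreover have "{w \<in> UNIV. ?e w \<in> M A} = ideal_gen {g, F}"
  proof (rule set_eqI, rule iffI)
    fix w assume "w \<in> {w \<in> UNIV. ?e w \<in> M A}"
    then obtain k where "?e w = ?e F * ?e k" by (auto simp: M_def A_def)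
    then have "?e (w - F * k) = 0" by (simp add: subst2_diff subst2_mult z)
    then have "g dvd w - F * k" using primitive_vanish_iff[OF g prim] by blast
    then obtain l where "w - F * k = g * l" by (auto elim: dvdE)
    then have "w = l * g + k * F" by (simp add: algebra_simps)
    then show "w \<in> ideal_gen {g, F}" unfolding ideal_gen_pair by blast
  next
    fix w assume "w \<in> ideal_gen {g, F}"
    then obtain l k where w: "w = l * g + k * F" by (auto simp: ideal_gen_pair)
    have "?e g = 0" using primitive_arc[OF g prim] by auto
    then have "?e w = ?e F * ?e k" by (simp add: w subst2_add subst2_mult z mult.commute)
    then show "w \<in> {w \<in> UNIV. ?e w \<in> M A}" by (auto simp: M_def A_def)
  qed
  ultimately show ?thesis using qs by simp
qed

lemma codim_prod:
  assumes G: "finite G" "\<And>g. g \<in> G \<Longrightarrow> irreducible g" and u: "u dvd 1"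
    and prim: "\<And>g. g \<in> G \<Longrightarrow> primitive_parametrization (\<gamma> g) (ideal_gen {g})"
    and nz: "\<And>g. g \<in> G \<Longrightarrow> subst2 F (\<gamma> g) \<noteq> 0"
  shows "codim (ideal_gen {u * \<Prod>G, F}) (\<Sum>g\<in>G. subdegree (subst2 F (\<gamma> g)))"
  using G prim nz
proof (induction G rule: finite_induct)
  case empty
  then show ?case using codim_unit[OF u] by simp
next
  case (insert g G)
  obtain a b where ab: "\<gamma> g = (a, b)" by (cases "\<gamma> g")
  have g: "irreducible g" and p: "primitive_parametrization (a, b) (ideal_gen {g})"
    and n: "subst2 F (a, b) \<noteq> 0" using insert.prems[of g] ab by auto
  have "\<not> g dvd F" using n primitive_vanish_iff[OF g p] by blast
  then have cancel: "F dvd w" if "F dvd g * w" for w using irreducible_cancel[OF g] that by blast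
  have ih: "codim (ideal_gen {u * \<Prod>G, F}) (\<Sum>g\<in>G. subdegree (subst2 F (\<gamma> g)))"
    by (rule insert.IH) (simp_all add: insert.prems)
  have "codim (ideal_gen {g * (u * \<Prod>G), F})
      (subdegree (subst2 F (a, b)) + (\<Sum>g\<in>G. subdegree (subst2 F (\<gamma> g))))"
    by (rule codim_mult[OF cancel codim_irreducible[OF g p n] ih])
  then show ?case using insert.hyps ab by (simp add: mult_ac)
qed

text \<open>Induction over a factorization instead of a product over a set, since E, later the polar
  curve, may have multiple factors; the relation between the orders on a branch is added once for
  each repetition.\<close>

lemma codim_additive_relation:
  assumes "E \<noteq> 0"
    and "\<And>\<delta> a b. irreducible \<delta> \<Longrightarrow> \<delta> dvd E \<Longrightarrow> primitive_parametrization (a, b) (ideal_gen {\<delta>}) \<Longrightarrow>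
      subst2 A (a, b) \<noteq> 0 \<and> subst2 B (a, b) \<noteq> 0 \<and> subst2 C (a, b) \<noteq> 0 \<and>
      subdegree (subst2 A (a, b)) = subdegree (subst2 B (a, b)) + subdegree (subst2 C (a, b))"
  shows "\<exists>n m. codim (ideal_gen {E, A}) (n + m) \<and> codim (ideal_gen {E, B}) n \<and> codim (ideal_gen {E, C}) m"
  using assms
proof (induction rule: factorization_induct)
  case (unit u)
  then show ?case using codim_unit by (metis add_0)
next
  case (mult p E)
  note H = mult.prems
  obtain a b where ab: "primitive_parametrization (a, b) (ideal_gen {p})"
    using irreducible_has_primitive_parametrization[OF mult.hyps(1)] .
  have nz: "subst2 A (a, b) \<noteq> 0" "subst2 B (a, b) \<noteq> 0" "subst2 C (a, b) \<noteq> 0"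
    and s: "subdegree (subst2 A (a, b)) = subdegree (subst2 B (a, b)) + subdegree (subst2 C (a, b))"
    using H[OF mult.hyps(1) _ ab] by auto
  have step: "codim (ideal_gen {p * E, F}) (subdegree (subst2 F (a, b)) + k)"
    if F: "subst2 F (a, b) \<noteq> 0" and k: "codim (ideal_gen {E, F}) k" for F k
  proof (rule codim_mult[OF _ codim_irreducible[OF mult.hyps(1) ab F] k])
    fix w assume "F dvd p * w"
    moreover have "\<not> p dvd F" using F primitive_vanish_iff[OF mult.hyps(1) ab] by blast
    ultimately show "F dvd w" using irreducible_cancel[OF mult.hyps(1)] by blast
  qed
  have "\<exists>n m. codim (ideal_gen {E, A}) (n + m) \<and> codim (ideal_gen {E, B}) n \<and> codim (ideal_gen {E, C}) m"
    by (rule mult.IH, rule H, assumption, rule dvd_mult, assumption+)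
  then obtain n m where nm: "codim (ideal_gen {E, A}) (n + m)" "codim (ideal_gen {E, B}) n"
    "codim (ideal_gen {E, C}) m" by blast
  show ?case
    using step[OF nz(1) nm(1)] step[OF nz(2) nm(2)] step[OF nz(3) nm(3)] s
    by (intro exI[of _ "subdegree (subst2 B (a, b)) + n"] exI[of _ "subdegree (subst2 C (a, b)) + m"])
      (simp add: add_ac)
qed

section \<open>The indices of an invariant curve\<close>

lemma subdegree_fps_deriv:
  fixes \<phi> :: "complex fps"
  assumes "\<phi> \<noteq> 0" "\<phi> $ 0 = 0"
  shows "fps_deriv \<phi> \<noteq> 0" "Suc (subdegree (fps_deriv \<phi>)) = subdegree \<phi>"
proof -
  have "subdegree \<phi> \<noteq> 0" using assms by (simp add: subdegree_eq_0_iff)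
  then obtain n where n: "subdegree \<phi> = Suc n" by (cases "subdegree \<phi>") auto
  have "\<phi> $ Suc n \<noteq> 0" using nth_subdegree_nonzero[OF assms(1)] n by metis
  moreover have "fps_deriv \<phi> $ n = of_nat (Suc n) * \<phi> $ Suc n" by simp
  ultimately have nz: "fps_deriv \<phi> $ n \<noteq> 0" by (metis mult_eq_0_iff of_nat_eq_0_iff nat.distinct(2))
  then show "fps_deriv \<phi> \<noteq> 0" by (metis fps_zero_nth)
  have "subdegree (fps_deriv \<phi>) = n"
    by (rule subdegreeI[OF nz]) (use n in \<open>auto intro!: nth_less_subdegree_zero\<close>)
  then show "Suc (subdegree (fps_deriv \<phi>)) = subdegree \<phi>" by (simp add: n)
qed

lemma irreducible_associated:
  fixes p q :: pseries2
  assumes "irreducible p" "irreducible q" "p dvd q" shows "q dvd p"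
proof -
  obtain e where e: "q = p * e" using assms(3) by (auto elim: dvdE)
  have "\<not> p dvd 1" using assms(1) by (simp add: irreducible_def)
  then have "e dvd 1" using irreducibleD[OF assms(2) e] by blast
  then show ?thesis using e by auto
qed

lemma irreducible_dvd_prod:
  fixes p :: pseries2
  assumes "irreducible p" "finite G" "p dvd \<Prod>G"
  shows "\<exists>g\<in>G. p dvd g"
proof -
  have "p dvd \<Prod>G \<longrightarrow> (\<exists>g\<in>G. p dvd g)" using assms(2)
  proof (induction G rule: finite_induct)
    case empty
    then show ?case using assms(1) by (simp add: irreducible_def)
  next
    case (insert g G)
    then show ?case using irreducible_imp_prime[OF assms(1), of g "\<Prod>G"] by auto
  qed
  then show ?thesis using assms(3) by blast
qed

lemma irreducible_factor_exists:
  fixes F :: pseries2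
  assumes "F \<noteq> 0" "\<not> F dvd 1"
  shows "\<exists>p. irreducible p \<and> p dvd F"
proof -
  have "\<not> F dvd 1 \<longrightarrow> (\<exists>p. irreducible p \<and> p dvd F)"
    using assms(1) by (induction rule: factorization_induct) (auto intro: dvd_triv_left)
  then show ?thesis using assms(2) by blast
qed

text \<open>Restricted to a transversal line, g would divide its own derivative, whose order is
  smaller by one.\<close>

lemma irreducible_not_dvd_derivs:
  assumes g: "irreducible g"
  shows "\<not> (g dvd deriv_x g \<and> g dvd deriv_y g)"
proof
  assume dv: "g dvd deriv_x g \<and> g dvd deriv_y g"
  have "g \<noteq> 0" using g by auto
  then obtain c where c: "subst2 g (fps_const c * fps_X, fps_X) \<noteq> 0"
    using exists_transversal_line by blast
  let ?a = "fps_const c * fps_X :: complex fps"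
  let ?\<psi> = "subst2 g (?a, fps_X)"
  have z: "?a $ 0 = 0" "(fps_X :: complex fps) $ 0 = 0" by simp_all
  have z0: "?\<psi> $ 0 = 0" using g pseries2_unit_iff[of g] by (simp add: subst2_nth_0 irreducible_def)
  have "?\<psi> dvd fps_deriv ?\<psi>"
    unfolding fps_deriv_subst2[OF z] using dv by (intro dvd_add dvd_mult2 subst2_dvd[OF z]) auto
  then have "subdegree ?\<psi> \<le> subdegree (fps_deriv ?\<psi>)"
    using subdegree_fps_deriv(1)[OF c z0] by (intro dvd_imp_subdegree_le) auto
  then show False using subdegree_fps_deriv(2)[OF c z0] by simp
qed

lemma value0_eq_0_decompose:
  assumes "value0 F = 0"
  obtains A B where "F = xvar * A + fps_X * B"
proof -
  have "F $ 0 = fps_X * fps_shift 1 (F $ 0)"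
    using assms by (intro fps_ext) (auto simp: value0_def)
  then have "F $ 0 = (xvar * fps_const (fps_shift 1 (F $ 0))) $ 0" by (simp add: xvar_def)
  have "F = xvar * fps_const (fps_shift 1 (F $ 0)) + fps_X * fps_shift 1 F"
  proof (rule fps_ext)
    fix n
    show "F $ n = (xvar * fps_const (fps_shift 1 (F $ 0)) + fps_X * fps_shift 1 F) $ n"
      using \<open>F $ 0 = fps_X * fps_shift 1 (F $ 0)\<close> by (cases n) (simp_all add: xvar_def)
  qed
  then show ?thesis by (rule that)
qed

section \<open>Lines through the origin\<close>

definition line :: "complex \<Rightarrow> pseries2" where
  "line c = xvar - scalar c * fps_X"

lemma subst2_line: "a $ 0 = 0 \<Longrightarrow> b $ 0 = 0 \<Longrightarrow> subst2 (line c) (a, b) = a - fps_const c * b"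
  by (simp add: line_def subst2_diff subst2_mult subst2_scalar subst2_xvar subst2_y)

text \<open>Along the arc (t, 0) the line has order 1; orders add up in a factorization, so one
  factor has order 0 and is a unit.\<close>

lemma irreducible_line: "irreducible (line c)"
proof -
  have ev: "subst2 (line c) (fps_X, 0) = fps_X" by (simp add: subst2_line)
  show ?thesis unfolding irreducible_def
  proof (intro conjI allI impI)
    show "line c \<noteq> 0" using ev by (auto simp: subst2_0)
    show "\<not> line c dvd 1"
      using subst2_nth_0[of "line c" fps_X 0] by (simp add: pseries2_unit_iff ev)
    fix A B assume "line c = A * B"
    then have AB: "subst2 A (fps_X, 0) * subst2 B (fps_X, 0) = fps_X"
      using ev by (simp add: subst2_mult)
    then have nz: "subst2 A (fps_X, 0) \<noteq> 0" "subst2 B (fps_X, 0) \<noteq> 0" by auto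
    then have "subdegree (subst2 A (fps_X, 0)) + subdegree (subst2 B (fps_X, 0)) = 1"
      using arg_cong[OF AB, of subdegree] by simp
    then have "subdegree (subst2 A (fps_X, 0)) = 0 \<or> subdegree (subst2 B (fps_X, 0)) = 0" by linarith
    then show "A dvd 1 \<or> B dvd 1" using subdegree_subst2_pos nz by (metis less_irrefl)
  qed
qed

lemma primitive_line: "primitive_parametrization (fps_const c * fps_X, fps_X) (ideal_gen {line c})"
proof -
  have "subdegree s = 1" if "s $ 0 = 0" "fps_X = b' oo s" for b' s :: "complex fps"
    using arg_cong[OF that(2), of subdegree] that(1) by simp
  then show ?thesis
    by (auto simp: primitive_parametrization.simps parametrization_iff subst2_line)
qed

text \<open>Multiplication by \<open>g\<close> and by \<open>h\<close> turns both Tjurina algebras into quotients of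
  $\mathbb{C}[[x,y]]/(f)$ by the same ideal.\<close>

lemma codim_triple_mult:
  assumes cancel: "\<And>w. f dvd p * w \<Longrightarrow> f dvd w"
  shows "p * w \<in> ideal_gen {p * A, p * B, f} \<longleftrightarrow> w \<in> ideal_gen {A, B, f}"
    "{t + p * w | t w. t \<in> ideal_gen {p * A, p * B, f} \<and> w \<in> UNIV} = ideal_gen {f, p}"
proof -
  show "p * w \<in> ideal_gen {p * A, p * B, f} \<longleftrightarrow> w \<in> ideal_gen {A, B, f}"
  proof
    assume "p * w \<in> ideal_gen {p * A, p * B, f}"
    then obtain k l m where "p * w = k * (p * A) + (l * (p * B) + m * f)"
      by (auto simp: ideal_gen_triple)
    then have "p * (w - (k * A + l * B)) = f * m" by (simp add: algebra_simps)
    then have "f dvd w - (k * A + l * B)" using cancel by (metis dvdI)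
    then obtain s where "w - (k * A + l * B) = f * s" by (auto elim: dvdE)
    then have "w = k * A + (l * B + s * f)" by (simp add: algebra_simps)
    then show "w \<in> ideal_gen {A, B, f}" unfolding ideal_gen_triple by blast
  next
    assume "w \<in> ideal_gen {A, B, f}"
    then obtain k l m where "w = k * A + (l * B + m * f)" by (auto simp: ideal_gen_triple)
    then have "p * w = k * (p * A) + (l * (p * B) + (p * m) * f)" by (simp add: algebra_simps)
    then show "p * w \<in> ideal_gen {p * A, p * B, f}" unfolding ideal_gen_triple by blast
  qed
  show "{t + p * w | t w. t \<in> ideal_gen {p * A, p * B, f} \<and> w \<in> UNIV} = ideal_gen {f, p}"
  proof (rule set_eqI, rule iffI)
    fix x assume "x \<in> {t + p * w | t w. t \<in> ideal_gen {p * A, p * B, f} \<and> w \<in> UNIV}"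
    then obtain k l m w where "x = k * (p * A) + (l * (p * B) + m * f) + p * w"
      by (auto simp: ideal_gen_triple)
    then have "x = m * f + (k * A + l * B + w) * p" by (simp add: algebra_simps)
    then show "x \<in> ideal_gen {f, p}" unfolding ideal_gen_pair by blast
  next
    fix x assume "x \<in> ideal_gen {f, p}"
    then obtain k l where "x = k * f + l * p" by (auto simp: ideal_gen_pair)
    then have "x = (0 * (p * A) + (0 * (p * B) + k * f)) + p * l" by (simp add: algebra_simps)
    moreover have "0 * (p * A) + (0 * (p * B) + k * f) \<in> ideal_gen {p * A, p * B, f}"
      unfolding ideal_gen_triple by blast
    ultimately show "x \<in> {t + p * w | t w. t \<in> ideal_gen {p * A, p * B, f} \<and> w \<in> UNIV}" by blast
  qed
qed

text \<open>The ideal J = (h * A, h * B, f) = (g * P, g * Q, f) has codimension t + n when counted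
  through (f, h) and t' + m when counted through (f, g). Finiteness of t' is obtained on the way,
  since (f, g) lies between J and the whole ring.\<close>

lemma codim_triple_compare:
  assumes cancel: "\<And>w. f dvd g * w \<Longrightarrow> f dvd w" "\<And>w. f dvd h * w \<Longrightarrow> f dvd w"
    and eq: "g * P = h * A + f * e" "g * Q = h * B + f * e'"
    and n: "codim (ideal_gen {f, h}) n" and m: "codim (ideal_gen {f, g}) m"
    and t: "codim (ideal_gen {A, B, f}) t"
  obtains t' where "codim (ideal_gen {P, Q, f}) t'" "t' + m = t + n"
proof -
  have "pser.rel_dim (ideal_gen {h * A, h * B, f}) {s + h * w | s w. s \<in> ideal_gen {h * A, h * B, f} \<and> w \<in> UNIV} t"
    by (rule rel_dim_image[OF linear_mult t])
      (simp_all add: subspace_ideal_gen codim_triple_mult(1)[OF cancel(2)])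
  then have "pser.rel_dim (ideal_gen {h * A, h * B, f}) (ideal_gen {f, h}) t"
    by (simp only: codim_triple_mult(2)[OF cancel(2), where A = A and B = B])
  then have tot: "codim (ideal_gen {h * A, h * B, f}) (t + n)" using pser.rel_dim_trans n by blast
  have ideals: "ideal_gen {h * A, h * B, f} = ideal_gen {g * P, g * Q, f}"
  proof (rule ideal_gen_eq)
    have "h * A = 1 * (g * P) + (0 * (g * Q) + (- e) * f)"
      "h * B = 0 * (g * P) + (1 * (g * Q) + (- e') * f)"
      using eq by (simp_all add: algebra_simps)
    then have "h * A \<in> ideal_gen {g * P, g * Q, f}" "h * B \<in> ideal_gen {g * P, g * Q, f}"
      unfolding ideal_gen_triple by blast+
    then show "{h * A, h * B, f} \<subseteq> ideal_gen {g * P, g * Q, f}" using ideal_gen_base by auto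
    have "g * P = 1 * (h * A) + (0 * (h * B) + e * f)"
      "g * Q = 0 * (h * A) + (1 * (h * B) + e' * f)"
      using eq by (simp_all add: algebra_simps)
    then have "g * P \<in> ideal_gen {h * A, h * B, f}" "g * Q \<in> ideal_gen {h * A, h * B, f}"
      unfolding ideal_gen_triple by blast+
    then show "{g * P, g * Q, f} \<subseteq> ideal_gen {h * A, h * B, f}" using ideal_gen_base by auto
  qed auto
  note tot' = tot[unfolded ideals]
  have sub: "ideal_gen {g * P, g * Q, f} \<subseteq> ideal_gen {f, g}"
  proof (rule ideal_gen_subset)
    have "g * P = 0 * f + P * g" "g * Q = 0 * f + Q * g" by simp_all
    then have "g * P \<in> ideal_gen {f, g}" "g * Q \<in> ideal_gen {f, g}"
      unfolding ideal_gen_pair by blast+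
    then show "{g * P, g * Q, f} \<subseteq> ideal_gen {f, g}" using ideal_gen_base by auto
  qed auto
  obtain m' t' where m': "codim (ideal_gen {f, g}) m'"
    and t': "pser.rel_dim (ideal_gen {g * P, g * Q, f}) (ideal_gen {f, g}) t'"
    using pser.rel_dim_between[OF tot' subspace_ideal_gen subspace_ideal_gen sub subset_UNIV] .
  have mm: "m' = m" using pser.rel_dim_unique[OF m m' subspace_ideal_gen] .
  have "t' + m = t + n"
    using pser.rel_dim_unique[OF tot' pser.rel_dim_trans[OF m t'] subspace_ideal_gen] .
  moreover have "pser.rel_dim {w \<in> UNIV. g * w \<in> ideal_gen {g * P, g * Q, f}}
      {w \<in> UNIV. g * w \<in> ideal_gen {f, g}} t'"
    by (rule rel_dim_vimage[OF linear_mult t' subspace_ideal_gen])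
      (simp_all add: codim_triple_mult(2)[OF cancel(1), simplified])
  moreover have "{w \<in> UNIV. g * w \<in> ideal_gen {f, g}} = UNIV"
  proof -
    have "g * w = 0 * f + w * g" for w by simp
    then have "g * w \<in> ideal_gen {f, g}" for w unfolding ideal_gen_pair by blast
    then show ?thesis by blast
  qed
  moreover have "{w \<in> UNIV. g * w \<in> ideal_gen {g * P, g * Q, f}} = ideal_gen {P, Q, f}"
    using codim_triple_mult(1)[OF cancel(1)] by simp
  ultimately show ?thesis using that by simp
qed

section \<open>Data attached to a reduced invariant curve\<close>

locale invariant_curve_setup =
  fixes P Q f k u :: pseries2 and G :: "pseries2 set"
    and \<gamma> :: "pseries2 \<Rightarrow> complex fps \<times> complex fps" and c :: complex
  assumes foliation: "singular_foliation (P, Q)"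
    and finG: "finite G" and unit: "u dvd 1" and f_eq: "f = u * \<Prod>G"
    and irr: "\<And>g. g \<in> G \<Longrightarrow> irreducible g"
    and nonassoc: "\<And>g h. g \<in> G \<Longrightarrow> h \<in> G \<Longrightarrow> g dvd h \<Longrightarrow> g = h"
    and f0: "value0 f = 0"
    and invariant: "P * deriv_y f - Q * deriv_x f = f * k"
    and prim: "\<And>g. g \<in> G \<Longrightarrow> primitive_parametrization (\<gamma> g) (ideal_gen {g})"
    and transversal: "subst2 f (fps_const c * fps_X, fps_X) \<noteq> 0"
begin

text \<open>The equation of a generic polar curve, and the corresponding combination of \<open>P\<close>, \<open>Q\<close>;
  they provide the factors in the definition of the GSV-index.\<close>

definition polar :: pseries2 where "polar = deriv_y f + scalar c * deriv_x f"
definition dual_polar :: pseries2 where "dual_polar = Q + scalar c * P"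

lemma f_nonzero: "f \<noteq> 0"
  using transversal by (auto simp: subst2_0)

lemma polar_decomposition:
  "polar * P = dual_polar * deriv_x f + f * k"
  "polar * Q = dual_polar * deriv_y f + f * (- scalar c * k)"
proof -
  have "polar * P - dual_polar * deriv_x f = f * k"
    unfolding polar_def dual_polar_def invariant[symmetric] by (simp add: algebra_simps)
  then show "polar * P = dual_polar * deriv_x f + f * k" by (simp add: algebra_simps)
  have "polar * Q - dual_polar * deriv_y f = - scalar c * (f * k)"
    unfolding polar_def dual_polar_def invariant[symmetric] by (simp add: algebra_simps)
  then show "polar * Q = dual_polar * deriv_y f + f * (- scalar c * k)" by (simp add: algebra_simps)
qed

text \<open>With f = g * e, the product rule modulo g reduces the claim to g itself, because g is
  prime and, f being reduced, does not divide e.\<close>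

lemma not_dvd_derivs:
  assumes "g \<in> G" shows "\<not> (g dvd deriv_x f \<and> g dvd deriv_y f)"
proof
  assume dv: "g dvd deriv_x f \<and> g dvd deriv_y f"
  define e where "e = u * \<Prod>(G - {g})"
  have fe: "f = g * e" using finG assms by (simp add: f_eq e_def prod.remove mult_ac)
  have "\<not> g dvd e"
  proof
    assume "g dvd e"
    moreover have "\<not> g dvd u" using unit irr[OF assms] by (auto simp: irreducible_def intro: dvd_trans)
    ultimately have "g dvd \<Prod>(G - {g})"
      unfolding e_def using irreducible_imp_prime[OF irr[OF assms]] by blast
    then obtain h where "h \<in> G - {g}" "g dvd h"
      using irreducible_dvd_prod[OF irr[OF assms], of "G - {g}"] finG by auto
    then show False using nonassoc assms by blast
  qed
  moreover have "g dvd deriv_x g * e" "g dvd deriv_y g * e"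
    using dv unfolding fe deriv_x_mult deriv_y_mult by (simp_all add: dvd_add_left_iff)
  ultimately have "g dvd deriv_x g \<and> g dvd deriv_y g"
    using irreducible_imp_prime[OF irr[OF assms]] by blast
  then show False using irreducible_not_dvd_derivs[OF irr[OF assms]] by blast
qed

section \<open>Values along an arbitrary primitive arc of a branch\<close>

context
  fixes g a b
  assumes g: "g \<in> G" and ab: "primitive_parametrization (a, b) (ideal_gen {g})"
begin

abbreviation "ev F \<equiv> subst2 F (a, b)"

lemma arc: "a $ 0 = 0" "b $ 0 = 0" "(a, b) \<noteq> (0, 0)" "ev g = 0"
  using primitive_arc[OF irr[OF g] ab] by auto

lemma ev_f: "ev f = 0"
proof -
  have "g dvd f" unfolding f_eq using dvd_prodI[OF finG g, of "\<lambda>x. x"] by simp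
  then show ?thesis using primitive_vanish_iff[OF irr[OF g] ab] by blast
qed

lemma ev_derivs: "ev (deriv_x f) * fps_deriv a + ev (deriv_y f) * fps_deriv b = 0"
  using fps_deriv_subst2[OF arc(1,2), of f] ev_f by simp

lemma ev_derivs_nonzero: "ev (deriv_x f) \<noteq> 0 \<or> ev (deriv_y f) \<noteq> 0"
  using not_dvd_derivs[OF g] primitive_vanish_iff[OF irr[OF g] ab] by blast

lemma ev_form_nonzero: "ev P \<noteq> 0 \<or> ev Q \<noteq> 0"
  using not_both_vanish_on_arc[OF series_ring_convergent _ _ _ arc(1-3)] foliation by auto

text \<open>Invariance makes (P, Q) and (f_x, f_y) proportional along the arc; the second
  annihilates the tangent vector and is not identically zero, so the first annihilates it as
  well.\<close>

lemma ev_form: "ev P * fps_deriv a + ev Q * fps_deriv b = 0"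
proof -
  let ?a = "fps_deriv a" and ?b = "fps_deriv b" and ?X = "ev (deriv_x f)" and ?Y = "ev (deriv_y f)"
  have "ev (P * deriv_y f - Q * deriv_x f) = 0" by (simp add: invariant subst2_mult arc ev_f)
  then have inv: "ev P * ?Y = ev Q * ?X" by (simp add: subst2_diff subst2_mult arc)
  have "?X * (ev P * ?a + ev Q * ?b) = ev P * (?X * ?a + ?Y * ?b) - (ev P * ?Y - ev Q * ?X) * ?b"
    by (simp add: algebra_simps)
  moreover have "?Y * (ev P * ?a + ev Q * ?b) = ev Q * (?X * ?a + ?Y * ?b) + (ev P * ?Y - ev Q * ?X) * ?a"
    by (simp add: algebra_simps)
  ultimately show ?thesis using ev_derivs_nonzero ev_derivs inv by auto
qed

lemma ev_line: "ev (line c) = a - fps_const c * b"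
  by (rule subst2_line[OF arc(1,2)])

lemma ev_line_nonzero: "ev (line c) \<noteq> 0" and ev_line_0: "ev (line c) $ 0 = 0"
proof -
  show "ev (line c) \<noteq> 0"
  proof
    \<comment> \<open>An arc on the line is the arc (c t, t) with b substituted for t, so
      \<open>f\<close> would vanish on the whole line.\<close>
    assume "ev (line c) = 0"
    then have a: "a = (fps_const c * fps_X) oo b"
      using arc(1,2) by (simp add: ev_line fps_compose_mult_distrib)
    then have "b \<noteq> 0" using arc(3) by auto
    have "subst2 f ((fps_const c * fps_X) oo b, fps_X oo b)
        = subst2 f (fps_const c * fps_X, fps_X) oo b"
      using arc(2) by (intro subst2_compose) auto
    then have "subst2 f (fps_const c * fps_X, fps_X) oo b = 0" using ev_f a arc(2) by simp
    then show False using transversal \<open>b \<noteq> 0\<close> arc(2) by (simp add: fps_compose_eq_0_iff)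
  qed
  show "ev (line c) $ 0 = 0" using arc(1,2) by (simp add: ev_line)
qed

lemma deriv_ev_line: "fps_deriv (ev (line c)) = fps_deriv a - fps_const c * fps_deriv b"
  by (simp add: ev_line)

lemma deriv_ev_line_nonzero: "fps_deriv (ev (line c)) \<noteq> 0"
  by (rule subdegree_fps_deriv(1)[OF ev_line_nonzero ev_line_0])

text \<open>A covector (A, B) with B = - c * A is a multiple of dx - c dy, whose value on the
  tangent vector is the derivative of the restricted line and hence not 0. The lemma serves both
  (f_x, f_y) and (P, Q).\<close>

lemma combination_nonzero:
  assumes "A * fps_deriv a + B * fps_deriv b = 0" "A \<noteq> 0 \<or> B \<noteq> 0"
  shows "B + fps_const c * A \<noteq> 0"
proof
  assume z: "B + fps_const c * A = 0"
  then have B: "B = - (fps_const c * A)" by (simp add: add_eq_0_iff)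
  have "A * fps_deriv (ev (line c)) = 0"
    using assms(1) unfolding deriv_ev_line B by (simp add: algebra_simps)
  then have "A = 0" using deriv_ev_line_nonzero by simp
  then show False using B assms(2) by simp
qed

lemma ev_polar_nonzero: "ev polar \<noteq> 0"
  using combination_nonzero[OF ev_derivs ev_derivs_nonzero]
  by (simp add: polar_def subst2_add subst2_mult subst2_scalar arc)

lemma ev_dual_polar: "ev dual_polar = ev Q + fps_const c * ev P"
  by (simp add: dual_polar_def subst2_add subst2_mult subst2_scalar arc)

lemma ev_dual_polar_nonzero: "ev dual_polar \<noteq> 0"
  using combination_nonzero[OF ev_form ev_form_nonzero] by (simp add: ev_dual_polar)

lemma multiplicity_along_branch:
  assumes "ev (- Q) = \<theta> * fps_deriv a" "ev P = \<theta> * fps_deriv b"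
  shows "subdegree \<theta> + subdegree (ev (line c)) = Suc (subdegree (ev dual_polar))"
proof -
  have "ev Q = - (\<theta> * fps_deriv a)" using assms(1) by (metis minus_minus subst2_uminus)
  then have eq: "ev dual_polar = - \<theta> * fps_deriv (ev (line c))"
    by (simp add: ev_dual_polar assms(2) deriv_ev_line algebra_simps)
  then have "\<theta> \<noteq> 0" using ev_dual_polar_nonzero by auto
  then have "subdegree (ev dual_polar) = subdegree \<theta> + subdegree (fps_deriv (ev (line c)))"
    using deriv_ev_line_nonzero by (simp add: eq)
  then show ?thesis using subdegree_fps_deriv(2)[OF ev_line_nonzero ev_line_0] by simp
qed

text \<open>If \<open>a\<close> divides \<open>b\<close>, then it divides \<open>Q(a, b)\<close>, because \<open>Q\<close> vanishes at the origin.\<close>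

lemma multiplicity_exists:
  obtains \<theta> where "ev (- Q) = \<theta> * fps_deriv a" "ev P = \<theta> * fps_deriv b"
proof -
  have dvd: "fps_deriv y dvd ev F"
    if y: "y \<noteq> 0" "y $ 0 = 0" "y dvd a" "y dvd b" and F: "value0 F = 0" for y F
  proof (cases "ev F = 0")
    case False
    obtain A B where "F = xvar * A + fps_X * B" using value0_eq_0_decompose[OF F] .
    then have "ev F = a * ev A + b * ev B"
      by (simp add: subst2_add subst2_mult subst2_xvar subst2_y arc)
    then have "y dvd ev F" using y by simp
    then have "subdegree y \<le> subdegree (ev F)" using False by (intro dvd_imp_subdegree_le)
    then have "subdegree (fps_deriv y) \<le> subdegree (ev F)"
      using subdegree_fps_deriv(2)[OF y(1,2)] by simp
    then show ?thesis
      using subdegree_le_imp_dvd_left_divring[OF subdegree_fps_deriv(1)[OF y(1,2)]] by (metis dvdI)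
  qed simp
  have PQ0: "value0 P = 0" "value0 Q = 0" using foliation by auto
  have dvd_iff: "y dvd z" if "y \<noteq> 0" "z = 0 \<or> subdegree y \<le> subdegree z" for y z :: "complex fps"
    using that subdegree_le_imp_dvd_left_divring[of y z] by (metis dvdI dvd_0_right)
  \<comment> \<open>C[[t]] is a valuation ring: the nonzero coordinate of least order divides the
    other one, and its derivative can then be divided out.\<close>
  have "(a \<noteq> 0 \<and> a dvd b) \<or> (b \<noteq> 0 \<and> b dvd a)"
    using dvd_iff[of a b] dvd_iff[of b a] arc(3)
    by (cases "a = 0"; cases "b = 0"; cases "subdegree a \<le> subdegree b") auto
  then show ?thesis
  proof
    assume a: "a \<noteq> 0 \<and> a dvd b"
    then obtain t where t: "ev Q = fps_deriv a * t"
      using dvd[of a Q] arc PQ0 by (auto elim: dvdE)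
    have da: "fps_deriv a \<noteq> 0" using subdegree_fps_deriv(1) a arc(1) by blast
    have "fps_deriv a * (ev P + t * fps_deriv b) = 0"
      using ev_form by (simp add: t algebra_simps)
    then have "ev P = - t * fps_deriv b" using da by (simp add: add_eq_0_iff2)
    then show ?thesis using that[of "- t"] t by (simp add: subst2_uminus)
  next
    assume b: "b \<noteq> 0 \<and> b dvd a"
    then obtain t where t: "ev P = fps_deriv b * t"
      using dvd[of b P] arc PQ0 by (auto elim: dvdE)
    have db: "fps_deriv b \<noteq> 0" using subdegree_fps_deriv(1) b arc(2) by blast
    have "fps_deriv b * (ev Q + t * fps_deriv a) = 0"
      using ev_form by (simp add: t algebra_simps)
    then have "ev Q = - t * fps_deriv a" using db by (simp add: add_eq_0_iff2)
    then show ?thesis using that[of t] t by (simp add: subst2_uminus)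
  qed
qed

end

text \<open>\<open>branch_multiplicity\<close> admits every primitive parametrization of the branch,
  while the other two terms use the chosen arc. The orders of \<open>line c\<close> and of
  \<open>dual_polar\<close> agree on both arcs, as each is the codimension of an ideal that contains
  g.\<close>

lemma branch_multiplicity_eq:
  assumes g: "g \<in> G"
  shows "branch_multiplicity (P, Q) (ideal_gen {g}) + subdegree (subst2 (line c) (\<gamma> g))
       = Suc (subdegree (subst2 dual_polar (\<gamma> g)))"
proof -
  let ?R = "\<lambda>m a b \<theta>. primitive_parametrization (a, b) (ideal_gen {g}) \<and>
     subst2 (fst (dual_field (P, Q))) (a, b) = \<theta> * fps_deriv a \<and>
     subst2 (snd (dual_field (P, Q))) (a, b) = \<theta> * fps_deriv b \<and> subdegree \<theta> = m"
  have main: "m + subdegree (subst2 (line c) (\<gamma> g)) = Suc (subdegree (subst2 dual_polar (\<gamma> g)))"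
    if R: "?R m a b \<theta>" for m a b \<theta>
  proof -
    obtain a0 b0 where ab0: "\<gamma> g = (a0, b0)" by (cases "\<gamma> g")
    have p0: "primitive_parametrization (a0, b0) (ideal_gen {g})" using prim[OF g] ab0 by simp
    have p: "primitive_parametrization (a, b) (ideal_gen {g})" using R by simp
    have same: "subdegree (subst2 F (a, b)) = subdegree (subst2 F (a0, b0))"
      if "subst2 F (a, b) \<noteq> 0" "subst2 F (a0, b0) \<noteq> 0" for F
      using pser.rel_dim_unique[OF codim_irreducible[OF irr[OF g] p0 that(2)]
          codim_irreducible[OF irr[OF g] p that(1)] subspace_ideal_gen] .
    have "m + subdegree (subst2 (line c) (a, b)) = Suc (subdegree (subst2 dual_polar (a, b)))"
      using multiplicity_along_branch[OF g p, of \<theta>] R by simp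
    then show ?thesis
      using same[OF ev_line_nonzero[OF g p] ev_line_nonzero[OF g p0]]
        same[OF ev_dual_polar_nonzero[OF g p] ev_dual_polar_nonzero[OF g p0]] ab0 by simp
  qed
  obtain a b where ab: "\<gamma> g = (a, b)" by (cases "\<gamma> g")
  have p: "primitive_parametrization (a, b) (ideal_gen {g})" using prim[OF g] ab by simp
  obtain \<theta> where "subst2 (- Q) (a, b) = \<theta> * fps_deriv a" "subst2 P (a, b) = \<theta> * fps_deriv b"
    using multiplicity_exists[OF g p] .
  then have R: "?R (subdegree \<theta>) a b \<theta>" using p by simp
  have "branch_multiplicity (P, Q) (ideal_gen {g}) = subdegree \<theta>"
    unfolding branch_multiplicity_def
  proof (rule the_equality)
    show "\<exists>a b \<theta>'. ?R (subdegree \<theta>) a b \<theta>'" using R by blast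
    fix m assume "\<exists>a b \<theta>. ?R m a b \<theta>"
    then obtain a' b' \<theta>' where R': "?R m a' b' \<theta>'" by blast
    show "m = subdegree \<theta>" using main[OF R'] main[OF R] by simp
  qed
  then show ?thesis using main[OF R] by simp
qed

section \<open>Components, coprimality and cancellation modulo the curve\<close>

lemma curve_components_eq: "curve_components f = (\<lambda>g. ideal_gen {g}) ` G"
proof (rule set_eqI, rule iffI)
  fix I assume "I \<in> curve_components f"
  then obtain p where p: "I = ideal_gen {p}" "irreducible p" "p dvd f"
    by (auto simp: curve_components_def)
  have "\<not> p dvd u" using p(2) unit by (auto simp: irreducible_def intro: dvd_trans)
  then have "p dvd \<Prod>G" using irreducible_imp_prime[OF p(2)] p(3) f_eq by blast
  then obtain g where g: "g \<in> G" "p dvd g" using irreducible_dvd_prod[OF p(2) finG] by blast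
  then have "g dvd p" using irreducible_associated[OF p(2) irr] by blast
  then have "I = ideal_gen {g}" unfolding p(1) using g(2)
    by (intro ideal_gen_eq) (auto simp: ideal_gen_single' mult.commute elim!: dvdE)
  then show "I \<in> (\<lambda>g. ideal_gen {g}) ` G" using g(1) by blast
next
  fix I assume "I \<in> (\<lambda>g. ideal_gen {g}) ` G"
  then obtain g where g: "g \<in> G" "I = ideal_gen {g}" by blast
  moreover have "g dvd f" unfolding f_eq using dvd_prodI[OF finG g(1), of "\<lambda>x. x"] by simp
  ultimately show "I \<in> curve_components f" using irr by (auto simp: curve_components_def)
qed

lemma inj_on_components: "inj_on (\<lambda>g. ideal_gen {g}) G"
proof (rule inj_onI)
  fix g h assume gh: "g \<in> G" "h \<in> G" "ideal_gen {g} = ideal_gen {h}"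
  then have "h \<in> ideal_gen {g}" using ideal_gen_base[of "{h}" h] by simp
  then have "g dvd h" by (auto simp: ideal_gen_single')
  then show "g = h" using nonassoc gh by blast
qed

lemma codim_f:
  assumes "\<And>g. g \<in> G \<Longrightarrow> \<not> g dvd F"
  shows "codim (ideal_gen {f, F}) (\<Sum>g\<in>G. subdegree (subst2 F (\<gamma> g)))"
  unfolding f_eq
proof (rule codim_prod[OF finG irr unit prim])
  fix g assume "g \<in> G"
  then show "subst2 F (\<gamma> g) \<noteq> 0"
    using assms prim irr primitive_vanish_iff by (cases "\<gamma> g") metis
qed auto

lemma not_dvd_nonvanishing: "g \<in> G \<Longrightarrow> subst2 F (\<gamma> g) \<noteq> 0 \<Longrightarrow> \<not> g dvd F"
  using prim irr primitive_vanish_iff by (cases "\<gamma> g") metis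

lemma not_dvd_polars:
  assumes "g \<in> G" shows "\<not> g dvd polar" "\<not> g dvd dual_polar" "\<not> g dvd line c"
proof -
  obtain a b where ab: "\<gamma> g = (a, b)" by (cases "\<gamma> g")
  have p: "primitive_parametrization (a, b) (ideal_gen {g})" using prim[OF assms] ab by simp
  show "\<not> g dvd polar" "\<not> g dvd dual_polar" "\<not> g dvd line c"
    using not_dvd_nonvanishing[OF assms] ev_polar_nonzero[OF assms p]
      ev_dual_polar_nonzero[OF assms p] ev_line_nonzero[OF assms p] ab by auto
qed

lemma relatively_prime_iff:
  "relatively_prime_in UNIV F f \<longleftrightarrow> (\<forall>g\<in>G. \<not> g dvd F)"
proof
  assume rp: "relatively_prime_in UNIV F f"
  show "\<forall>g\<in>G. \<not> g dvd F"
  proof (intro ballI notI)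
    fix g assume g: "g \<in> G" "g dvd F"
    moreover have "g dvd f" unfolding f_eq using dvd_prodI[OF finG g(1), of "\<lambda>x. x"] by simp
    ultimately have "\<exists>w\<in>UNIV. g * w = 1"
      using rp unfolding relatively_prime_in_def by (auto elim!: dvdE)
    then have "g dvd 1" by (metis dvdI)
    then show False using irr[OF g(1)] by (simp add: irreducible_def)
  qed
next
  assume nd: "\<forall>g\<in>G. \<not> g dvd F"
  show "relatively_prime_in UNIV F f"
    unfolding relatively_prime_in_def
  proof (intro ballI impI)
    fix d assume "(\<exists>v\<in>UNIV. F = d * v) \<and> (\<exists>v\<in>UNIV. f = d * v)"
    then have d: "d dvd F" "d dvd f" by auto
    have "d dvd 1"
    proof (rule ccontr)
      assume nu: "\<not> d dvd 1"
      have "d \<noteq> 0" using d(2) f_nonzero by auto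
      then obtain p where p: "irreducible p" "p dvd d" using irreducible_factor_exists nu by blast
      have "\<not> p dvd u" using p(1) unit by (auto simp: irreducible_def intro: dvd_trans)
      moreover have "p dvd u * \<Prod>G" using p(2) d(2) f_eq dvd_trans by blast
      ultimately have "p dvd \<Prod>G" using irreducible_imp_prime[OF p(1)] by blast
      then obtain g where g: "g \<in> G" "p dvd g" using irreducible_dvd_prod[OF p(1) finG] by blast
      then have "g dvd p" using irreducible_associated[OF p(1) irr] by blast
      then have "g dvd F" using p(2) d(1) dvd_trans by blast
      then show False using nd g(1) by blast
    qed
    then show "\<exists>w\<in>UNIV. d * w = 1" by (metis UNIV_I dvdE)
  qed
qed

text \<open>F is not a zero divisor modulo f; the induction removes one prime factor of f at a
  time.\<close>

lemma f_cancel: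
  assumes "\<And>g. g \<in> G \<Longrightarrow> \<not> g dvd F" "f dvd F * w" shows "f dvd w"
proof -
  have "\<And>w. \<Prod>H dvd F * w \<longrightarrow> \<Prod>H dvd w" if "finite H" "H \<subseteq> G" for H
    using that
  proof (induction H rule: finite_induct)
    case (insert g H)
    show ?case
    proof
      assume dv: "\<Prod>(insert g H) dvd F * w"
      then have dv': "g * \<Prod>H dvd F * w" using insert.hyps by simp
      then have "g dvd F * w" using dvd_mult_left by blast
      then have "g dvd w" using irreducible_imp_prime irr assms(1) insert.prems by blast
      then obtain w' where w': "w = g * w'" by (auto elim: dvdE)
      have "g \<noteq> 0" using irr[of g] insert.prems by auto
      moreover have "g * \<Prod>H dvd g * (F * w')" using dv' by (simp add: w' mult_ac)
      ultimately have "\<Prod>H dvd F * w'" by simp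
      then have "\<Prod>H dvd w'" using insert by blast
      then show "\<Prod>(insert g H) dvd w" using insert.hyps by (simp add: w')
    qed
  qed simp
  moreover have "\<Prod>G dvd F * w" using assms(2) f_eq dvd_mult_right by blast
  ultimately have "\<Prod>G dvd w" using finG by blast
  then obtain e where e: "w = \<Prod>G * e" by (auto elim: dvdE)
  obtain v where v: "1 = u * v" using unit by (auto elim: dvdE)
  have "w = (u * v) * (\<Prod>G * e)" by (simp add: e flip: v)
  then have "w = f * (v * e)" by (simp add: f_eq mult_ac)
  then show ?thesis by simp
qed

text \<open>Each branch contributes a difference of two orders plus 1, and these ones cancel the
  number of components subtracted in the definition.\<close>

lemma foliation_multiplicity_eq:
  "foliation_multiplicity (P, Q) f
     = int (\<Sum>g\<in>G. subdegree (subst2 dual_polar (\<gamma> g))) - int (\<Sum>g\<in>G. subdegree (subst2 (line c) (\<gamma> g))) + 1"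
proof -
  have "(\<Sum>I\<in>curve_components f. int (branch_multiplicity (P, Q) I))
      = (\<Sum>g\<in>G. int (branch_multiplicity (P, Q) (ideal_gen {g})))"
    unfolding curve_components_eq by (simp add: sum.reindex[OF inj_on_components])
  also have "\<dots> = (\<Sum>g\<in>G. int (subdegree (subst2 dual_polar (\<gamma> g)))
      - int (subdegree (subst2 (line c) (\<gamma> g))) + 1)"
    using branch_multiplicity_eq by (intro sum.cong) force+
  moreover have "card (curve_components f) = card G"
    unfolding curve_components_eq by (rule card_image[OF inj_on_components])
  ultimately show ?thesis
    by (simp add: foliation_multiplicity_def sum.distrib sum_subtractf)
qed

text \<open>Along a branch of the polar curve, the derivative of \<open>f\<close> is the product of \<open>f\<^sub>x\<close> and the
  derivative of \<open>line c\<close>.\<close>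

lemma polar_branch:
  assumes \<delta>: "irreducible \<delta>" "\<delta> dvd polar" and ab: "primitive_parametrization (a, b) (ideal_gen {\<delta>})"
  shows "subst2 f (a, b) \<noteq> 0 \<and> subst2 (deriv_x f) (a, b) \<noteq> 0 \<and> subst2 (line c) (a, b) \<noteq> 0 \<and>
    subdegree (subst2 f (a, b)) = subdegree (subst2 (deriv_x f) (a, b)) + subdegree (subst2 (line c) (a, b))"
proof -
  let ?e = "\<lambda>F. subst2 F (a, b)"
  have z: "a $ 0 = 0" "b $ 0 = 0" using primitive_arc[OF \<delta>(1) ab] by auto
  have f: "?e f \<noteq> 0"
  proof
    assume "?e f = 0"
    then have "\<delta> dvd f" using primitive_vanish_iff[OF \<delta>(1) ab] by blast
    moreover have "\<not> \<delta> dvd u" using \<delta>(1) unit by (auto simp: irreducible_def intro: dvd_trans)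
    ultimately have "\<delta> dvd \<Prod>G" using irreducible_imp_prime[OF \<delta>(1)] f_eq by blast
    then obtain g where g: "g \<in> G" "\<delta> dvd g" using irreducible_dvd_prod[OF \<delta>(1) finG] by blast
    then have "g dvd \<delta>" using irreducible_associated[OF \<delta>(1) irr] by blast
    then have "g dvd polar" using \<delta>(2) dvd_trans by blast
    then show False using not_dvd_polars g(1) by blast
  qed
  have "?e polar = 0" using primitive_vanish_iff[OF \<delta>(1) ab] \<delta>(2) by blast
  then have Y: "?e (deriv_y f) = - (fps_const c * ?e (deriv_x f))"
    by (simp add: polar_def subst2_add subst2_mult subst2_scalar z add_eq_0_iff2)
  have f0': "?e f $ 0 = 0" using f0 by (simp add: subst2_nth_0)
  have "fps_deriv (?e f) = ?e (deriv_x f) * (fps_deriv a - fps_const c * fps_deriv b)"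
    unfolding fps_deriv_subst2[OF z] Y by (simp add: algebra_simps)
  also have "fps_deriv a - fps_const c * fps_deriv b = fps_deriv (?e (line c))"
    by (simp add: subst2_line[OF z])
  finally have d: "fps_deriv (?e f) = ?e (deriv_x f) * fps_deriv (?e (line c))" .
  have nz: "?e (deriv_x f) \<noteq> 0" "fps_deriv (?e (line c)) \<noteq> 0"
    using subdegree_fps_deriv(1)[OF f f0'] d by auto
  have l: "?e (line c) \<noteq> 0" using nz(2) by auto
  have l0: "?e (line c) $ 0 = 0" using z by (simp add: subst2_line)
  have "subdegree (fps_deriv (?e f)) = subdegree (?e (deriv_x f)) + subdegree (fps_deriv (?e (line c)))"
    using nz by (simp add: d)
  then show ?thesis using f nz(1) l subdegree_fps_deriv(2)[OF f f0'] subdegree_fps_deriv(2)[OF l l0] by simp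
qed

lemma polar_nonzero: "polar \<noteq> 0"
proof -
  have "\<not> f dvd 1" using f0 by (simp add: pseries2_unit_iff)
  then have "G \<noteq> {}" using f_eq unit by auto
  then show ?thesis using not_dvd_polars(1) by fastforce
qed

text \<open>With D the polar and l the line, I(D, f) = I(D, f_x) + I(D, l) holds branch by branch on
  D. Since (D, f_x) = (f_x, f_y), the middle term is the Milnor number; on the line, D restricts to
  the derivative of the restriction of f, so the last term is I(f, l) - 1. Finiteness of the Milnor
  number, and with it of the Tjurina number, comes out of the same count.\<close>

lemma milnor_and_tjurina:
  obtains t where "codim (ideal_gen {deriv_x f, deriv_y f, f}) t" "tjurina_number f = t"
    and "int (milnor_number f) = int (\<Sum>g\<in>G. subdegree (subst2 polar (\<gamma> g)))
      - int (\<Sum>g\<in>G. subdegree (subst2 (line c) (\<gamma> g))) + 1"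
proof -
  have "\<exists>m l. codim (ideal_gen {polar, f}) (m + l) \<and> codim (ideal_gen {polar, deriv_x f}) m
      \<and> codim (ideal_gen {polar, line c}) l"
    by (rule codim_additive_relation[OF polar_nonzero]) (rule polar_branch)
  then obtain m l where m: "codim (ideal_gen {polar, f}) (m + l)" "codim (ideal_gen {polar, deriv_x f}) m"
    "codim (ideal_gen {polar, line c}) l" by blast
  have swap: "codim (ideal_gen {q, p}) n \<Longrightarrow> codim (ideal_gen {p, q}) n" for p q n
    by (simp add: insert_commute)
  have uniq: "codim (ideal_gen S) n \<Longrightarrow> codim (ideal_gen S) n' \<Longrightarrow> n' = n" for S n n'
    by (rule pser.rel_dim_unique[OF _ _ subspace_ideal_gen])
  \<comment> \<open>The count over the branches of the polar curve and the count over the branches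
    of f give the codimension of one and the same ideal.\<close>
  have 1: "m + l = (\<Sum>g\<in>G. subdegree (subst2 polar (\<gamma> g)))"
    by (rule uniq[OF codim_f swap[OF m(1)]]) (rule not_dvd_polars)
  let ?X = "(fps_const c * fps_X, fps_X) :: complex fps \<times> complex fps"
  have z: "(fps_const c * fps_X :: complex fps) $ 0 = 0" "(fps_X :: complex fps) $ 0 = 0" by simp_all
  have f0': "subst2 f ?X $ 0 = 0" using f0 by (simp add: subst2_nth_0)
  have D: "subst2 polar ?X = fps_deriv (subst2 f ?X)"
    unfolding fps_deriv_subst2[OF z]
    by (simp add: polar_def subst2_add subst2_mult subst2_scalar algebra_simps)
  have "subst2 polar ?X \<noteq> 0" unfolding D by (rule subdegree_fps_deriv(1)[OF transversal f0'])
  then have "codim (ideal_gen {line c, polar}) (subdegree (subst2 polar ?X))"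
    by (rule codim_irreducible[OF irreducible_line primitive_line])
  then have 2: "l = subdegree (subst2 polar ?X)" using uniq swap m(3) by blast
  have 3: "(\<Sum>g\<in>G. subdegree (subst2 (line c) (\<gamma> g))) = subdegree (subst2 f ?X)"
    by (rule uniq[OF swap[OF codim_irreducible[OF irreducible_line primitive_line transversal]] codim_f])
      (rule not_dvd_polars)
  have ideals: "ideal_gen {polar, deriv_x f} = ideal_gen {deriv_x f, deriv_y f}"
  proof (rule ideal_gen_eq)
    have "polar = scalar c * deriv_x f + 1 * deriv_y f" by (simp add: polar_def)
    then have "polar \<in> ideal_gen {deriv_x f, deriv_y f}" unfolding ideal_gen_pair by blast
    then show "{polar, deriv_x f} \<subseteq> ideal_gen {deriv_x f, deriv_y f}" using ideal_gen_base by auto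
    have "deriv_y f = 1 * polar + (- scalar c) * deriv_x f" by (simp add: polar_def)
    then have "deriv_y f \<in> ideal_gen {polar, deriv_x f}" unfolding ideal_gen_pair by blast
    then show "{deriv_x f, deriv_y f} \<subseteq> ideal_gen {polar, deriv_x f}" using ideal_gen_base by auto
  qed auto
  then have milnor: "milnor_number f = m"
    unfolding milnor_number_def using m(2) quotient_dim_ideal_gen by simp
  have sub: "ideal_gen {deriv_x f, deriv_y f} \<subseteq> ideal_gen {deriv_x f, deriv_y f, f}"
    by (rule ideal_gen_subset) (use ideal_gen_base in auto)
  obtain t s where t: "codim (ideal_gen {deriv_x f, deriv_y f, f}) t"
    and "pser.rel_dim (ideal_gen {deriv_x f, deriv_y f}) (ideal_gen {deriv_x f, deriv_y f, f}) s"
    using pser.rel_dim_between[OF m(2)[unfolded ideals] subspace_ideal_gen subspace_ideal_gen sub subset_UNIV] .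
  have "{f, deriv_x f, deriv_y f} = {deriv_x f, deriv_y f, f}" by auto
  then have "tjurina_number f = t" unfolding tjurina_number_def using quotient_dim_ideal_gen[OF t] by simp
  moreover have "Suc l = (\<Sum>g\<in>G. subdegree (subst2 (line c) (\<gamma> g)))"
    unfolding 3 2 D by (rule subdegree_fps_deriv(2)[OF transversal f0'])
  then have "int (milnor_number f) = int (\<Sum>g\<in>G. subdegree (subst2 polar (\<gamma> g)))
      - int (\<Sum>g\<in>G. subdegree (subst2 (line c) (\<gamma> g))) + 1"
    using 1 milnor by linarith
  ultimately show ?thesis using t that by blast
qed

lemma gsv_and_milnor:
  "gsv_index (P, Q) f = foliation_multiplicity (P, Q) f - int (milnor_number f) \<and>
   foliation_multiplicity (P, Q) f - int (foliation_tjurina_number (P, Q) f) =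
   int (milnor_number f) - int (tjurina_number f)"
proof -
  obtain t where t: "codim (ideal_gen {deriv_x f, deriv_y f, f}) t" "tjurina_number f = t"
    and milnor: "int (milnor_number f) = int (\<Sum>g\<in>G. subdegree (subst2 polar (\<gamma> g)))
      - int (\<Sum>g\<in>G. subdegree (subst2 (line c) (\<gamma> g))) + 1"
    using milnor_and_tjurina .
  let ?N = "\<lambda>F. \<Sum>g\<in>G. subdegree (subst2 F (\<gamma> g))"
  have im: "intersection_multiplicity f F = ?N F" if "\<And>g. g \<in> G \<Longrightarrow> \<not> g dvd F" for F
    unfolding intersection_multiplicity_def by (rule quotient_dim_ideal_gen[OF codim_f[OF that]])
  \<comment> \<open>The right-hand side does not mention q and h: this makes the index well defined,
    and for the polar pair it yields the second equation.\<close>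
  have main: "int (?N h) - int (?N q) = int (foliation_tjurina_number (P, Q) f) - int t"
    if q: "\<And>g. g \<in> G \<Longrightarrow> \<not> g dvd q" and h: "\<And>g. g \<in> G \<Longrightarrow> \<not> g dvd h"
      and eq: "q * P = h * deriv_x f + f * e" "q * Q = h * deriv_y f + f * e'" for q h e e'
  proof -
    obtain t' where "codim (ideal_gen {P, Q, f}) t'" "t' + ?N q = t + ?N h"
      using codim_triple_compare[OF f_cancel[OF q] f_cancel[OF h] eq codim_f[OF h] codim_f[OF q] t(1)] .
    moreover from this(1) have "foliation_tjurina_number (P, Q) f = t'"
      using quotient_dim_ideal_gen[of "{P, Q, f}" t'] by simp
    ultimately show ?thesis by linarith
  qed
  have polar: "int (?N dual_polar) - int (?N polar) = int (foliation_tjurina_number (P, Q) f) - int t"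
    by (rule main[OF _ _ polar_decomposition]) (simp_all add: not_dvd_polars)
  have "gsv_index (P, Q) f = int (?N dual_polar) - int (?N polar)"
    unfolding gsv_index_def
  proof (rule the_equality)
    have "relatively_prime_in UNIV polar f" "relatively_prime_in UNIV dual_polar f"
      using relatively_prime_iff not_dvd_polars by auto
    moreover have "scale_form polar (P, Q) = scale_form dual_polar (differential f)
        + scale_form f (k, - scalar c * k)"
      using polar_decomposition by (simp add: differential_def)
    ultimately show "\<exists>g h \<eta>. relatively_prime_in UNIV g f \<and> relatively_prime_in UNIV h f \<and>
        scale_form g (P, Q) = scale_form h (differential f) + scale_form f \<eta> \<and>
        int (?N dual_polar) - int (?N polar)
          = int (intersection_multiplicity f h) - int (intersection_multiplicity f g)"
      using im[OF not_dvd_polars(1)] im[OF not_dvd_polars(2)] by metis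
  next
    fix i
    assume "\<exists>g h \<eta>. relatively_prime_in UNIV g f \<and> relatively_prime_in UNIV h f \<and>
        scale_form g (P, Q) = scale_form h (differential f) + scale_form f \<eta> \<and>
        i = int (intersection_multiplicity f h) - int (intersection_multiplicity f g)"
    then obtain q h e e' where *: "relatively_prime_in UNIV q f" "relatively_prime_in UNIV h f"
        "scale_form q (P, Q) = scale_form h (differential f) + scale_form f (e, e')"
        "i = int (intersection_multiplicity f h) - int (intersection_multiplicity f q)"
      by (metis surj_pair)
    have q: "\<And>g. g \<in> G \<Longrightarrow> \<not> g dvd q" and h: "\<And>g. g \<in> G \<Longrightarrow> \<not> g dvd h"
      using * relatively_prime_iff by blast+
    have eq: "q * P = h * deriv_x f + f * e" "q * Q = h * deriv_y f + f * e'"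
      using *(3) by (simp_all add: differential_def)
    have "int (?N h) - int (?N q) = int (foliation_tjurina_number (P, Q) f) - int t"
      by (rule main[OF _ _ eq]) (use q h in blast)+
    moreover have "intersection_multiplicity f q = ?N q" "intersection_multiplicity f h = ?N h"
      using im q h by blast+
    ultimately show "i = int (?N dual_polar) - int (?N polar)" using *(4) polar by linarith
  qed
  then show ?thesis using polar milnor foliation_multiplicity_eq t(2) by linarith
qed

end

theorem proposition4p1:
  fixes \<omega> :: form1 and f :: pseries2
  assumes "singular_foliation \<omega>" and "reduced_curve f" and "invariant_curve \<omega> f"
  shows "gsv_index \<omega> f = foliation_multiplicity \<omega> f - int (milnor_number f) \<and>
         foliation_multiplicity \<omega> f - int (foliation_tjurina_number \<omega> f) =
         int (milnor_number f) - int (tjurina_number f)"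
proof -
  obtain P Q where \<omega>: "\<omega> = (P, Q)" by (cases \<omega>)
  have f: "value0 f = 0" "squarefree f" using assms(2) by (auto simp: reduced_curve_def)
  have "f \<noteq> 0" using f(2) by auto
  obtain k where k: "P * deriv_y f - Q * deriv_x f = f * k"
    using assms(3) by (auto simp: invariant_curve_def \<omega> differential_def)
  obtain u G where G: "finite G" "u dvd 1" "f = u * \<Prod>G" "\<And>g. g \<in> G \<Longrightarrow> irreducible g"
    "\<And>g h. g \<in> G \<Longrightarrow> h \<in> G \<Longrightarrow> g dvd h \<Longrightarrow> g = h"
    using squarefree_factorization[OF f(2)] by metis
  have "\<exists>\<gamma>. primitive_parametrization \<gamma> (ideal_gen {g})" if "irreducible g" for g
    using irreducible_has_primitive_parametrization[OF that] by metis
  then obtain \<gamma> where \<gamma>: "\<And>g. irreducible g \<Longrightarrow> primitive_parametrization (\<gamma> g) (ideal_gen {g})"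
    by metis
  obtain c where c: "subst2 f (fps_const c * fps_X, fps_X) \<noteq> 0"
    using exists_transversal_line[OF \<open>f \<noteq> 0\<close>] .
  interpret invariant_curve_setup P Q f k u G \<gamma> c
    by unfold_locales (use assms(1) \<omega> f G k \<gamma> c in auto)
  show ?thesis unfolding \<omega> by (rule gsv_and_milnor)
qed

end
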